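(* Let $c>0$ and $\gamma\in\mathbb R\setminus\{0\}$. Let $n\to\infty$ with $k=k(n)\to\infty$, $\frac kn\to c$, and let $q=q(n)=e^{-\gamma/n}$. For each $n$ let $\lambda$ be a random Young diagram in the $n\times k$ rectangle distributed according to one of the two probability measures (A) $\displaystyle \mu_{n,k}(\lambda|q)=\frac{s_\lambda(1,q,\dots,q^{n-1})\,s_{\bar\lambda'}(1,q,\dots,q^{k-1})}{\prod_{i=1}^n\prod_{j=1}^k(q^{i-1}+q^{j-1})}$, (B) $\displaystyle \mu_{n,k}(\lambda|q,q^{-1})=\frac{s_\lambda(1,q,\dots,q^{n-1})\,s_{\bar\lambda'}(1,q^{-1},\dots,q^{1-k})}{\prod_{i=1}^n\prod_{j=1}^k(q^{i-1}+q^{1-j})}$, and consider the random point process $\{x_i=\frac{a_i}{n}\}_{i=1}^n$ with $a_i=\lambda_i+n-i$. Define real numbers $a>0$ and $b$ in case (A) by $$a=\tfrac14\sqrt{(e^\gamma-1)(e^\gamma+1)(e^{c\gamma}-1)(e^{c\gamma}+1)},\qquad b=\frac{1+e^{\gamma(c+1)}}{2},$$ and in case (B) by $$a=\frac{e^{c\gamma}}{(1+e^{c\gamma})^2}\sqrt{2(e^\gamma-1)(e^{c\gamma}-1)(1+e^{\gamma(c+1)})},\qquad b=\frac{3e^{\gamma(2c+1)}-e^{\gamma(c+1)}+3e^{c\gamma}-e^{2c\gamma}}{(1+e^{c\gamma})^2}.$$ Then for every linear statistic $$X^{(n)}_f=\sum_{i=1}^n f(e^{\gamma x_i}),$$ where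 $f\in C^1([b-2a,b+2a])$ is real-valued and extended to a $C^1$ function on $\mathbb R$, one has $$X_f^{(n)}-\mathbb E X_f^{(n)}\longrightarrow\mathcal N\left(0,\sum_{l\ge1}l\,|\widehat f_l|^2\right)$$ in distribution as $n,k\to\infty$, where $$\widehat f_l=\frac1{2\pi}\int_0^{2\pi}f(2a\cos\theta+b)\,e^{-il\theta}\,d\theta .$$
   Context: $s_\mu$ denotes the Schur polynomial. For $\lambda$ with at most $n$ rows and at most $k$ columns, $\bar\lambda$ is the complement in the $n\times k$ rectangle, $\bar\lambda_i=k-\lambda_{n+1-i}$, and $\bar\lambda'$ is its conjugate (transposed) diagram. The interval $[b-2a,b+2a]$ is the support of the limit density of the points $x_i$ expressed in the variable $e^{\gamma t}$, where the limit density is $$\rho(t)=\frac1\pi\arccos\left(\mathrm{sgn}(-\gamma)\frac{e^{\gamma-\frac{\gamma t}2}}{2}\frac{1-e^{\gamma(c-1)}}{\sqrt{(1-e^{\gamma t})(1-e^{\gamma(c+1-t)})}}\right)$$ in case (A), and $$\rho(t)=\frac1\pi\arccos\left(\mathrm{sgn}(-\gamma)\frac{e^{\frac\gamma2(t-c)}}{2}\frac{1-e^{\gamma c}-e^{\gamma(c-t)}+e^{\gamma(c+1-t)}}{\sqrt{(1-e^{\gamma t})(1-e^{\gamma(c+1-t)})}}\right)$$ in case (B); here "support" means the set of $e^{\gamma t}$, $0<t<c+1$, for which the argument of $\arccos$ lies in $[-1,1]$. $\mathcal N(0,\sigma^2)$ is the centered normal distribution with variance $\sigma^2$. *)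

theory Defs
  imports "HOL-Probability.Probability"
begin

text \<open>
  A partition is a weakly decreasing function \<open>nat \<Rightarrow> nat\<close> that is eventually zero; rows, columns
  and variables are counted from 0. Thus row \<open>i\<close> has length \<open>\<mu> i\<close>, and the \<open>\<mu>\<^sub>i\<close> of the usual
  1-based notation is \<open>\<mu> (i - 1)\<close>.
\<close>

definition cells :: "(nat \<Rightarrow> nat) \<Rightarrow> (nat \<times> nat) set" where
  "cells \<mu> = {(i, j). j < \<mu> i}"

text \<open>Fillings are made extensional outside the diagram, so that each tableau is counted once.\<close>

definition ssyt :: "nat \<Rightarrow> (nat \<Rightarrow> nat) \<Rightarrow> (nat \<times> nat \<Rightarrow> nat) set" where
  "ssyt m \<mu> = {T \<in> cells \<mu> \<rightarrow>\<^sub>E {..<m}.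
     (\<forall>i j j'. j < j' \<and> (i, j') \<in> cells \<mu> \<longrightarrow> T (i, j) \<le> T (i, j')) \<and>
     (\<forall>i i' j. i < i' \<and> (i', j) \<in> cells \<mu> \<longrightarrow> T (i, j) < T (i', j))}"

text \<open>The Schur polynomial \<open>s\<^sub>\<mu>(x 0, \<dots>, x (m - 1))\<close>.\<close>

definition schur :: "nat \<Rightarrow> (nat \<Rightarrow> real) \<Rightarrow> (nat \<Rightarrow> nat) \<Rightarrow> real" where
  "schur m x \<mu> = (\<Sum>T\<in>ssyt m \<mu>. \<Prod>p\<in>cells \<mu>. x (T p))"

definition young_box :: "nat \<Rightarrow> nat \<Rightarrow> (nat \<Rightarrow> nat) set" where
  "young_box n k = {\<nu>. antimono \<nu> \<and> (\<forall>i. \<nu> i \<le> k) \<and> (\<forall>i\<ge>n. \<nu> i = 0)}"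

definition box_complement :: "nat \<Rightarrow> nat \<Rightarrow> (nat \<Rightarrow> nat) \<Rightarrow> nat \<Rightarrow> nat" where
  "box_complement n k \<nu> i = (if i < n then k - \<nu> (n - Suc i) else 0)"

definition conjugate :: "(nat \<Rightarrow> nat) \<Rightarrow> nat \<Rightarrow> nat" where
  "conjugate \<nu> j = card {i. j < \<nu> i}"

text \<open>
  The probability of \<open>\<nu>\<close> for the specialisation
  \<open>x = (1, q, \<dots>, q\<^sup>n\<^sup>-\<^sup>1)\<close>, \<open>y = (1, p, \<dots>, p\<^sup>k\<^sup>-\<^sup>1)\<close>: the measure \<open>\<mu>\<^sub>n\<^sub>,\<^sub>k(\<nu>|q)\<close> is the case \<open>p = q\<close> and
  \<open>\<mu>\<^sub>n\<^sub>,\<^sub>k(\<nu>|q,q\<^sup>-\<^sup>1)\<close> is the case \<open>p = inverse q\<close>.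
\<close>

definition schur_prob :: "nat \<Rightarrow> nat \<Rightarrow> real \<Rightarrow> real \<Rightarrow> (nat \<Rightarrow> nat) \<Rightarrow> real" where
  "schur_prob n k q p \<nu> =
     schur n (\<lambda>i. q ^ i) \<nu> * schur k (\<lambda>j. p ^ j) (conjugate (box_complement n k \<nu>)) /
     (\<Prod>i<n. \<Prod>j<k. q ^ i + p ^ j)"

text \<open>The random diagram \<open>\<Lambda>\<close> on the probability space \<open>M\<close> has the law \<open>schur_prob n k q p\<close>.\<close>

definition random_diagram ::
    "'w measure \<Rightarrow> ('w \<Rightarrow> nat \<Rightarrow> nat) \<Rightarrow> nat \<Rightarrow> nat \<Rightarrow> real \<Rightarrow> real \<Rightarrow> bool" where
  "random_diagram M \<Lambda> n k q p \<longleftrightarrow>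
     prob_space M \<and>
     \<Lambda> \<in> measurable M (count_space (young_box n k)) \<and>
     (\<forall>\<nu>\<in>young_box n k. measure M {\<omega> \<in> space M. \<Lambda> \<omega> = \<nu>} = schur_prob n k q p \<nu>)"

definition point :: "nat \<Rightarrow> (nat \<Rightarrow> nat) \<Rightarrow> nat \<Rightarrow> real" where
  "point n \<nu> i = real (\<nu> i + n - Suc i) / real n"

definition linear_statistic :: "real \<Rightarrow> (real \<Rightarrow> real) \<Rightarrow> nat \<Rightarrow> (nat \<Rightarrow> nat) \<Rightarrow> real" where
  "linear_statistic \<gamma> f n \<nu> = (\<Sum>i<n. f (exp (\<gamma> * point n \<nu> i)))"

definition a_A :: "real \<Rightarrow> real \<Rightarrow> real" where
  "a_A \<gamma> c = 1 / 4 * sqrt ((exp \<gamma> - 1) * (exp \<gamma> + 1) * (exp (c * \<gamma>) - 1) * (exp (c * \<gamma>) + 1))"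

definition b_A :: "real \<Rightarrow> real \<Rightarrow> real" where
  "b_A \<gamma> c = (1 + exp (\<gamma> * (c + 1))) / 2"

definition a_B :: "real \<Rightarrow> real \<Rightarrow> real" where
  "a_B \<gamma> c = exp (c * \<gamma>) / (1 + exp (c * \<gamma>))\<^sup>2 *
     sqrt (2 * (exp \<gamma> - 1) * (exp (c * \<gamma>) - 1) * (1 + exp (\<gamma> * (c + 1))))"

definition b_B :: "real \<Rightarrow> real \<Rightarrow> real" where
  "b_B \<gamma> c = (3 * exp (\<gamma> * (2 * c + 1)) - exp (\<gamma> * (c + 1)) + 3 * exp (c * \<gamma>) - exp (2 * c * \<gamma>)) /
     (1 + exp (c * \<gamma>))\<^sup>2"

definition fourier_coeff :: "real \<Rightarrow> real \<Rightarrow> (real \<Rightarrow> real) \<Rightarrow> nat \<Rightarrow> complex" where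
  "fourier_coeff a b f l = 1 / (2 * of_real pi) *
     integral {0..2 * pi} (\<lambda>\<theta>. of_real (f (2 * a * cos \<theta> + b)) * exp (- (\<i> * of_nat l * of_real \<theta>)))"

text \<open>
  The normal distribution with mean 0 and variance \<open>v \<ge> 0\<close>, as the law of \<open>sqrt v * Z\<close> with \<open>Z\<close>
  standard normal, so that \<open>v = 0\<close> gives the point mass at 0; for \<open>v > 0\<close> it has the usual density.
\<close>

definition centered_normal :: "real \<Rightarrow> real measure" where
  "centered_normal v = distr std_normal_distribution borel (\<lambda>x. sqrt v * x)"

lemma centered_normal_0: "centered_normal 0 = return borel 0"
proof -
  interpret prob_space std_normal_distribution
    by (rule prob_space_normal_density) simp
  have "distr std_normal_distribution borel (\<lambda>x. 0) = return borel (0 :: real)"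
    by (rule distr_const) simp
  then show ?thesis
    by (simp add: centered_normal_def)
qed

lemma centered_normal_density:
  assumes "v > 0"
  shows "centered_normal v = density lborel (normal_density 0 (sqrt v))"
proof -
  interpret prob_space std_normal_distribution
    by (rule prob_space_normal_density) simp
  have "distributed std_normal_distribution lborel (\<lambda>x. x) std_normal_density"
    by (simp add: distributed_def distr_id2)
  from normal_density_affine[OF this, of "sqrt v" 0]
  have "distributed std_normal_distribution lborel (\<lambda>x. sqrt v * x) (normal_density 0 (sqrt v))"
    using assms by simp
  then have "distr std_normal_distribution lborel (\<lambda>x. sqrt v * x)
      = density lborel (normal_density 0 (sqrt v))"
    by (simp add: distributed_def)
  moreover have "distr std_normal_distribution lborel (\<lambda>x. sqrt v * x)
      = distr std_normal_distribution borel (\<lambda>x. sqrt v * x)"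
    by (intro distr_cong) simp_all
  ultimately show ?thesis
    by (simp add: centered_normal_def)
qed

text \<open>
  The limit density of the points is \<open>arccos u / \<pi>\<close> on \<open>(0, c + 1)\<close>, where \<open>u\<close> is the following
  expression. In the variable \<open>exp (\<gamma> * t)\<close> its support is \<open>[b - 2a, b + 2a]\<close>; the closure only
  matters when this interval reaches an end of the range (e.g. for the first measure with \<open>c = 1\<close>).
\<close>

definition arccos_arg_A :: "real \<Rightarrow> real \<Rightarrow> real \<Rightarrow> real" where
  "arccos_arg_A \<gamma> c t = sgn (- \<gamma>) * (exp (\<gamma> - \<gamma> * t / 2) / 2) *
     ((1 - exp (\<gamma> * (c - 1))) / sqrt ((1 - exp (\<gamma> * t)) * (1 - exp (\<gamma> * (c + 1 - t)))))"

definition arccos_arg_B :: "real \<Rightarrow> real \<Rightarrow> real \<Rightarrow> real" where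
  "arccos_arg_B \<gamma> c t = sgn (- \<gamma>) * (exp (\<gamma> / 2 * (t - c)) / 2) *
     ((1 - exp (\<gamma> * c) - exp (\<gamma> * (c - t)) + exp (\<gamma> * (c + 1 - t))) /
      sqrt ((1 - exp (\<gamma> * t)) * (1 - exp (\<gamma> * (c + 1 - t)))))"

lemma exp_prod_pos:
  fixes \<gamma> s t :: real
  assumes "\<gamma> \<noteq> 0" "s > 0" "t > 0"
  shows "(1 - exp (\<gamma> * s)) * (1 - exp (\<gamma> * t)) > 0"
proof (cases "\<gamma> > 0")
  case True
  then show ?thesis using assms by (intro mult_neg_neg) auto
next
  case False
  then have "\<gamma> * s < 0" "\<gamma> * t < 0" using assms by (auto simp: mult_neg_pos)
  then show ?thesis by (intro mult_pos_pos) auto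
qed

lemma support_aux:
  fixes \<gamma> c a b :: real
  assumes \<gamma>: "\<gamma> \<noteq> 0" and c: "c > 0" and a: "a > 0"
    and u: "\<And>t. 0 < t \<Longrightarrow> t < c + 1 \<Longrightarrow> u t \<in> {-1..1} \<longleftrightarrow> (exp (\<gamma> * t) - b)\<^sup>2 \<le> (2 * a)\<^sup>2"
    and E: "\<And>y. (y - b)\<^sup>2 < (2 * a)\<^sup>2 \<Longrightarrow> (1 - y) * (y - exp (\<gamma> * (c + 1))) > 0"
  shows "closure ((\<lambda>t. exp (\<gamma> * t)) ` {t. 0 < t \<and> t < c + 1 \<and> u t \<in> {-1..1}}) = {b - 2 * a..b + 2 * a}"
    (is "closure ?S = _")
proof
  have "?S \<subseteq> {b - 2 * a..b + 2 * a}"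
  proof
    fix y assume "y \<in> ?S"
    then have "(y - b)\<^sup>2 \<le> (2 * a)\<^sup>2" using u by auto
    then have "\<bar>y - b\<bar> \<le> 2 * a" using a power2_le_iff_abs_le[of "2 * a" "y - b"] by simp
    then show "y \<in> {b - 2 * a..b + 2 * a}" by auto
  qed
  then show "closure ?S \<subseteq> {b - 2 * a..b + 2 * a}"
    by (rule closure_minimal) simp
  have "{b - 2 * a<..<b + 2 * a} \<subseteq> ?S"
  proof
    fix y assume y: "y \<in> {b - 2 * a<..<b + 2 * a}"
    then have "\<bar>y - b\<bar> < \<bar>2 * a\<bar>" using a by auto
    then have yb: "(y - b)\<^sup>2 < (2 * a)\<^sup>2"
      using abs_le_square_iff[of "2 * a" "y - b"] by linarith
    from E[OF this] have y1: "(1 < y \<and> y < exp (\<gamma> * (c + 1))) \<or> (exp (\<gamma> * (c + 1)) < y \<and> y < 1)"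
      by (auto simp: zero_less_mult_iff)
    then have "y > 0" using exp_gt_zero[of "\<gamma> * (c + 1)"] by linarith
    define t where "t = ln y / \<gamma>"
    have yt: "y = exp (\<gamma> * t)" using \<gamma> \<open>y > 0\<close> by (simp add: t_def)
    have "(0 < \<gamma> * t \<and> \<gamma> * t < \<gamma> * (c + 1)) \<or> (\<gamma> * (c + 1) < \<gamma> * t \<and> \<gamma> * t < 0)"
      using y1 by (simp add: yt)
    then have "0 < t \<and> t < c + 1"
      using c \<gamma> by (auto simp: mult_less_cancel_left zero_less_mult_iff mult_less_0_iff)
    then show "y \<in> ?S" using u[of t] yb yt by auto
  qed
  then have "closure {b - 2 * a<..<b + 2 * a} \<subseteq> closure ?S"
    by (rule closure_mono)
  then show "{b - 2 * a..b + 2 * a} \<subseteq> closure ?S"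
    using a by simp
qed


lemma arccos_arg_unit_iff:
  fixes N D e :: real
  assumes "D > 0"
  shows "sgn s * e * (N / sqrt D) \<in> {-1..1} \<longleftrightarrow> s = 0 \<or> (e * N)\<^sup>2 \<le> D"
proof (cases "s = 0")
  case False
  have "sgn s * e * (N / sqrt D) \<in> {-1..1} \<longleftrightarrow> \<bar>sgn s * e * (N / sqrt D)\<bar> \<le> 1"
    unfolding atLeastAtMost_iff by linarith
  also have "\<bar>sgn s * e * (N / sqrt D)\<bar> = \<bar>e * N\<bar> / sqrt D"
    using False assms by (simp add: abs_mult)
  also have "\<dots> \<le> 1 \<longleftrightarrow> \<bar>e * N\<bar> \<le> sqrt D"
    using assms by simp
  also have "\<dots> \<longleftrightarrow> (e * N)\<^sup>2 \<le> D"
    by (simp flip: real_sqrt_abs)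
  finally show ?thesis using False by simp
qed simp

lemma a_A_square:
  assumes "\<gamma> \<noteq> 0" "c > 0"
  shows "a_A \<gamma> c > 0"
    and "(2 * a_A \<gamma> c)\<^sup>2 = (exp \<gamma> - 1) * (exp \<gamma> + 1) * (exp (c * \<gamma>) - 1) * (exp (c * \<gamma>) + 1) / 4"
proof -
  have pos: "(exp \<gamma> - 1) * (exp (c * \<gamma>) - 1) > 0"
    using exp_prod_pos[of \<gamma> 1 c] assms by (simp add: algebra_simps)
  have "(exp \<gamma> - 1) * (exp (c * \<gamma>) - 1) * ((exp \<gamma> + 1) * (exp (c * \<gamma>) + 1)) > 0"
    by (intro mult_pos_pos[OF pos] mult_pos_pos add_pos_pos) simp_all
  then have *: "(exp \<gamma> - 1) * (exp \<gamma> + 1) * (exp (c * \<gamma>) - 1) * (exp (c * \<gamma>) + 1) > 0"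
    by (simp only: mult_ac)
  then show "a_A \<gamma> c > 0" by (simp add: a_A_def)
  show "(2 * a_A \<gamma> c)\<^sup>2 = (exp \<gamma> - 1) * (exp \<gamma> + 1) * (exp (c * \<gamma>) - 1) * (exp (c * \<gamma>) + 1) / 4"
    unfolding a_A_def power_mult_distrib real_sqrt_pow2[OF less_imp_le[OF *]]
    by (simp add: power2_eq_square)
qed

lemma a_B_square:
  assumes "\<gamma> \<noteq> 0" "c > 0"
  shows "a_B \<gamma> c > 0"
    and "(2 * a_B \<gamma> c)\<^sup>2 = 8 * (exp (c * \<gamma>))\<^sup>2 * (exp \<gamma> - 1) * (exp (c * \<gamma>) - 1) *
           (1 + exp (\<gamma> * (c + 1))) / ((1 + exp (c * \<gamma>))\<^sup>2)\<^sup>2"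
proof -
  have pos: "(exp \<gamma> - 1) * (exp (c * \<gamma>) - 1) > 0"
    using exp_prod_pos[of \<gamma> 1 c] assms by (simp add: algebra_simps)
  have "(exp \<gamma> - 1) * (exp (c * \<gamma>) - 1) * (2 * (1 + exp (\<gamma> * (c + 1)))) > 0"
    by (intro mult_pos_pos[OF pos] mult_pos_pos add_pos_pos) simp_all
  then have *: "2 * (exp \<gamma> - 1) * (exp (c * \<gamma>) - 1) * (1 + exp (\<gamma> * (c + 1))) > 0"
    by (simp only: mult_ac)
  have "1 + exp (c * \<gamma>) > 0" by (intro add_pos_pos) auto
  with * show "a_B \<gamma> c > 0" by (simp add: a_B_def zero_less_divide_iff)
  show "(2 * a_B \<gamma> c)\<^sup>2 = 8 * (exp (c * \<gamma>))\<^sup>2 * (exp \<gamma> - 1) * (exp (c * \<gamma>) - 1) *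
           (1 + exp (\<gamma> * (c + 1))) / ((1 + exp (c * \<gamma>))\<^sup>2)\<^sup>2"
    unfolding a_B_def power_mult_distrib power_divide real_sqrt_pow2[OF less_imp_le[OF *]]
    by simp
qed

lemma exp_parameters:
  fixes \<gamma> c t :: real
  shows "exp (\<gamma> * (c + 1)) = exp \<gamma> * exp (c * \<gamma>)"
    and "exp (\<gamma> * (2 * c + 1)) = exp \<gamma> * (exp (c * \<gamma>))\<^sup>2"
    and "exp (2 * c * \<gamma>) = (exp (c * \<gamma>))\<^sup>2"
    and "exp (\<gamma> * (c - 1)) = exp (c * \<gamma>) / exp \<gamma>"
    and "exp (\<gamma> * (c + 1 - t)) = exp \<gamma> * exp (c * \<gamma>) / exp (\<gamma> * t)"
    and "exp (\<gamma> * (c - t)) = exp (c * \<gamma>) / exp (\<gamma> * t)"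
    and "(exp (\<gamma> - \<gamma> * t / 2))\<^sup>2 = (exp \<gamma>)\<^sup>2 / exp (\<gamma> * t)"
    and "(exp (\<gamma> / 2 * (t - c)))\<^sup>2 = exp (\<gamma> * t) / exp (c * \<gamma>)"
  by (simp_all add: power2_eq_square field_simps flip: exp_add exp_diff)

lemma sq_diff_le_iff:
  fixes K K' d e r s :: real
  assumes "K * (d - e) = K' * (r - s)" "K > 0" "K' > 0"
  shows "e \<le> d \<longleftrightarrow> s \<le> r"
proof -
  have "e \<le> d \<longleftrightarrow> 0 \<le> K * (d - e)" using assms(2) by (auto simp: zero_le_mult_iff)
  also have "\<dots> \<longleftrightarrow> s \<le> r" unfolding assms(1) using assms(3) by (auto simp: zero_le_mult_iff)
  finally show ?thesis .
qed

lemma support_A: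
  assumes \<gamma>: "\<gamma> \<noteq> 0" and c: "c > 0"
  shows "closure ((\<lambda>t. exp (\<gamma> * t)) ` {t. 0 < t \<and> t < c + 1 \<and> arccos_arg_A \<gamma> c t \<in> {-1..1}}) =
    {b_A \<gamma> c - 2 * a_A \<gamma> c..b_A \<gamma> c + 2 * a_A \<gamma> c}"
proof (rule support_aux[OF \<gamma> c a_A_square(1)[OF \<gamma> c]])
  define A C where "A = exp \<gamma>" and "C = exp (c * \<gamma>)"
  have pos: "A > 0" "C > 0" by (auto simp: A_def C_def)
  have quad: "(2 * a_A \<gamma> c)\<^sup>2 - (y - b_A \<gamma> c)\<^sup>2 = (1 - y) * (y - A * C) - (A - C)\<^sup>2 / 4" for y
    unfolding a_A_square(2)[OF \<gamma> c] b_A_def exp_parameters(1) A_def[symmetric] C_def[symmetric]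
    by (simp add: power2_eq_square field_simps)
  show "(1 - y) * (y - exp (\<gamma> * (c + 1))) > 0" if "(y - b_A \<gamma> c)\<^sup>2 < (2 * a_A \<gamma> c)\<^sup>2" for y
    using quad[of y] that zero_le_power2[of "A - C"]
    unfolding exp_parameters(1) A_def[symmetric] C_def[symmetric] by linarith
  fix t :: real assume t: "0 < t" "t < c + 1"
  define y where "y = exp (\<gamma> * t)"
  have y: "y > 0" by (simp add: y_def)
  have "arccos_arg_A \<gamma> c t \<in> {-1..1} \<longleftrightarrow>
      (exp (\<gamma> - \<gamma> * t / 2) / 2 * (1 - exp (\<gamma> * (c - 1))))\<^sup>2 \<le> (1 - exp (\<gamma> * t)) * (1 - exp (\<gamma> * (c + 1 - t)))"
    unfolding arccos_arg_A_def
    by (subst arccos_arg_unit_iff) (use \<gamma> t exp_prod_pos[of \<gamma> t "c + 1 - t"] in auto)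
  also have "\<dots> \<longleftrightarrow> (y - b_A \<gamma> c)\<^sup>2 \<le> (2 * a_A \<gamma> c)\<^sup>2"
  proof (rule sq_diff_le_iff)
    show "y * ((1 - exp (\<gamma> * t)) * (1 - exp (\<gamma> * (c + 1 - t))) -
        (exp (\<gamma> - \<gamma> * t / 2) / 2 * (1 - exp (\<gamma> * (c - 1))))\<^sup>2) =
        1 * ((2 * a_A \<gamma> c)\<^sup>2 - (y - b_A \<gamma> c)\<^sup>2)"
      unfolding quad
      unfolding power_mult_distrib power_divide exp_parameters(4,5,7)
      unfolding A_def[symmetric] C_def[symmetric] y_def[symmetric]
      using y pos by (simp add: field_simps power2_eq_square)
  qed (use y in auto)
  finally show "arccos_arg_A \<gamma> c t \<in> {-1..1} \<longleftrightarrow> (exp (\<gamma> * t) - b_A \<gamma> c)\<^sup>2 \<le> (2 * a_A \<gamma> c)\<^sup>2"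
    by (simp add: y_def)
qed

lemma support_B:
  assumes \<gamma>: "\<gamma> \<noteq> 0" and c: "c > 0"
  shows "closure ((\<lambda>t. exp (\<gamma> * t)) ` {t. 0 < t \<and> t < c + 1 \<and> arccos_arg_B \<gamma> c t \<in> {-1..1}}) =
    {b_B \<gamma> c - 2 * a_B \<gamma> c..b_B \<gamma> c + 2 * a_B \<gamma> c}"
proof (rule support_aux[OF \<gamma> c a_B_square(1)[OF \<gamma> c]])
  define A C where "A = exp \<gamma>" and "C = exp (c * \<gamma>)"
  have pos: "A > 0" "C > 0" by (auto simp: A_def C_def)
  have C1: "1 + C \<noteq> 0" using pos by linarith
  have quad: "(1 + C)\<^sup>2 * ((2 * a_B \<gamma> c)\<^sup>2 - (y - b_B \<gamma> c)\<^sup>2) =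
      4 * C * ((1 - y) * (y - A * C)) - (y * (1 - C) + C * (A - 1))\<^sup>2" for y
  proof -
    define B where "B = 3 * (A * C\<^sup>2) - A * C + 3 * C - C\<^sup>2"
    define R where "R = 8 * C\<^sup>2 * (A - 1) * (C - 1) * (1 + A * C)"
    have eq: "K * (R / K\<^sup>2 - (y - B / K)\<^sup>2) = (R - B\<^sup>2) / K + 2 * y * B - K * y\<^sup>2" if "K \<noteq> 0" for K :: real
      using that by (simp add: power2_eq_square field_simps)
    have RB: "R - B\<^sup>2 = - (C\<^sup>2 * (A + 1)\<^sup>2) * (1 + C)\<^sup>2"
      unfolding R_def B_def by algebra
    have "(1 + C)\<^sup>2 * ((2 * a_B \<gamma> c)\<^sup>2 - (y - b_B \<gamma> c)\<^sup>2) =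
        (1 + C)\<^sup>2 * (R / ((1 + C)\<^sup>2)\<^sup>2 - (y - B / (1 + C)\<^sup>2)\<^sup>2)"
      unfolding a_B_square(2)[OF \<gamma> c] b_B_def exp_parameters(1-3) A_def[symmetric] C_def[symmetric]
        B_def R_def by simp
    also have "\<dots> = (R - B\<^sup>2) / (1 + C)\<^sup>2 + 2 * y * B - (1 + C)\<^sup>2 * y\<^sup>2"
      using C1 by (intro eq) simp
    also have "\<dots> = - (C\<^sup>2 * (A + 1)\<^sup>2) + 2 * y * B - (1 + C)\<^sup>2 * y\<^sup>2"
      unfolding RB using C1 by simp
    also have "\<dots> = 4 * C * ((1 - y) * (y - A * C)) - (y * (1 - C) + C * (A - 1))\<^sup>2"
      unfolding B_def by algebra
    finally show ?thesis .
  qed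
  show "(1 - y) * (y - exp (\<gamma> * (c + 1))) > 0" if "(y - b_B \<gamma> c)\<^sup>2 < (2 * a_B \<gamma> c)\<^sup>2" for y
  proof -
    have "(1 + C)\<^sup>2 * ((2 * a_B \<gamma> c)\<^sup>2 - (y - b_B \<gamma> c)\<^sup>2) > 0"
      using that C1 by (intro mult_pos_pos) auto
    then have "4 * C * ((1 - y) * (y - A * C)) > 0"
      unfolding quad using zero_le_power2[of "y * (1 - C) + C * (A - 1)"] by linarith
    then show ?thesis
      unfolding exp_parameters(1) A_def[symmetric] C_def[symmetric] using pos
      by (simp add: zero_less_mult_iff)
  qed
  fix t :: real assume t: "0 < t" "t < c + 1"
  define y where "y = exp (\<gamma> * t)"
  have y: "y > 0" by (simp add: y_def)
  have "arccos_arg_B \<gamma> c t \<in> {-1..1} \<longleftrightarrow>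
      (exp (\<gamma> / 2 * (t - c)) / 2 * (1 - exp (\<gamma> * c) - exp (\<gamma> * (c - t)) + exp (\<gamma> * (c + 1 - t))))\<^sup>2
        \<le> (1 - exp (\<gamma> * t)) * (1 - exp (\<gamma> * (c + 1 - t)))"
    unfolding arccos_arg_B_def
    by (subst arccos_arg_unit_iff) (use \<gamma> t exp_prod_pos[of \<gamma> t "c + 1 - t"] in auto)
  also have "\<dots> \<longleftrightarrow> (y - b_B \<gamma> c)\<^sup>2 \<le> (2 * a_B \<gamma> c)\<^sup>2"
  proof (rule sq_diff_le_iff)
    show "4 * C * y * ((1 - exp (\<gamma> * t)) * (1 - exp (\<gamma> * (c + 1 - t))) -
        (exp (\<gamma> / 2 * (t - c)) / 2 * (1 - exp (\<gamma> * c) - exp (\<gamma> * (c - t)) + exp (\<gamma> * (c + 1 - t))))\<^sup>2) =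
        (1 + C)\<^sup>2 * ((2 * a_B \<gamma> c)\<^sup>2 - (y - b_B \<gamma> c)\<^sup>2)"
      unfolding quad
      unfolding exp_parameters(5)
      unfolding power_mult_distrib power_divide exp_parameters(6)[of \<gamma> c t] exp_parameters(8) mult.commute[of \<gamma> c]
      unfolding A_def[symmetric] C_def[symmetric] y_def[symmetric]
      using y pos by (simp add: field_simps power2_eq_square)
  qed (use y pos C1 in auto)
  finally show "arccos_arg_B \<gamma> c t \<in> {-1..1} \<longleftrightarrow> (exp (\<gamma> * t) - b_B \<gamma> c)\<^sup>2 \<le> (2 * a_B \<gamma> c)\<^sup>2"
    by (simp add: y_def)
qed

end

theory Submission
  imports Defs "Jordan_Normal_Form.Determinant" "HOL-Complex_Analysis.Complex_Analysis"
begin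

text \<open>
  The two measures are orthogonal polynomial ensembles, and the fluctuations of such an ensemble of
  \<open>n\<close> points are governed by the recurrence coefficients with index near \<open>n\<close>. Here these converge,
  and they keep doing so when the measure is tilted by the exponential of a linear statistic, which
  forces the cumulant generating function to become quadratic.

  \<^emph>\<open>The ensemble.\<close> Put \<open>Q = exp (\<gamma> / n)\<close> and \<open>N = n + k\<close>. The numbers \<open>\<lambda> i + n - 1 - i\<close> form an
  \<open>n\<close>-element subset \<open>S\<close> of \<open>{0, \<dots>, N - 1}\<close>, and the corresponding numbers of the conjugate of the
  complementary diagram form the complement of \<open>S\<close> (lemma \<open>holes\<close>). A principally specialised Schur
  polynomial is a constant times a Vandermonde product (\<open>schur_principal\<close>). The Vandermonde product
  over the complement of \<open>S\<close> can be expressed by the one over \<open>S\<close> (\<open>gaps_complement\<close>), so both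
  measures become \<open>\<Prod>m\<in>S. w m\<close> times the squared Vandermonde product of the \<open>x m = Q ^ m\<close> with
  \<open>m \<in> S\<close>, for an explicit weight \<open>w\<close> (\<open>schur_prob_weight\<close>). This is an orthogonal polynomial
  ensemble on \<open>N\<close> nodes, and \<open>f (exp (\<gamma> * x\<^sub>i))\<close> is \<open>f\<close> evaluated at a node.

  \<^emph>\<open>Recurrence coefficients.\<close> The orthonormal polynomials of \<open>w\<close> satisfy a three term recurrence
  \<open>x p\<^sub>i = a\<^sub>i\<^sub>+\<^sub>1 p\<^sub>i\<^sub>+\<^sub>1 + b\<^sub>i p\<^sub>i + a\<^sub>i p\<^sub>i\<^sub>-\<^sub>1\<close>. The weight is a q-Krawtchouk weight, so that
  these polynomials are eigenfunctions of a q-difference operator (\<open>mop_eigen\<close>), which determines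
  \<open>a\<^sub>i\<close> and \<open>b\<^sub>i\<close> in closed form (\<open>ra_krawtchouk\<close>, \<open>rb_krawtchouk\<close>). For indices at bounded distance
  from \<open>n\<close> they converge to the numbers \<open>a\<close> and \<open>b\<close> of the theorem (\<open>krawtchouk_near_toeplitz\<close>).

  \<^emph>\<open>Variance.\<close> The covariance of two linear statistics is a sum of products of matrix elements over
  the corner \<open>i < n \<le> l\<close> of the matrix (\<open>cov_corner\<close>). For a polynomial \<open>f\<close> the matrix of
  multiplication by \<open>f\<close> is banded and near the index \<open>n\<close> it is close to the Toeplitz matrix with
  entries \<open>fc a b f (j - i)\<close>. The corner sum is therefore close to \<open>\<Sum>l. l * (fc a b f l)\<^sup>2\<close>
  (\<open>cov_near_toeplitz\<close>).

  \<^emph>\<open>Gaussian limit for polynomials.\<close> Replace \<open>w\<close> by \<open>w m * exp (t * f (x m))\<close>. The second derivative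
  in \<open>t\<close> of the logarithm of the Laplace transform of the statistic is its variance in the tilted
  ensemble. The recurrence coefficients of the tilted weight evolve by the Toda equations
  (\<open>toda_ra\<close>, \<open>toda_rb\<close>). These have constant sequences as equilibria and propagate perturbations
  with finite speed up to factorially small errors, hence the coefficients near \<open>n\<close> stay close to
  \<open>a\<close> and \<open>b\<close> for bounded \<open>t\<close> (\<open>near_toeplitz_tilt\<close>). So the variance in the tilted ensemble has the
  same limit \<open>v\<close> for every \<open>t\<close>, and integrating twice shows that the Laplace transform converges to
  \<open>exp (v * t\<^sup>2 / 2)\<close> (\<open>laplace_near_toeplitz\<close>). A normal families argument turns this into
  convergence of characteristic functions (\<open>laplace_imp_char\<close>).

  \<^emph>\<open>Continuously differentiable functions.\<close> The reproducing kernel formula for the variance shows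
  that it is at most \<open>L\<^sup>2\<close> times the variance of the identity for an \<open>L\<close>-Lipschitz function
  (\<open>cov_lipschitz\<close>), and the latter variance is \<open>(a\<^sub>n)\<^sup>2\<close>, which is bounded. Approximating \<open>f\<close> by
  polynomials in \<open>C\<^sup>1\<close> therefore changes the characteristic functions uniformly little. Bessel's
  inequality for the derivative controls the limiting variances in the same way (\<open>fcos_bessel\<close>), and
  Levy's continuity theorem concludes.
\<close>

hide_const (open) Module.smult

section \<open>Orthogonal polynomials on finitely many nodes\<close>

locale node_weight =
  fixes N :: nat and x w :: "nat \<Rightarrow> real"
  assumes nodes_inj: "inj_on x {..<N}"
    and weight_pos: "m < N \<Longrightarrow> w m > 0"
begin

text \<open>
  The discrete inner product \<open>\<langle>p, r\<rangle>\<close> of polynomials; it is positive definite only in degrees below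
  \<open>N\<close>.
\<close>

definition ip :: "real poly \<Rightarrow> real poly \<Rightarrow> real" where
  "ip p r = (\<Sum>m<N. w m * poly p (x m) * poly r (x m))"

lemma ip_commute: "ip p r = ip r p"
  by (simp add: ip_def mult_ac)

lemma ip_diff_left: "ip (p - r) s = ip p s - ip r s"
  by (simp add: ip_def algebra_simps sum_subtractf)

lemma ip_smult_left: "ip (smult c p) s = c * ip p s"
  by (simp add: ip_def mult_ac sum_distrib_left)

lemma ip_add_right: "ip s (p + r) = ip s p + ip s r"
  by (simp add: ip_def algebra_simps sum.distrib)

lemma ip_diff_right: "ip s (p - r) = ip s p - ip s r"
  by (simp add: ip_def algebra_simps sum_subtractf)

lemma ip_smult_right: "ip s (smult c p) = c * ip s p"
  by (simp add: ip_def mult_ac sum_distrib_left)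

lemma ip_0_right: "ip s 0 = 0"
  by (simp add: ip_def)

lemma ip_X_left: "ip (pCons 0 p) r = ip p (pCons 0 r)"
  by (simp add: ip_def mult_ac)

text \<open>
  The monic orthogonal polynomials, generated by the Stieltjes procedure. The polynomial of degree
  \<open>N\<close> vanishes at all nodes, so that the recursion is meaningful up to this degree only.
\<close>

fun mop :: "nat \<Rightarrow> real poly" where
  "mop 0 = 1"
| "mop (Suc 0) = pCons 0 1 - smult (ip (pCons 0 1) 1 / ip 1 1) 1"
| "mop (Suc (Suc n)) = pCons 0 (mop (Suc n))
      - smult (ip (pCons 0 (mop (Suc n))) (mop (Suc n)) / ip (mop (Suc n)) (mop (Suc n))) (mop (Suc n))
      - smult (ip (mop (Suc n)) (mop (Suc n)) / ip (mop n) (mop n)) (mop n)"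

text \<open>
  Squared norms and diagonal recurrence coefficients of the monic polynomials.
\<close>

definition hn :: "nat \<Rightarrow> real" where "hn n = ip (mop n) (mop n)"
definition rb :: "nat \<Rightarrow> real" where "rb n = ip (pCons 0 (mop n)) (mop n) / hn n"

lemma mop_Suc_0: "mop (Suc 0) = pCons 0 (mop 0) - smult (rb 0) (mop 0)"
  by (simp add: rb_def hn_def)

lemma mop_Suc_Suc: "mop (Suc (Suc n)) = pCons 0 (mop (Suc n)) - smult (rb (Suc n)) (mop (Suc n))
    - smult (hn (Suc n) / hn n) (mop n)"
  by (simp add: rb_def hn_def)

declare mop.simps(2,3) [simp del]

lemma X_mop: "pCons 0 (mop n) = mop (Suc n) + smult (rb n) (mop n) +
    (if n = 0 then 0 else smult (hn n / hn (n - 1)) (mop (n - 1)))"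
  by (cases n) (simp_all add: mop_Suc_0 mop_Suc_Suc)

lemma mop_degree_monic: "degree (mop n) = n \<and> lead_coeff (mop n) = 1"
proof (induction n rule: mop.induct)
  case 2
  show ?case by (simp add: mop_Suc_0)
next
  case (3 n)
  let ?r = "smult (rb (Suc n)) (mop (Suc n)) + smult (hn (Suc n) / hn n) (mop n)"
  have eq: "mop (Suc (Suc n)) = pCons 0 (mop (Suc n)) - ?r"
    by (simp add: mop_Suc_Suc)
  have "mop (Suc n) \<noteq> 0" using 3 by auto
  then have d: "degree (pCons 0 (mop (Suc n))) = Suc (Suc n)" using 3 by simp
  have "degree ?r \<le> Suc n"
    using 3 by (intro degree_add_le) (auto intro: order.trans[OF degree_smult_le])
  then have r: "degree ?r < Suc (Suc n)" by simp
  have d2: "degree (mop (Suc (Suc n))) = Suc (Suc n)"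
    unfolding eq diff_conv_add_uminus using d r
    by (subst degree_add_eq_left) (simp_all only: degree_minus)
  moreover have "coeff ?r (Suc (Suc n)) = 0" using r coeff_eq_0 by blast
  then have "coeff (mop (Suc (Suc n))) (Suc (Suc n)) = 1"
    unfolding eq coeff_diff using 3 by (simp add: coeff_pCons)
  ultimately show ?case by simp
qed simp

lemma degree_mop [simp]: "degree (mop n) = n" and coeff_mop [simp]: "coeff (mop n) n = 1"
  using mop_degree_monic[of n] by auto

lemma mop_nonzero [simp]: "mop n \<noteq> 0"
  using coeff_mop[of n] by fastforce

text \<open>
  This is where distinctness of the nodes enters, and why all statements about orthogonality are
  restricted to degrees below \<open>N\<close>.
\<close>

lemma nodes_zero_imp_0:
  assumes "\<And>m. m < N \<Longrightarrow> poly p (x m) = 0" "degree p < N"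
  shows "p = 0"
proof (rule ccontr)
  assume "p \<noteq> 0"
  have "x ` {..<N} \<subseteq> {r. poly p r = 0}" using assms by auto
  then have "card (x ` {..<N}) \<le> card {r. poly p r = 0}"
    using \<open>p \<noteq> 0\<close> by (intro card_mono poly_roots_finite)
  then have "N \<le> degree p"
    using card_image[OF nodes_inj] card_poly_roots_bound[OF \<open>p \<noteq> 0\<close>] by simp
  with assms show False by simp
qed

lemma ip_self_pos:
  assumes "p \<noteq> 0" "degree p < N"
  shows "ip p p > 0"
proof -
  obtain m where m: "m < N" "poly p (x m) \<noteq> 0"
    using nodes_zero_imp_0 assms by blast
  have "0 < w m * poly p (x m) * poly p (x m)"
    using m weight_pos[of m] by (auto simp: mult.assoc zero_less_mult_iff linorder_neq_iff)
  also have "\<dots> \<le> ip p p"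
    unfolding ip_def using m weight_pos
    by (intro member_le_sum) (auto simp: mult.assoc less_imp_le)
  finally show ?thesis .
qed

lemma hn_pos: "n < N \<Longrightarrow> hn n > 0"
  unfolding hn_def by (intro ip_self_pos) auto

text \<open>
  The index \<open>j = N\<close> is included: the polynomial of degree \<open>N\<close> is produced by the same recursion,
  although its own norm vanishes.
\<close>

lemma mop_orth_le: "j \<le> N \<Longrightarrow> i < j \<Longrightarrow> ip (mop j) (mop i) = 0"
proof (induction j arbitrary: i rule: mop.induct)
  case 2
  then have "hn 0 > 0" by (intro hn_pos) simp
  then have "rb 0 * hn 0 = ip (pCons 0 (mop 0)) (mop 0)" unfolding rb_def by simp
  moreover have "ip (mop (Suc 0)) (mop 0) = ip (pCons 0 (mop 0)) (mop 0) - rb 0 * hn 0"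
    unfolding mop_Suc_0 ip_diff_left ip_smult_left hn_def by (rule refl)
  moreover have "i = 0" using 2 by simp
  ultimately show ?case by simp
next
  case (3 n)
  have h: "hn n > 0" "hn (Suc n) > 0" using 3 by (auto intro!: hn_pos)
  have IH1: "ip (mop (Suc n)) (mop i) = 0" if "i < Suc n" for i using 3 that by simp
  have IH2: "ip (mop n) (mop i) = 0" if "i < n" for i using 3 that by simp
  have eq: "ip (mop (Suc (Suc n))) (mop i) = ip (mop (Suc n)) (pCons 0 (mop i))
       - rb (Suc n) * ip (mop (Suc n)) (mop i) - hn (Suc n) / hn n * ip (mop n) (mop i)" for i
    by (simp add: mop_Suc_Suc ip_diff_left ip_smult_left ip_X_left)
  consider "i = Suc n" | "i = n" | "i < n" using 3 by linarith
  then show ?case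
  proof cases
    case 1
    have "ip (mop (Suc n)) (pCons 0 (mop (Suc n))) = rb (Suc n) * hn (Suc n)"
      using h by (simp add: rb_def ip_commute)
    moreover have "ip (mop n) (mop (Suc n)) = 0" using IH1[of n] by (simp add: ip_commute)
    ultimately show ?thesis unfolding 1 eq by (simp flip: hn_def)
  next
    case 2
    have "ip (mop (Suc n)) (pCons 0 (mop n)) = ip (mop (Suc n)) (mop (Suc n))"
      unfolding X_mop
      using IH1[of n] IH1[of "n - 1"]
      by (simp add: ip_add_right ip_smult_right ip_0_right)
    then show ?thesis unfolding 2 eq using h IH1[of n] by (simp flip: hn_def)
  next
    case 3
    have "ip (mop (Suc n)) (pCons 0 (mop i)) = 0"
      unfolding X_mop
      using IH1[of i] IH1[of "Suc i"] IH1[of "i - 1"] 3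
      by (simp add: ip_add_right ip_smult_right ip_0_right)
    then show ?thesis unfolding eq using IH1[of i] IH2[of i] 3 by simp
  qed
qed simp

lemma mop_orth:
  assumes "i < N" "j < N" "i \<noteq> j"
  shows "ip (mop i) (mop j) = 0"
  using mop_orth_le[of i j] mop_orth_le[of j i] assms by (cases "i < j") (auto simp: ip_commute)

lemma mop_orth_lower:
  assumes "degree p < j" "j \<le> N"
  shows "ip (mop j) p = 0"
  using assms(1)
proof (induction "degree p" arbitrary: p rule: less_induct)
  case less
  show ?case
  proof (cases "p = 0")
    case False
    let ?r = "p - smult (lead_coeff p) (mop (degree p))"
    have "ip (mop j) ?r = 0"
    proof (cases "degree p = 0")
      case True
      then obtain c where "p = [:c:]" using degree_eq_zeroE by blast
      then have "?r = 0" using True by (simp add: one_pCons)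
      then show ?thesis by (simp only:) (simp add: ip_def)
    next
      case False
      have "degree ?r < degree p"
        by (rule degree_lessI) (use False in \<open>auto simp: coeff_eq_0 le_less\<close>)
      then show ?thesis using less by simp
    qed
    moreover have "ip (mop j) (mop (degree p)) = 0" using less assms mop_orth_le by auto
    ultimately show ?thesis
      by (simp add: ip_diff_right ip_smult_right)
  qed (simp add: ip_def)
qed

subsection \<open>Orthonormal functions and matrix elements\<close>

text \<open>
  The orthonormal functions on the nodes, with the square root of the weight absorbed, so that they
  form an orthogonal matrix.
\<close>

definition ef :: "nat \<Rightarrow> nat \<Rightarrow> real" where
  "ef i m = sqrt (w m / hn i) * poly (mop i) (x m)"

text \<open>
  Matrix elements of the operator of multiplication by \<open>u\<close> in the orthonormal basis.
\<close>

definition me :: "(nat \<Rightarrow> real) \<Rightarrow> nat \<Rightarrow> nat \<Rightarrow> real" where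
  "me u i j = (\<Sum>m<N. u m * ef i m * ef j m)"

text \<open>
  The off-diagonal entries of the Jacobi matrix; \<open>ra 0 = 0\<close> makes the recurrence uniform in the
  index.
\<close>

definition ra :: "nat \<Rightarrow> real" where
  "ra n = (if n = 0 then 0 else sqrt (hn n / hn (n - 1)))"

lemma ef_mult: "i < N \<Longrightarrow> j < N \<Longrightarrow> m < N \<Longrightarrow>
    ef i m * ef j m = w m * poly (mop i) (x m) * poly (mop j) (x m) / sqrt (hn i * hn j)"
  using weight_pos[of m]
  by (simp add: ef_def real_sqrt_divide real_sqrt_mult)

lemma me_commute: "me u i j = me u j i"
  by (simp add: me_def mult_ac)

lemma me_poly_eq_ip:
  assumes "i < N" "j < N"
  shows "me (\<lambda>m. poly f (x m)) i j = ip (f * mop i) (mop j) / sqrt (hn i * hn j)"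
proof -
  have "me (\<lambda>m. poly f (x m)) i j = (\<Sum>m<N. poly f (x m) * (ef i m * ef j m))"
    by (simp add: me_def mult_ac)
  also have "\<dots> = (\<Sum>m<N. w m * poly (f * mop i) (x m) * poly (mop j) (x m) / sqrt (hn i * hn j))"
    using assms by (intro sum.cong refl) (simp add: ef_mult mult_ac)
  finally show ?thesis by (simp add: ip_def sum_divide_distrib)
qed

lemma me_1:
  assumes "i < N" "j < N"
  shows "me (\<lambda>_. 1) i j = (if i = j then 1 else 0)"
  using me_poly_eq_ip[OF assms, of 1] mop_orth[OF assms] hn_pos[of i] assms
  by (auto simp: hn_def)

lemma me_banded:
  assumes "i < N" "j < N" "i + degree f < j \<or> j + degree f < i"
  shows "me (\<lambda>m. poly f (x m)) i j = 0"
proof -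
  have *: "me (\<lambda>m. poly f (x m)) i j = 0" if "i < N" "j < N" "i + degree f < j" for i j
  proof -
    have "degree (f * mop i) < j"
      using degree_mult_le[of f "mop i"] that by simp
    then have "ip (mop j) (f * mop i) = 0" using that by (intro mop_orth_lower) auto
    then show ?thesis using me_poly_eq_ip[OF that(1,2)] by (simp add: ip_commute)
  qed
  from assms(3) show ?thesis
    using *[of i j] *[of j i] assms me_commute[of _ i j] by metis
qed

lemma ra_nonneg: "n < N \<Longrightarrow> ra n \<ge> 0"
  using hn_pos[of n] hn_pos[of "n - 1"] by (auto simp: ra_def intro!: divide_nonneg_nonneg less_imp_le)

lemma x_ef:
  assumes "Suc i < N" "m < N"
  shows "x m * ef i m = ra (Suc i) * ef (Suc i) m + rb i * ef i m + ra i * ef (i - 1) m"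
proof -
  have h: "hn i > 0" "hn (Suc i) > 0" "hn (i - 1) > 0" using assms by (auto intro!: hn_pos)
  have "x m * poly (mop i) (x m) = poly (pCons 0 (mop i)) (x m)" by simp
  also have "\<dots> = poly (mop (Suc i)) (x m) + rb i * poly (mop i) (x m) +
      (if i = 0 then 0 else hn i / hn (i - 1) * poly (mop (i - 1)) (x m))"
    by (subst X_mop) auto
  finally have 1: "x m * poly (mop i) (x m) = \<dots>" .
  have 2: "ra (Suc i) * sqrt (w m / hn (Suc i)) = sqrt (w m / hn i)"
    using h by (simp add: ra_def flip: real_sqrt_mult)
  have 3: "ra i * sqrt (w m / hn (i - 1)) = sqrt (w m / hn i) * (hn i / hn (i - 1))" if "i \<noteq> 0"
  proof -
    have "ra i * sqrt (w m / hn (i - 1)) = sqrt ((w m / hn i) * (hn i / hn (i - 1))\<^sup>2)"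
      using h that by (simp add: ra_def power2_eq_square flip: real_sqrt_mult)
    also have "\<dots> = sqrt (w m / hn i) * (hn i / hn (i - 1))"
      unfolding real_sqrt_mult real_sqrt_abs using h by simp
    finally show ?thesis .
  qed
  have "x m * ef i m = sqrt (w m / hn i) * (x m * poly (mop i) (x m))"
    by (simp add: ef_def)
  also have "\<dots> = sqrt (w m / hn i) * poly (mop (Suc i)) (x m) + rb i * ef i m +
      (if i = 0 then 0 else sqrt (w m / hn i) * (hn i / hn (i - 1)) * poly (mop (i - 1)) (x m))"
    unfolding 1 by (simp add: ef_def algebra_simps)
  also have "sqrt (w m / hn i) * poly (mop (Suc i)) (x m) = ra (Suc i) * ef (Suc i) m"
    unfolding 2[symmetric] by (simp add: ef_def)
  also have "(if i = 0 then 0 else sqrt (w m / hn i) * (hn i / hn (i - 1)) * poly (mop (i - 1)) (x m))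
      = ra i * ef (i - 1) m"
  proof (cases "i = 0")
    case True
    then show ?thesis by (simp add: ra_def)
  next
    case False
    then show ?thesis unfolding ef_def mult.assoc[symmetric] 3[OF False] by simp
  qed
  finally show ?thesis .
qed

lemma me_X_mult:
  assumes "Suc i < N"
  shows "me (\<lambda>m. x m * u m) i j = ra (Suc i) * me u (Suc i) j + rb i * me u i j + ra i * me u (i - 1) j"
proof -
  have "me (\<lambda>m. x m * u m) i j = (\<Sum>m<N. u m * (x m * ef i m) * ef j m)"
    by (simp add: me_def mult_ac)
  also have "\<dots> = (\<Sum>m<N. u m * (ra (Suc i) * ef (Suc i) m + rb i * ef i m + ra i * ef (i - 1) m) * ef j m)"
    using assms by (intro sum.cong refl) (simp add: x_ef)
  also have "\<dots> = ra (Suc i) * me u (Suc i) j + rb i * me u i j + ra i * me u (i - 1) j"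
    unfolding me_def sum_distrib_left sum.distrib[symmetric] by (intro sum.cong refl) (simp add: algebra_simps)
  finally show ?thesis .
qed

lemma me_x_diag: "i < N \<Longrightarrow> me x i i = rb i"
  using me_poly_eq_ip[of i i "[:0, 1:]"] hn_pos[of i] by (simp add: rb_def)

lemma me_x_offdiag: "Suc i < N \<Longrightarrow> me x i (Suc i) = ra (Suc i)"
  using me_X_mult[of i "\<lambda>_. 1" "Suc i"] by (simp add: me_1)

lemma me_x_banded: "i < N \<Longrightarrow> j < N \<Longrightarrow> Suc i < j \<Longrightarrow> me x i j = 0"
  using me_banded[of i j "[:0, 1:]"] by simp

text \<open>
  A multiplication operator has norm at most the supremum of the multiplier; for single matrix
  elements the arithmetic-geometric mean inequality suffices.
\<close>

lemma me_bound:
  assumes "\<And>m. m < N \<Longrightarrow> \<bar>u m\<bar> \<le> K" "i < N" "j < N"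
  shows "\<bar>me u i j\<bar> \<le> K"
proof -
  have "\<bar>me u i j\<bar> \<le> (\<Sum>m<N. \<bar>u m * ef i m * ef j m\<bar>)"
    unfolding me_def by (rule sum_abs)
  also have "\<dots> \<le> (\<Sum>m<N. K * ((ef i m * ef i m + ef j m * ef j m) / 2))"
  proof (rule sum_mono)
    fix m assume m: "m \<in> {..<N}"
    have "\<bar>ef i m * ef j m\<bar> \<le> (ef i m * ef i m + ef j m * ef j m) / 2"
      using sum_squares_bound[of "\<bar>ef i m\<bar>" "\<bar>ef j m\<bar>"] by (simp add: abs_mult power2_eq_square)
    moreover have "\<bar>u m\<bar> \<le> K" using assms m by simp
    ultimately have "\<bar>u m\<bar> * \<bar>ef i m * ef j m\<bar> \<le> K * ((ef i m * ef i m + ef j m * ef j m) / 2)"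
      by (intro mult_mono) auto
    then show "\<bar>u m * ef i m * ef j m\<bar> \<le> K * ((ef i m * ef i m + ef j m * ef j m) / 2)"
      by (simp add: abs_mult mult.assoc)
  qed
  also have "\<dots> = K * ((me (\<lambda>_. 1) i i + me (\<lambda>_. 1) j j) / 2)"
    by (simp add: me_def sum_distrib_left sum.distrib sum_divide_distrib algebra_simps add_divide_distrib)
  also have "\<dots> = K" using assms by (simp add: me_1)
  finally show ?thesis .
qed

text \<open>
  Orthonormal rows of a square matrix imply orthonormal columns. It yields multiplicativity of
  matrix elements and thereby the passage from traces to corner sums.
\<close>

lemma ef_orthogonal_matrix:
  assumes "m < N" "m' < N"
  shows "(\<Sum>i<N. ef i m * ef i m') = (if m = m' then 1 else 0)"
proof -
  define E where "E = mat N N (\<lambda>(i, m). ef i m)"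
  have E: "E \<in> carrier_mat N N" "transpose_mat E \<in> carrier_mat N N" by (auto simp: E_def)
  have "E * transpose_mat E = 1\<^sub>m N"
  proof (rule eq_matI)
    fix i j assume "i < dim_row (1\<^sub>m N :: real mat)" "j < dim_col (1\<^sub>m N :: real mat)"
    then have ij: "i < N" "j < N" by auto
    then have "(E * transpose_mat E) $$ (i, j) = me (\<lambda>_. 1) i j"
      by (simp add: E_def scalar_prod_def me_def lessThan_atLeast0)
    then show "(E * transpose_mat E) $$ (i, j) = 1\<^sub>m N $$ (i, j)"
      using ij by (simp add: me_1)
  qed (auto simp: E_def)
  then have "transpose_mat E * E = 1\<^sub>m N"
    using mat_mult_left_right_inverse[OF E] by simp
  then have "(transpose_mat E * E) $$ (m, m') = 1\<^sub>m N $$ (m, m')" by simp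
  then show ?thesis using assms
    by (simp add: E_def scalar_prod_def lessThan_atLeast0)
qed

lemma me_mult:
  "(\<Sum>l<N. me u i l * me v l j) = me (\<lambda>m. u m * v m) i j"
proof -
  have "(\<Sum>l<N. me u i l * me v l j) =
      (\<Sum>l<N. \<Sum>m<N. \<Sum>m'<N. u m * ef i m * v m' * ef j m' * (ef l m * ef l m'))"
    by (simp add: me_def sum_product mult_ac)
  also have "\<dots> = (\<Sum>m<N. \<Sum>l<N. \<Sum>m'<N. u m * ef i m * v m' * ef j m' * (ef l m * ef l m'))"
    by (rule sum.swap)
  also have "\<dots> = (\<Sum>m<N. \<Sum>m'<N. \<Sum>l<N. u m * ef i m * v m' * ef j m' * (ef l m * ef l m'))"
    by (intro sum.cong refl sum.swap)
  also have "\<dots> = (\<Sum>m<N. \<Sum>m'<N. u m * ef i m * v m' * ef j m' * (if m = m' then 1 else 0))"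
    by (intro sum.cong refl) (simp add: ef_orthogonal_matrix flip: sum_distrib_left)
  also have "\<dots> = me (\<lambda>m. u m * v m) i j"
    by (simp add: me_def mult_ac if_distrib cong: if_cong)
  finally show ?thesis .
qed

end

section \<open>Ensembles of finitely many nodes\<close>

lemma permutes_less: "p permutes {0..<n :: nat} \<Longrightarrow> j < n \<Longrightarrow> p j < n"
  using permutes_in_image[of p "{0..<n}" j] by auto

lemma det_scale:
  "Determinant.det (mat n n (\<lambda>(j, i). a j * b i * c j i)) =
     (\<Prod>j<n. a j) * (\<Prod>i<n. b i) * Determinant.det (mat n n (\<lambda>(j, i). c j i :: real))"
proof -
  have "Determinant.det (mat n n (\<lambda>(j, i). a j * b i * c j i)) =
     (\<Sum>p | p permutes {0..<n}. signof p * (\<Prod>j=0..<n. a j * b (p j) * c j (p j)))"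
    by (subst det_def'[where n = n], simp, intro sum.cong refl arg_cong2[where f = "(*)"] prod.cong)
       (auto simp: permutes_less)
  also have "\<dots> = (\<Sum>p | p permutes {0..<n}. (\<Prod>j<n. a j) * (\<Prod>i<n. b i) *
      (signof p * (\<Prod>j=0..<n. c j (p j))))"
  proof (intro sum.cong refl)
    fix p assume "p \<in> {p. p permutes {0..<n}}"
    then have "(\<Prod>j=0..<n. b (p j)) = (\<Prod>i=0..<n. b i)"
      using prod.permute[of p "{0..<n}" b] by simp
    then show "signof p * (\<Prod>j=0..<n. a j * b (p j) * c j (p j)) = (\<Prod>j<n. a j) * (\<Prod>i<n. b i) *
      (signof p * (\<Prod>j=0..<n. c j (p j)))"
      by (simp add: prod.distrib lessThan_atLeast0)
  qed
  also have "\<dots> = (\<Prod>j<n. a j) * (\<Prod>i<n. b i) * Determinant.det (mat n n (\<lambda>(j, i). c j i))"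
    unfolding sum_distrib_left[symmetric]
    by (subst det_def'[where n = n], simp,
        intro sum.cong refl arg_cong2[where f = "(*)"] prod.cong) (auto simp: permutes_less)
  finally show ?thesis .
qed

lemma prod_list_diag_mat: "prod_list (diag_mat (mat n n f)) = (\<Prod>i<n. f (i, i))"
  by (simp add: prod_list_diag_prod lessThan_atLeast0)

text \<open>
  The change of basis from powers to monic polynomials is unitriangular.
\<close>

lemma det_poly_coeffs:
  fixes p :: "nat \<Rightarrow> real poly"
  assumes deg: "\<And>i. i < n \<Longrightarrow> degree (p i) = i" and monic: "\<And>i. i < n \<Longrightarrow> coeff (p i) i = 1"
  shows "Determinant.det (mat n n (\<lambda>(j, i). poly (p i) (z j))) =
         Determinant.det (mat n n (\<lambda>(j, i). z j ^ i))"
proof -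
  let ?C = "mat n n (\<lambda>(l, i). coeff (p i) l)"
  have "mat n n (\<lambda>(j, i). poly (p i) (z j)) = mat n n (\<lambda>(j, i). z j ^ i) * ?C"
  proof (rule eq_matI)
    fix j i assume "j < dim_row (mat n n (\<lambda>(j, i). z j ^ i) * ?C)"
      "i < dim_col (mat n n (\<lambda>(j, i). z j ^ i) * ?C)"
    then have ji: "j < n" "i < n" by auto
    have "poly (p i) (z j) = (\<Sum>l\<le>i. coeff (p i) l * z j ^ l)"
      using deg[of i] ji by (simp add: poly_altdef)
    also have "\<dots> = (\<Sum>l<n. coeff (p i) l * z j ^ l)"
      using deg[of i] ji by (intro sum.mono_neutral_left) (auto simp: coeff_eq_0)
    finally show "mat n n (\<lambda>(j, i). poly (p i) (z j)) $$ (j, i) =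
        (mat n n (\<lambda>(j, i). z j ^ i) * ?C) $$ (j, i)"
      using ji by (simp add: scalar_prod_def lessThan_atLeast0 mult_ac)
  qed auto
  moreover have "Determinant.det ?C = 1"
    by (subst det_upper_triangular)
      (auto simp: prod_list_diag_mat upper_triangular_def deg monic coeff_eq_0)
  ultimately show ?thesis
    using det_mult[of "mat n n (\<lambda>(j, i). z j ^ i)" n ?C] by simp
qed

text \<open>
  The determinant depends only on the leading terms. With the Newton basis it is triangular, which
  evaluates the Vandermonde determinant.
\<close>

lemma det_monic:
  fixes p :: "nat \<Rightarrow> real poly"
  assumes "\<And>i. i < n \<Longrightarrow> degree (p i) = i" and "\<And>i. i < n \<Longrightarrow> coeff (p i) i = 1"
  shows "Determinant.det (mat n n (\<lambda>(j, i). poly (p i) (z j))) = (\<Prod>j<n. \<Prod>l<j. z j - z l)"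
proof -
  let ?q = "\<lambda>i. \<Prod>l<i. [:- z l, 1:]"
  have q: "degree (?q i) = i \<and> coeff (?q i) i = 1" for i
  proof -
    have d: "degree (?q i) = i" by (subst degree_prod_sum_eq) auto
    have "lead_coeff (?q i) = 1" by (subst lead_coeff_prod) simp
    with d show ?thesis by simp
  qed
  have "Determinant.det (mat n n (\<lambda>(j, i). poly (p i) (z j))) =
      Determinant.det (mat n n (\<lambda>(j, i). poly (?q i) (z j)))"
    using det_poly_coeffs[of n p z] det_poly_coeffs[of n ?q z] assms q by simp
  also have "\<dots> = (\<Prod>j<n. poly (?q j) (z j))"
    by (subst det_lower_triangular[where n = n])
       (auto simp: prod_list_diag_mat poly_prod intro!: prod_zero)
  finally show ?thesis by (simp add: poly_prod)
qed

lemma prod_offdiag_square: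
  fixes a :: "nat \<Rightarrow> nat \<Rightarrow> real"
  assumes "\<And>i j. a i j = a j i"
  shows "(\<Prod>j<n. \<Prod>l\<in>{..<n} - {j}. a j l) = (\<Prod>j<n. \<Prod>l<j. a j l)\<^sup>2"
proof (induction n)
  case (Suc n)
  have "(\<Prod>l\<in>{..<Suc n} - {j}. a j l) = a j n * (\<Prod>l\<in>{..<n} - {j}. a j l)" if "j < n" for j
  proof -
    have "{..<Suc n} - {j} = insert n ({..<n} - {j})" using that by auto
    then show ?thesis by simp
  qed
  moreover have "{..<Suc n} - {n} = {..<n}" by auto
  ultimately show ?case
    using Suc by (simp add: prod.distrib power_mult_distrib assms[of _ n] power2_eq_square)
qed simp

lemma permutes_agree_off_one:
  assumes "p permutes A" "r permutes A" "\<And>j. j \<noteq> k \<Longrightarrow> p j = r j"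
  shows "p = r"
proof -
  have "p k = r k"
  proof -
    obtain l where l: "r l = p k" using permutes_surj[OF assms(2)] by (metis surjD)
    show ?thesis
    proof (cases "l = k")
      case False
      then have "p l = p k" using assms(3)[of l] l by simp
      then show ?thesis using False permutes_inj[OF assms(1)] by (metis injD)
    qed (use l in simp)
  qed
  then show ?thesis using assms(3) by (intro ext) (metis)
qed

text \<open>
  The reason why two-point functions of the ensemble contain exactly one exchange term.
\<close>

lemma permutes_agree_off_two:
  assumes p: "p permutes A" and r: "r permutes A" and eq: "\<And>j. j \<noteq> k \<Longrightarrow> j \<noteq> l \<Longrightarrow> p j = r j"
    and kl: "k \<in> A" "l \<in> A" "k \<noteq> l"
  shows "r = p \<or> r = p \<circ> Transposition.transpose k l"
proof -
  let ?t = "Transposition.transpose k l"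
  have pt: "(p \<circ> ?t) permutes A"
    using p permutes_compose[OF permutes_swap_id[OF kl(1,2)] p] by simp
  obtain m where m: "p m = r k" using permutes_surj[OF p] by (metis surjD)
  have "m = k \<or> m = l"
  proof (rule ccontr)
    assume "\<not> ?thesis"
    then have "p m = r m" using eq by auto
    then have "m = k" using m permutes_inj[OF r] by (metis injD)
    with \<open>\<not> ?thesis\<close> show False by simp
  qed
  then show ?thesis
  proof
    assume "m = k"
    then have "r = p" using m eq by (intro permutes_agree_off_one[OF r p, of l]) metis
    then show ?thesis by simp
  next
    assume ml: "m = l"
    have "r = p \<circ> ?t"
    proof (rule permutes_agree_off_one[OF r pt, of l])
      fix j assume "j \<noteq> l"
      then show "r j = (p \<circ> ?t) j"
        using m ml eq[of j] by (cases "j = k") (auto simp: transpose_apply_other)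
    qed
    then show ?thesis by simp
  qed
qed

context node_weight
begin

definition ens :: "nat \<Rightarrow> nat set set" where "ens n = {S. S \<subseteq> {..<N} \<and> card S = n}"

text \<open>
  The product over ordered pairs is the square of the Vandermonde product. In this form it needs no
  enumeration of the set.
\<close>

definition sw :: "nat set \<Rightarrow> real" where
  "sw S = (\<Prod>m\<in>S. w m) * (\<Prod>m\<in>S. \<Prod>m'\<in>S - {m}. \<bar>x m - x m'\<bar>)"

text \<open>
  Partition function and expectation of the ensemble.
\<close>

definition Zn :: "nat \<Rightarrow> real" where "Zn n = (\<Sum>S\<in>ens n. sw S)"

definition EE :: "nat \<Rightarrow> (nat set \<Rightarrow> real) \<Rightarrow> real" where
  "EE n F = (\<Sum>S\<in>ens n. sw S * F S) / Zn n"

text \<open>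
  Sums over configurations are computed as sums over ordered tuples of nodes, where coincidences are
  harmless because the following determinant vanishes.
\<close>

definition tup :: "nat \<Rightarrow> (nat \<Rightarrow> nat) set" where "tup n = {..<n} \<rightarrow>\<^sub>E {..<N}"

definition slater :: "nat \<Rightarrow> (nat \<Rightarrow> nat) \<Rightarrow> real" where
  "slater n y = Determinant.det (mat n n (\<lambda>(j, i). ef i (y j)))"

lemma finite_ens: "finite (ens n)"
  by (rule finite_subset[of _ "Pow {..<N}"]) (auto simp: ens_def)

lemma finite_tup: "finite (tup n)"
  unfolding tup_def by (intro finite_PiE) auto

lemma ens_finite: "S \<in> ens n \<Longrightarrow> finite S"
  by (auto simp: ens_def intro: finite_subset)

lemma sw_pos:
  assumes "S \<in> ens n"
  shows "sw S > 0"
proof -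
  have "x m \<noteq> x m'" if "m \<in> S" "m' \<in> S" "m \<noteq> m'" for m m'
    using that assms nodes_inj by (auto simp: ens_def inj_on_def)
  then show ?thesis unfolding sw_def using assms weight_pos
    by (intro mult_pos_pos prod_pos) (auto simp: ens_def)
qed

lemma slater_square:
  assumes y: "y \<in> tup n" and n: "n \<le> N"
  shows "(slater n y)\<^sup>2 = (if inj_on y {..<n} then sw (y ` {..<n}) / (\<Prod>i<n. hn i) else 0)"
proof -
  have yN: "y j < N" if "j < n" for j using y that by (auto simp: tup_def)
  have hp: "hn i > 0" if "i < n" for i using hn_pos n that by simp
  have "slater n y = Determinant.det (mat n n (\<lambda>(j, i). sqrt (w (y j)) * (1 / sqrt (hn i)) * poly (mop i) (x (y j))))"
    unfolding slater_def by (rule arg_cong[where f = Determinant.det], rule cong_mat) (auto simp: ef_def real_sqrt_divide)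
  also have "\<dots> = (\<Prod>j<n. sqrt (w (y j))) * (\<Prod>i<n. 1 / sqrt (hn i)) * (\<Prod>j<n. \<Prod>l<j. x (y j) - x (y l))"
    by (subst det_scale, subst det_monic) auto
  finally have "(slater n y)\<^sup>2 = (\<Prod>j<n. (sqrt (w (y j)))\<^sup>2) * (\<Prod>i<n. (1 / sqrt (hn i))\<^sup>2) *
      (\<Prod>j<n. \<Prod>l<j. x (y j) - x (y l))\<^sup>2"
    by (simp add: power_mult_distrib prod_power_distrib)
  also have "(\<Prod>j<n. (sqrt (w (y j)))\<^sup>2) = (\<Prod>j<n. w (y j))"
    using yN weight_pos by (intro prod.cong) (auto simp: less_imp_le)
  also have "(\<Prod>i<n. (1 / sqrt (hn i))\<^sup>2) = 1 / (\<Prod>i<n. hn i)"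
  proof -
    have "(\<Prod>i<n. (1 / sqrt (hn i))\<^sup>2) = (\<Prod>i<n. 1 / hn i)"
      using hp by (intro prod.cong) (auto simp: power_divide less_imp_le)
    then show ?thesis by (simp add: prod_dividef)
  qed
  also have "(\<Prod>j<n. \<Prod>l<j. x (y j) - x (y l))\<^sup>2 = (\<Prod>j<n. \<Prod>l<j. \<bar>x (y j) - x (y l)\<bar>)\<^sup>2"
    by (simp add: prod_power_distrib)
  also have "\<dots> = (\<Prod>j<n. \<Prod>l\<in>{..<n} - {j}. \<bar>x (y j) - x (y l)\<bar>)"
    by (subst prod_offdiag_square) (auto simp: abs_minus_commute)
  finally have *: "(slater n y)\<^sup>2 = (\<Prod>j<n. w (y j)) * (1 / (\<Prod>i<n. hn i)) *
      (\<Prod>j<n. \<Prod>l\<in>{..<n} - {j}. \<bar>x (y j) - x (y l)\<bar>)" .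
  show ?thesis
  proof (cases "inj_on y {..<n}")
    case True
    have "(\<Prod>m\<in>y ` {..<n} - {y j}. \<bar>x (y j) - x m\<bar>) = (\<Prod>l\<in>{..<n} - {j}. \<bar>x (y j) - x (y l)\<bar>)"
      if "j < n" for j
    proof -
      have "y ` {..<n} - {y j} = y ` ({..<n} - {j})"
        using True that by (auto simp: inj_on_def)
      then show ?thesis using True
        by (simp add: prod.reindex inj_on_diff)
    qed
    then show ?thesis unfolding * sw_def using True by (simp add: prod.reindex)
  next
    case False
    then obtain j l where jl: "j < n" "l < n" "j \<noteq> l" "y j = y l" by (auto simp: inj_on_def)
    then have z: "(\<Prod>l\<in>{..<n} - {j}. \<bar>x (y j) - x (y l)\<bar>) = 0"
      by (intro prod_zero[OF _ bexI[of _ l]]) (use jl in auto)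
    have zz: "(\<Prod>j<n. \<Prod>l\<in>{..<n} - {j}. \<bar>x (y j) - x (y l)\<bar>) = 0"
    proof (rule prod_zero[rotated])
      show "\<exists>j\<in>{..<n}. (\<Prod>l\<in>{..<n} - {j}. \<bar>x (y j) - x (y l)\<bar>) = 0" using z jl by blast
    qed simp
    show ?thesis unfolding * if_not_P[OF False] zz by (rule mult_zero_right)
  qed
qed

text \<open>
  Passing from sets to tuples costs a factor \<open>fact n\<close>.
\<close>

lemma card_enumerations:
  assumes "S \<in> ens n"
  shows "card {y \<in> tup n. inj_on y {..<n} \<and> y ` {..<n} = S} = fact n"
proof -
  have "{y \<in> tup n. inj_on y {..<n} \<and> y ` {..<n} = S} = {y \<in> {..<n} \<rightarrow>\<^sub>E S. inj_on y {..<n}}"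
  proof (intro equalityI subsetI)
    fix y assume "y \<in> {y \<in> {..<n} \<rightarrow>\<^sub>E S. inj_on y {..<n}}"
    then have y: "y \<in> {..<n} \<rightarrow>\<^sub>E S" "inj_on y {..<n}" by auto
    then have "y ` {..<n} = S"
      using assms ens_finite[OF assms] by (intro card_subset_eq) (auto simp: card_image ens_def)
    then show "y \<in> {y \<in> tup n. inj_on y {..<n} \<and> y ` {..<n} = S}"
      using y assms by (auto simp: tup_def ens_def PiE_iff)
  qed (auto simp: tup_def)
  also have "card \<dots> = fact n"
    using assms ens_finite[OF assms]
    by (subst card_inj_on_subset_funcset) (auto simp: ens_def fact_prod_rev)
  finally show ?thesis .
qed

lemma sum_tuples_slater:
  assumes n: "n \<le> N"
  shows "(\<Sum>y\<in>tup n. (slater n y)\<^sup>2 * G (y ` {..<n})) = fact n * (\<Sum>S\<in>ens n. sw S * G S) / (\<Prod>i<n. hn i)"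
proof -
  let ?I = "{y \<in> tup n. inj_on y {..<n}}"
  have "(\<Sum>y\<in>tup n. (slater n y)\<^sup>2 * G (y ` {..<n})) =
      (\<Sum>y\<in>?I. sw (y ` {..<n}) / (\<Prod>i<n. hn i) * G (y ` {..<n}))"
    using finite_tup n by (intro sum.mono_neutral_cong_right) (auto simp: slater_square)
  also have "\<dots> = (\<Sum>S\<in>ens n. \<Sum>y\<in>{y \<in> ?I. y ` {..<n} = S}. sw (y ` {..<n}) / (\<Prod>i<n. hn i) * G (y ` {..<n}))"
    using finite_tup finite_ens
    by (intro sum.group[symmetric]) (auto simp: ens_def tup_def card_image)
  also have "\<dots> = (\<Sum>S\<in>ens n. fact n * (sw S / (\<Prod>i<n. hn i) * G S))"
  proof (intro sum.cong refl)
    fix S assume "S \<in> ens n"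
    then have "card {y \<in> ?I. y ` {..<n} = S} = fact n"
      using card_enumerations[of S n] by (simp add: conj_assoc)
    then show "(\<Sum>y\<in>{y \<in> ?I. y ` {..<n} = S}. sw (y ` {..<n}) / (\<Prod>i<n. hn i) * G (y ` {..<n})) =
        fact n * (sw S / (\<Prod>i<n. hn i) * G S)"
      by simp
  qed
  also have "\<dots> = fact n * (\<Sum>S\<in>ens n. sw S * G S) / (\<Prod>i<n. hn i)"
    by (simp add: sum_distrib_left sum_divide_distrib mult_ac)
  finally show ?thesis .
qed

text \<open>
  The Andreief (Cauchy-Binet) identity: expanding both determinants decouples the sums over the
  components of the tuple.
\<close>

lemma andreief:
  "(\<Sum>y\<in>tup n. (slater n y)\<^sup>2 * (\<Prod>j<n. u j (y j))) =
   (\<Sum>p | p permutes {..<n}. \<Sum>r | r permutes {..<n}. signof p * signof r * (\<Prod>j<n. me (u j) (p j) (r j)))"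
proof -
  let ?P = "{p. p permutes {..<n}}"
  have D: "slater n y = (\<Sum>p\<in>?P. signof p * (\<Prod>j<n. ef (p j) (y j)))" for y
    unfolding slater_def lessThan_atLeast0
    by (subst det_def'[where n = n], simp, intro sum.cong refl arg_cong2[where f = "(*)"] prod.cong)
       (auto simp: permutes_less)
  have "(\<Sum>y\<in>tup n. (slater n y)\<^sup>2 * (\<Prod>j<n. u j (y j))) =
     (\<Sum>y\<in>tup n. \<Sum>p\<in>?P. \<Sum>r\<in>?P. signof p * signof r * (\<Prod>j<n. u j (y j) * ef (p j) (y j) * ef (r j) (y j)))"
  proof (rule sum.cong[OF refl])
    fix y
    have "(slater n y)\<^sup>2 = (\<Sum>p\<in>?P. \<Sum>r\<in>?P. (signof p * (\<Prod>j<n. ef (p j) (y j))) * (signof r * (\<Prod>j<n. ef (r j) (y j))))"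
      by (simp only: D power2_eq_square sum_product)
    then show "(slater n y)\<^sup>2 * (\<Prod>j<n. u j (y j)) =
        (\<Sum>p\<in>?P. \<Sum>r\<in>?P. signof p * signof r * (\<Prod>j<n. u j (y j) * ef (p j) (y j) * ef (r j) (y j)))"
      by (simp add: sum_distrib_left prod.distrib mult_ac)
  qed
  also have "\<dots> = (\<Sum>p\<in>?P. \<Sum>y\<in>tup n. \<Sum>r\<in>?P. signof p * signof r * (\<Prod>j<n. u j (y j) * ef (p j) (y j) * ef (r j) (y j)))"
    by (rule sum.swap)
  also have "\<dots> = (\<Sum>p\<in>?P. \<Sum>r\<in>?P. \<Sum>y\<in>tup n. signof p * signof r * (\<Prod>j<n. u j (y j) * ef (p j) (y j) * ef (r j) (y j)))"
    by (rule sum.cong[OF refl], rule sum.swap)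
  also have "\<dots> = (\<Sum>p\<in>?P. \<Sum>r\<in>?P. signof p * signof r * (\<Prod>j<n. me (u j) (p j) (r j)))"
    unfolding me_def tup_def by (subst prod_sum_PiE) (auto simp: sum_distrib_left)
  finally show ?thesis .
qed

lemma prod_delta_zero:
  assumes "n \<le> N" "p permutes {..<n}" "r permutes {..<n}" "j < n" "p j \<noteq> r j" "u j = (\<lambda>_. 1)"
  shows "(\<Prod>j<n. me (u j) (p j) (r j)) = 0"
proof (rule prod_zero)
  have "p j < n" "r j < n" using assms permutes_in_image[of _ "{..<n}" j] by auto
  then have "me (u j) (p j) (r j) = 0" using assms by (simp add: me_1)
  then show "\<exists>j\<in>{..<n}. me (u j) (p j) (r j) = 0" using assms by (intro bexI[of _ j]) auto
qed simp

lemma me_1_perm: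
  assumes "n \<le> N" "p permutes {..<n}" "j < n"
  shows "me (\<lambda>_. 1) (p j) (p j) = 1"
  using assms permutes_in_image[of p "{..<n}" j] by (simp add: me_1)

lemma sum_slater_1:
  assumes n: "n \<le> N"
  shows "(\<Sum>y\<in>tup n. (slater n y)\<^sup>2) = fact n"
proof -
  let ?P = "{p. p permutes {..<n}}"
  have "(\<Sum>y\<in>tup n. (slater n y)\<^sup>2 * (\<Prod>j<n. (\<lambda>j m. 1) j (y j))) =
     (\<Sum>p\<in>?P. \<Sum>r\<in>?P. signof p * signof r * (\<Prod>j<n. me ((\<lambda>j m. 1) j) (p j) (r j)))"
    by (rule andreief)
  also have "\<dots> = (\<Sum>p\<in>?P. 1)"
  proof (intro sum.cong refl)
    fix p assume p: "p \<in> ?P"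
    have "(\<Sum>r\<in>?P. signof p * signof r * (\<Prod>j<n. me ((\<lambda>j m. 1) j) (p j) (r j))) =
      (\<Sum>r\<in>{p}. signof p * signof r * (\<Prod>j<n. me (\<lambda>_. 1) (p j) (r j)))"
    proof (rule sum.mono_neutral_right)
      show "\<forall>r\<in>?P - {p}. signof p * signof r * (\<Prod>j<n. me (\<lambda>_. 1) (p j) (r j)) = 0"
      proof
        fix r assume r: "r \<in> ?P - {p}"
        then obtain j where j: "p j \<noteq> r j" by (metis DiffD2 ext singletonI)
        then have "j < n" using p r by (metis DiffD1 lessThan_iff mem_Collect_eq permutes_not_in)
        then show "signof p * signof r * (\<Prod>j<n. me (\<lambda>_. 1) (p j) (r j)) = 0"
          using prod_delta_zero[of n p r j "\<lambda>_ _. 1"] p r j n by simp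
      qed
    qed (use p in \<open>auto simp: finite_permutations\<close>)
    then show "(\<Sum>r\<in>?P. signof p * signof r * (\<Prod>j<n. me ((\<lambda>j m. 1) j) (p j) (r j))) = (1 :: real)"
      using p n by (simp add: me_1_perm flip: of_int_mult)
  qed
  also have "\<dots> = fact n" by (simp add: card_permutations)
  finally show ?thesis by simp
qed

lemma Zn_eq:
  assumes n: "n \<le> N"
  shows "Zn n = (\<Prod>i<n. hn i)"
proof -
  have "(\<Prod>i<n. hn i) > 0" using n hn_pos by (intro prod_pos) auto
  then have "(\<Prod>i<n. hn i) \<noteq> 0" by linarith
  then show ?thesis
    using sum_tuples_slater[OF n, of "\<lambda>_. 1"] sum_slater_1[OF n] unfolding Zn_def by (simp add: eq_divide_eq del: prod_zero_iff)
qed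

lemma Zn_pos: "n \<le> N \<Longrightarrow> Zn n > 0"
  by (subst Zn_eq) (auto intro!: prod_pos hn_pos)

lemma EE_tuples:
  assumes n: "n \<le> N"
  shows "EE n G = (\<Sum>y\<in>tup n. (slater n y)\<^sup>2 * G (y ` {..<n})) / fact n"
  unfolding EE_def Zn_eq[OF n] sum_tuples_slater[OF n, of G] by simp

text \<open>
  By orthonormality only equal permutations survive when a single component carries a test function.
\<close>

lemma sum_slater_single:
  assumes n: "n \<le> N" and k: "k < n"
  shows "(\<Sum>y\<in>tup n. (slater n y)\<^sup>2 * f (y k)) = (\<Sum>p | p permutes {..<n}. me f (p k) (p k))"
proof -
  let ?P = "{p. p permutes {..<n}}"
  define u where "u = (\<lambda>j. if j = k then f else (\<lambda>_. 1 :: real))"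
  have pu: "(\<Prod>j<n. g (u j) j) = g f k * (\<Prod>j\<in>{..<n} - {k}. g (\<lambda>_. 1) j)" for g :: "_ \<Rightarrow> _ \<Rightarrow> real"
    using k by (subst prod.remove[of _ k]) (auto simp: u_def)
  have "(\<Sum>y\<in>tup n. (slater n y)\<^sup>2 * f (y k)) = (\<Sum>y\<in>tup n. (slater n y)\<^sup>2 * (\<Prod>j<n. u j (y j)))"
    using pu[of "\<lambda>f j. f (y j)" for y] by simp
  also have "\<dots> = (\<Sum>p\<in>?P. \<Sum>r\<in>?P. signof p * signof r * (\<Prod>j<n. me (u j) (p j) (r j)))"
    by (rule andreief)
  also have "\<dots> = (\<Sum>p\<in>?P. me f (p k) (p k))"
  proof (intro sum.cong refl)
    fix p assume p: "p \<in> ?P"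
    have "(\<Sum>r\<in>?P. signof p * signof r * (\<Prod>j<n. me (u j) (p j) (r j))) =
      (\<Sum>r\<in>{p}. signof p * signof r * (\<Prod>j<n. me (u j) (p j) (r j)))"
    proof (rule sum.mono_neutral_right)
      show "\<forall>r\<in>?P - {p}. signof p * signof r * (\<Prod>j<n. me (u j) (p j) (r j)) = 0"
      proof
        fix r assume r: "r \<in> ?P - {p}"
        then obtain j where j: "p j \<noteq> r j" "j \<noteq> k"
          using permutes_agree_off_one[of p "{..<n}" r k] p by auto
        then have "j < n" using p r by (metis DiffD1 lessThan_iff mem_Collect_eq permutes_not_in)
        then show "signof p * signof r * (\<Prod>j<n. me (u j) (p j) (r j)) = 0"
          using prod_delta_zero[of n p r j u] p r j n by (simp add: u_def)
      qed
    qed (use p in \<open>auto simp: finite_permutations\<close>)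
    then show "(\<Sum>r\<in>?P. signof p * signof r * (\<Prod>j<n. me (u j) (p j) (r j))) = me f (p k) (p k)"
      using p n pu[of "\<lambda>f j. me f (p j) (p j)"] by (simp add: me_1_perm flip: of_int_mult)
  qed
  finally show ?thesis .
qed

text \<open>
  With two test functions the second permutation may differ from the first one by the transposition
  of the two marked positions; its sign produces the exchange term.
\<close>

lemma sum_slater_pair:
  assumes n: "n \<le> N" and k: "k < n" and l: "l < n" and kl: "k \<noteq> l"
  shows "(\<Sum>y\<in>tup n. (slater n y)\<^sup>2 * (f (y k) * g (y l))) =
    (\<Sum>p | p permutes {..<n}. me f (p k) (p k) * me g (p l) (p l) - me f (p k) (p l) * me g (p l) (p k))"
proof -
  let ?P = "{p. p permutes {..<n}}" and ?t = "Transposition.transpose k l"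
  define u where "u = (\<lambda>j. if j = k then f else if j = l then g else (\<lambda>_. 1 :: real))"
  have pu: "(\<Prod>j<n. h (u j) j) = h f k * h g l * (\<Prod>j\<in>{..<n} - {k, l}. h (\<lambda>_. 1) j)" for h :: "_ \<Rightarrow> _ \<Rightarrow> real"
  proof -
    have "(\<Prod>j<n. h (u j) j) = h f k * (\<Prod>j\<in>{..<n} - {k}. h (u j) j)"
      using k by (subst prod.remove[of _ k]) (auto simp: u_def)
    also have "(\<Prod>j\<in>{..<n} - {k}. h (u j) j) = h g l * (\<Prod>j\<in>{..<n} - {k} - {l}. h (u j) j)"
      using l kl by (subst prod.remove[of _ l]) (auto simp: u_def)
    also have "{..<n} - {k} - {l} = {..<n} - {k, l}" by auto
    also have "(\<Prod>j\<in>{..<n} - {k, l}. h (u j) j) = (\<Prod>j\<in>{..<n} - {k, l}. h (\<lambda>_. 1) j)"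
      by (intro prod.cong) (auto simp: u_def)
    finally show ?thesis by (simp add: mult_ac)
  qed
  have "(\<Sum>y\<in>tup n. (slater n y)\<^sup>2 * (f (y k) * g (y l))) = (\<Sum>y\<in>tup n. (slater n y)\<^sup>2 * (\<Prod>j<n. u j (y j)))"
    using pu[of "\<lambda>f j. f (y j)" for y] by simp
  also have "\<dots> = (\<Sum>p\<in>?P. \<Sum>r\<in>?P. signof p * signof r * (\<Prod>j<n. me (u j) (p j) (r j)))"
    by (rule andreief)
  also have "\<dots> = (\<Sum>p\<in>?P. me f (p k) (p k) * me g (p l) (p l) - me f (p k) (p l) * me g (p l) (p k))"
  proof (intro sum.cong refl)
    fix p assume "p \<in> ?P"
    then have p: "p permutes {..<n}" by simp
    have t: "?t permutes {..<n}" using k l by (intro permutes_swap_id) auto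
    have pt: "(p \<circ> ?t) permutes {..<n}" by (rule permutes_compose[OF t p])
    have ne: "p \<noteq> p \<circ> ?t"
      using kl permutes_inj[OF p] by (metis comp_apply injD transpose_apply_first)
    have sg: "sign (p \<circ> ?t) = - sign p"
      using sign_compose[of p ?t] p t kl
      by (auto simp: permutation_permutes sign_swap_id)
    have sq: "signof p * signof p = (1 :: real)" by (simp flip: of_int_mult)
    have "(\<Sum>r\<in>?P. signof p * signof r * (\<Prod>j<n. me (u j) (p j) (r j))) =
      (\<Sum>r\<in>{p, p \<circ> ?t}. signof p * signof r * (\<Prod>j<n. me (u j) (p j) (r j)))"
    proof (rule sum.mono_neutral_right)
      show "\<forall>r\<in>?P - {p, p \<circ> ?t}. signof p * signof r * (\<Prod>j<n. me (u j) (p j) (r j)) = 0"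
      proof
        fix r assume r: "r \<in> ?P - {p, p \<circ> ?t}"
        then obtain j where j: "p j \<noteq> r j" "j \<noteq> k" "j \<noteq> l"
          using permutes_agree_off_two[of p "{..<n}" r k l] p k l kl by auto
        then have "j < n" using p r by (metis DiffD1 lessThan_iff mem_Collect_eq permutes_not_in)
        then show "signof p * signof r * (\<Prod>j<n. me (u j) (p j) (r j)) = 0"
          using prod_delta_zero[of n p r j u] p r j n by (simp add: u_def)
      qed
    qed (use p pt in \<open>auto simp: finite_permutations\<close>)
    also have "\<dots> = (\<Prod>j<n. me (u j) (p j) (p j)) - (\<Prod>j<n. me (u j) (p j) ((p \<circ> ?t) j))"
      using ne sg sq by (simp add: mult.assoc[symmetric] del: comp_apply)
    also have "(\<Prod>j<n. me (u j) (p j) (p j)) = me f (p k) (p k) * me g (p l) (p l)"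
      using n p pu[of "\<lambda>f j. me f (p j) (p j)"] by (simp add: me_1_perm)
    also have "(\<Prod>j<n. me (u j) (p j) ((p \<circ> ?t) j)) = me f (p k) (p l) * me g (p l) (p k) *
        (\<Prod>j\<in>{..<n} - {k, l}. me (\<lambda>_. 1) (p j) ((p \<circ> ?t) j))"
      using pu[of "\<lambda>f j. me f (p j) ((p \<circ> ?t) j)"] by simp
    also have "(\<Prod>j\<in>{..<n} - {k, l}. me (\<lambda>_. 1) (p j) ((p \<circ> ?t) j)) = 1"
      using n p by (intro prod.neutral) (auto simp: me_1_perm transpose_apply_other)
    finally show "(\<Sum>r\<in>?P. signof p * signof r * (\<Prod>j<n. me (u j) (p j) (r j))) =
        me f (p k) (p k) * me g (p l) (p l) - me f (p k) (p l) * me g (p l) (p k)" by simp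
  qed
  finally show ?thesis .
qed

lemma EE_linear:
  assumes n: "n \<le> N"
  shows "EE n (\<lambda>S. \<Sum>m\<in>S. f m) = (\<Sum>i<n. me f i i)"
proof -
  let ?P = "{p. p permutes {..<n}}"
  have "(\<Sum>y\<in>tup n. (slater n y)\<^sup>2 * (\<Sum>m\<in>y ` {..<n}. f m)) = (\<Sum>y\<in>tup n. \<Sum>k<n. (slater n y)\<^sup>2 * f (y k))"
  \<comment> \<open>Coinciding components contribute nothing, since the determinant is then zero.\<close>
  proof (intro sum.cong refl)
    fix y assume y: "y \<in> tup n"
    show "(slater n y)\<^sup>2 * (\<Sum>m\<in>y ` {..<n}. f m) = (\<Sum>k<n. (slater n y)\<^sup>2 * f (y k))"
      by (cases "inj_on y {..<n}")
         (use slater_square[OF y n] in \<open>auto simp: sum.reindex sum_distrib_left\<close>)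
  qed
  also have "\<dots> = (\<Sum>k<n. \<Sum>y\<in>tup n. (slater n y)\<^sup>2 * f (y k))" by (rule sum.swap)
  also have "\<dots> = (\<Sum>k<n. \<Sum>p\<in>?P. me f (p k) (p k))"
    using n by (intro sum.cong[OF refl]) (simp add: sum_slater_single)
  also have "\<dots> = (\<Sum>p\<in>?P. \<Sum>k<n. me f (p k) (p k))" by (rule sum.swap)
  also have "\<dots> = (\<Sum>p\<in>?P. \<Sum>i<n. me f i i)"
    by (rule sum.cong[OF refl]) (use sum.permute[of _ "{..<n}" "\<lambda>i. me f i i"] in \<open>simp add: o_def\<close>)
  also have "\<dots> = fact n * (\<Sum>i<n. me f i i)" by (simp add: card_permutations)
  finally show ?thesis by (simp add: EE_tuples[OF n])
qed

lemma EE_add: "EE n (\<lambda>S. F S + G S) = EE n F + EE n G"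
  by (simp add: EE_def sum.distrib algebra_simps add_divide_distrib)

lemma EE_offdiag:
  assumes n: "n \<le> N"
  shows "EE n (\<lambda>S. \<Sum>m\<in>S. \<Sum>m'\<in>S - {m}. f m * g m') =
    (\<Sum>i<n. \<Sum>l<n. me f i i * me g l l - me f i l * me g l i)"
proof -
  let ?P = "{p. p permutes {..<n}}"
  have "(\<Sum>y\<in>tup n. (slater n y)\<^sup>2 * (\<Sum>m\<in>y ` {..<n}. \<Sum>m'\<in>y ` {..<n} - {m}. f m * g m')) =
      (\<Sum>y\<in>tup n. \<Sum>k<n. \<Sum>l\<in>{..<n} - {k}. (slater n y)\<^sup>2 * (f (y k) * g (y l)))"
  proof (intro sum.cong refl)
    fix y assume y: "y \<in> tup n"
    show "(slater n y)\<^sup>2 * (\<Sum>m\<in>y ` {..<n}. \<Sum>m'\<in>y ` {..<n} - {m}. f m * g m') =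
        (\<Sum>k<n. \<Sum>l\<in>{..<n} - {k}. (slater n y)\<^sup>2 * (f (y k) * g (y l)))"
    proof (cases "inj_on y {..<n}")
      case True
      have "y ` {..<n} - {y k} = y ` ({..<n} - {k})" if "k < n" for k
        using True that by (auto simp: inj_on_def)
      then show ?thesis using True
        by (simp add: sum.reindex inj_on_diff sum_distrib_left)
    next
      case False
      then have "(slater n y)\<^sup>2 = 0" using slater_square[OF y n] by simp
      then show ?thesis by simp
    qed
  qed
  also have "\<dots> = (\<Sum>k<n. \<Sum>y\<in>tup n. \<Sum>l\<in>{..<n} - {k}. (slater n y)\<^sup>2 * (f (y k) * g (y l)))"
    by (rule sum.swap)
  also have "\<dots> = (\<Sum>k<n. \<Sum>l\<in>{..<n} - {k}. \<Sum>y\<in>tup n. (slater n y)\<^sup>2 * (f (y k) * g (y l)))"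
    by (rule sum.cong[OF refl], rule sum.swap)
  also have "\<dots> = (\<Sum>k<n. \<Sum>l\<in>{..<n} - {k}. \<Sum>p\<in>?P.
      me f (p k) (p k) * me g (p l) (p l) - me f (p k) (p l) * me g (p l) (p k))"
    using n by (intro sum.cong[OF refl] sum_slater_pair) auto
  also have "\<dots> = (\<Sum>k<n. \<Sum>l<n. \<Sum>p\<in>?P.
      me f (p k) (p k) * me g (p l) (p l) - me f (p k) (p l) * me g (p l) (p k))"
    by (intro sum.cong refl sum.mono_neutral_left) auto
  also have "\<dots> = (\<Sum>k<n. \<Sum>p\<in>?P. \<Sum>l<n.
      me f (p k) (p k) * me g (p l) (p l) - me f (p k) (p l) * me g (p l) (p k))"
    by (rule sum.cong[OF refl], rule sum.swap)
  also have "\<dots> = (\<Sum>p\<in>?P. \<Sum>k<n. \<Sum>l<n.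
      me f (p k) (p k) * me g (p l) (p l) - me f (p k) (p l) * me g (p l) (p k))"
    by (rule sum.swap)
  also have "\<dots> = (\<Sum>p\<in>?P. \<Sum>i<n. \<Sum>l<n. me f i i * me g l l - me f i l * me g l i)"
  proof (rule sum.cong[OF refl])
    fix p assume "p \<in> ?P"
    then have p: "p permutes {..<n}" by simp
    have "(\<Sum>k<n. \<Sum>l<n. me f (p k) (p k) * me g (p l) (p l) - me f (p k) (p l) * me g (p l) (p k)) =
      (\<Sum>k<n. \<Sum>l<n. me f (p k) (p k) * me g l l - me f (p k) l * me g l (p k))"
      using sum.permute[OF p, of "\<lambda>l. me f (p k) (p k) * me g l l - me f (p k) l * me g l (p k)" for k]
      by (simp add: o_def)
    also have "\<dots> = (\<Sum>i<n. \<Sum>l<n. me f i i * me g l l - me f i l * me g l i)"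
      using sum.permute[OF p, of "\<lambda>i. \<Sum>l<n. me f i i * me g l l - me f i l * me g l i"]
      by (simp add: o_def)
    finally show "(\<Sum>k<n. \<Sum>l<n. me f (p k) (p k) * me g (p l) (p l) - me f (p k) (p l) * me g (p l) (p k)) =
      (\<Sum>i<n. \<Sum>l<n. me f i i * me g l l - me f i l * me g l i)" .
  qed
  also have "\<dots> = fact n * (\<Sum>i<n. \<Sum>l<n. me f i i * me g l l - me f i l * me g l i)"
    by (simp add: card_permutations)
  finally show ?thesis by (simp add: EE_tuples[OF n])
qed

definition cov :: "nat \<Rightarrow> (nat \<Rightarrow> real) \<Rightarrow> (nat \<Rightarrow> real) \<Rightarrow> real" where
  "cov n f g = EE n (\<lambda>S. (\<Sum>m\<in>S. f m) * (\<Sum>m\<in>S. g m)) -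
     EE n (\<lambda>S. \<Sum>m\<in>S. f m) * EE n (\<lambda>S. \<Sum>m\<in>S. g m)"

lemma cov_trace:
  assumes n: "n \<le> N"
  shows "cov n f g = (\<Sum>i<n. me (\<lambda>m. f m * g m) i i) - (\<Sum>i<n. \<Sum>l<n. me f i l * me g l i)"
proof -
  have "EE n (\<lambda>S. (\<Sum>m\<in>S. f m) * (\<Sum>m\<in>S. g m)) =
      EE n (\<lambda>S. (\<Sum>m\<in>S. f m * g m) + (\<Sum>m\<in>S. \<Sum>m'\<in>S - {m}. f m * g m'))"
    unfolding EE_def
  proof (intro arg_cong2[where f = "(/)"] sum.cong refl arg_cong2[where f = "(*)"])
    fix S assume "S \<in> ens n"
    then have S: "finite S" by (rule ens_finite)
    then have "(\<Sum>m'\<in>S. f m * g m') = f m * g m + (\<Sum>m'\<in>S - {m}. f m * g m')" if "m \<in> S" for m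
      using that by (subst sum.remove[of _ m]) auto
    then show "(\<Sum>m\<in>S. f m) * (\<Sum>m\<in>S. g m) = (\<Sum>m\<in>S. f m * g m) + (\<Sum>m\<in>S. \<Sum>m'\<in>S - {m}. f m * g m')"
      by (simp add: sum_product sum.distrib)
  qed
  also have "\<dots> = (\<Sum>i<n. me (\<lambda>m. f m * g m) i i) + (\<Sum>i<n. me f i i) * (\<Sum>i<n. me g i i) -
      (\<Sum>i<n. \<Sum>l<n. me f i l * me g l i)"
    unfolding EE_add EE_linear[OF n] EE_offdiag[OF n] by (simp add: sum_subtractf sum_product)
  finally show ?thesis unfolding cov_def EE_linear[OF n] by simp
qed

text \<open>
  Subtracting the part \<open>l < n\<close> of the full matrix product leaves the corner: the fluctuations are
  governed by the matrix elements close to the index \<open>n\<close> only.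
\<close>

lemma cov_corner:
  assumes n: "n \<le> N"
  shows "cov n f g = (\<Sum>i<n. \<Sum>l\<in>{n..<N}. me f i l * me g i l)"
proof -
  have "me (\<lambda>m. f m * g m) i i - (\<Sum>l<n. me f i l * me g l i) = (\<Sum>l\<in>{n..<N}. me f i l * me g i l)" for i
  proof -
    have "(\<Sum>l<N. me f i l * me g l i) = (\<Sum>l<n. me f i l * me g l i) + (\<Sum>l\<in>{n..<N}. me f i l * me g l i)"
      using n unfolding lessThan_atLeast0 by (subst sum.atLeastLessThan_concat) auto
    then show ?thesis
      unfolding me_mult[of f i g i] by (simp add: me_commute[of g])
  qed
  then show ?thesis unfolding cov_trace[OF n] sum_subtractf[symmetric] by simp
qed

text \<open>
  Symmetric form of the covariance in terms of the reproducing kernel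
  \<open>K m m' = \<Sum>i<n. ef i m * ef i m'\<close>, which is a projection.
\<close>

lemma cov_kernel:
  assumes n: "n \<le> N"
  shows "cov n f f = 1 / 2 * (\<Sum>m<N. \<Sum>m'<N. (f m - f m')\<^sup>2 * (\<Sum>i<n. ef i m * ef i m')\<^sup>2)"
proof -
  define K where "K = (\<lambda>m m'. \<Sum>i<n. ef i m * ef i m')"
  have Kfold: "(\<Sum>i<n. ef i m * ef i m') = K m m'" for m m' by (simp add: K_def)
  have Ksym: "K m m' = K m' m" for m m' by (simp add: K_def mult_ac)
  have Kproj: "(\<Sum>m'<N. (K m m')\<^sup>2) = K m m" for m
  proof -
    have "(\<Sum>m'<N. (K m m')\<^sup>2) = (\<Sum>m'<N. \<Sum>i<n. \<Sum>l<n. ef i m * ef l m * (1 * ef i m' * ef l m'))"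
      by (simp add: K_def power2_eq_square sum_product mult_ac)
    also have "\<dots> = (\<Sum>i<n. \<Sum>m'<N. \<Sum>l<n. ef i m * ef l m * (1 * ef i m' * ef l m'))"
      by (rule sum.swap)
    also have "\<dots> = (\<Sum>i<n. \<Sum>l<n. ef i m * ef l m * me (\<lambda>_. 1) i l)"
      unfolding me_def sum_distrib_left by (rule sum.cong[OF refl], rule sum.swap)
    also have "\<dots> = (\<Sum>i<n. \<Sum>l<n. ef i m * ef l m * (if i = l then 1 else 0))"
      using n by (intro sum.cong refl) (simp add: me_1)
    also have "\<dots> = K m m" by (simp add: K_def if_distrib cong: if_cong)
    finally show ?thesis .
  qed
  have 1: "(\<Sum>i<n. me (\<lambda>m. f m * f m) i i) = (\<Sum>m<N. (f m)\<^sup>2 * K m m)"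
    unfolding me_def K_def sum_distrib_left by (subst sum.swap) (simp add: power2_eq_square mult_ac)
  have 2: "(\<Sum>i<n. \<Sum>l<n. me f i l * me f l i) = (\<Sum>m<N. \<Sum>m'<N. f m * f m' * (K m m')\<^sup>2)"
  proof -
    have "(\<Sum>i<n. \<Sum>l<n. me f i l * me f l i) =
       (\<Sum>i<n. \<Sum>l<n. \<Sum>m<N. \<Sum>m'<N. f m * f m' * (ef i m * ef i m') * (ef l m * ef l m'))"
      by (simp add: me_def sum_product mult_ac)
    also have "\<dots> = (\<Sum>i<n. \<Sum>m<N. \<Sum>l<n. \<Sum>m'<N. f m * f m' * (ef i m * ef i m') * (ef l m * ef l m'))"
      by (rule sum.cong[OF refl], rule sum.swap)
    also have "\<dots> = (\<Sum>m<N. \<Sum>i<n. \<Sum>l<n. \<Sum>m'<N. f m * f m' * (ef i m * ef i m') * (ef l m * ef l m'))"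
      by (rule sum.swap)
    also have "\<dots> = (\<Sum>m<N. \<Sum>i<n. \<Sum>m'<N. \<Sum>l<n. f m * f m' * (ef i m * ef i m') * (ef l m * ef l m'))"
      by (rule sum.cong[OF refl], rule sum.cong[OF refl], rule sum.swap)
    also have "\<dots> = (\<Sum>m<N. \<Sum>m'<N. \<Sum>i<n. \<Sum>l<n. f m * f m' * (ef i m * ef i m') * (ef l m * ef l m'))"
      by (rule sum.cong[OF refl], rule sum.swap)
    also have "\<dots> = (\<Sum>m<N. \<Sum>m'<N. f m * f m' * (K m m')\<^sup>2)"
      by (simp add: K_def power2_eq_square sum_product sum_distrib_left mult_ac)
    finally show ?thesis .
  qed
  have "(\<Sum>m<N. \<Sum>m'<N. (f m - f m')\<^sup>2 * (K m m')\<^sup>2) =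
      (\<Sum>m<N. \<Sum>m'<N. (f m)\<^sup>2 * (K m m')\<^sup>2) + (\<Sum>m<N. \<Sum>m'<N. (f m')\<^sup>2 * (K m m')\<^sup>2) -
      2 * (\<Sum>m<N. \<Sum>m'<N. f m * f m' * (K m m')\<^sup>2)"
    by (simp add: power2_diff algebra_simps sum.distrib sum_subtractf sum_distrib_left)
  also have "(\<Sum>m<N. \<Sum>m'<N. (f m')\<^sup>2 * (K m m')\<^sup>2) = (\<Sum>m<N. \<Sum>m'<N. (f m)\<^sup>2 * (K m m')\<^sup>2)"
    by (subst sum.swap) (simp add: Ksym)
  also have "(\<Sum>m<N. \<Sum>m'<N. (f m)\<^sup>2 * (K m m')\<^sup>2) = (\<Sum>m<N. (f m)\<^sup>2 * K m m)"
    by (simp add: Kproj flip: sum_distrib_left)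
  finally show ?thesis
    unfolding cov_trace[OF n] 1 2 Kfold by simp
qed

text \<open>
  Comparison with the identity function, term by term in the kernel formula.
\<close>

lemma cov_lipschitz:
  assumes n: "n \<le> N" and L: "\<And>m m'. m < N \<Longrightarrow> m' < N \<Longrightarrow> \<bar>f m - f m'\<bar> \<le> L * \<bar>x m - x m'\<bar>"
  shows "cov n f f \<le> L\<^sup>2 * cov n x x"
proof -
  have "(f m - f m')\<^sup>2 \<le> L\<^sup>2 * (x m - x m')\<^sup>2" if "m < N" "m' < N" for m m'
  proof -
    have "\<bar>f m - f m'\<bar>\<^sup>2 \<le> (L * \<bar>x m - x m'\<bar>)\<^sup>2"
      using L[OF that] by (intro power_mono) auto
    then show ?thesis by (simp add: power_mult_distrib)
  qed
  then have "cov n f f \<le> 1 / 2 * (\<Sum>m<N. \<Sum>m'<N. (L\<^sup>2 * (x m - x m')\<^sup>2) * (\<Sum>i<n. ef i m * ef i m')\<^sup>2)"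
    unfolding cov_kernel[OF n]
    by (intro mult_left_mono sum_mono mult_right_mono) auto
  also have "\<dots> = L\<^sup>2 * cov n x x"
    unfolding cov_kernel[OF n] by (simp add: sum_distrib_left mult_ac)
  finally show ?thesis .
qed

text \<open>
  Since the matrix of \<open>x\<close> is tridiagonal, its corner has a single entry.
\<close>

lemma cov_x_left:
  assumes n: "0 < n" "n < N"
  shows "cov n x g = ra n * me g (n - 1) n"
proof -
  have "cov n x g = (\<Sum>i<n. \<Sum>l\<in>{n..<N}. me x i l * me g i l)"
    using n by (intro cov_corner) auto
  also have "\<dots> = (\<Sum>i\<in>{n - 1}. \<Sum>l\<in>{n..<N}. me x i l * me g i l)"
    by (rule sum.mono_neutral_right) (use n me_x_banded in \<open>auto intro!: sum.neutral\<close>)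
  also have "\<dots> = (\<Sum>l\<in>{n..<N}. me x (n - 1) l * me g (n - 1) l)" by simp
  also have "\<dots> = (\<Sum>l\<in>{n}. me x (n - 1) l * me g (n - 1) l)"
    by (rule sum.mono_neutral_right) (use n me_x_banded in auto)
  also have "\<dots> = ra n * me g (n - 1) n"
    using n me_x_offdiag[of "n - 1"] by simp
  finally show ?thesis .
qed

end

section \<open>Exponential tilting and the Toda equations\<close>

context node_weight
begin

text \<open>
  Multiplying the weight by \<open>exp (t * g)\<close> gives each configuration the extra factor
  \<open>exp (t * \<Sum>m\<in>S. g m)\<close>, so derivatives in \<open>t\<close> are cumulants of the linear statistic of \<open>g\<close>.
\<close>

definition wt :: "(nat \<Rightarrow> real) \<Rightarrow> real \<Rightarrow> nat \<Rightarrow> real" where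
  "wt g t m = w m * exp (t * g m)"

lemma wt_0: "wt g 0 = w"
  by (simp add: wt_def fun_eq_iff)

lemma node_weight_wt: "node_weight N x (wt g t)"
  by unfold_locales (use nodes_inj weight_pos in \<open>auto simp: wt_def\<close>)

lemma sw_wt: "finite S \<Longrightarrow> node_weight.sw x (wt g t) S = sw S * exp (t * (\<Sum>m\<in>S. g m))"
  by (simp add: node_weight.sw_def[OF node_weight_wt] sw_def wt_def prod.distrib exp_sum sum_distrib_left)

text \<open>
  Its increments in \<open>t\<close> form the cumulant generating function; its second difference in \<open>n\<close> is the
  logarithm of a squared recurrence coefficient.
\<close>

definition log_Zn :: "(nat \<Rightarrow> real) \<Rightarrow> nat \<Rightarrow> real \<Rightarrow> real" where
  "log_Zn g n t = ln (node_weight.Zn N x (wt g t) n)"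

lemma EE_wt:
  "node_weight.EE N x (wt g t) n F =
     (\<Sum>S\<in>ens n. sw S * exp (t * (\<Sum>m\<in>S. g m)) * F S) / (\<Sum>S\<in>ens n. sw S * exp (t * (\<Sum>m\<in>S. g m)))"
  and Zn_wt: "node_weight.Zn N x (wt g t) n = (\<Sum>S\<in>ens n. sw S * exp (t * (\<Sum>m\<in>S. g m)))"
  by (simp_all add: node_weight.EE_def[OF node_weight_wt] node_weight.Zn_def[OF node_weight_wt] sw_wt ens_finite
      cong: sum.cong)

lemma exp_sum_deriv:
  "((\<lambda>t. \<Sum>S\<in>ens n. sw S * exp (t * X S) * F S) has_real_derivative
     (\<Sum>S\<in>ens n. sw S * exp (t * X S) * (X S * F S))) (at t)"
  by (auto intro!: derivative_eq_intros sum.cong)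

lemma log_Zn_deriv:
  assumes n: "n \<le> N"
  shows "(log_Zn g n has_real_derivative node_weight.EE N x (wt g t) n (\<lambda>S. \<Sum>m\<in>S. g m)) (at t)"
proof -
  let ?Z = "\<lambda>t. \<Sum>S\<in>ens n. sw S * exp (t * (\<Sum>m\<in>S. g m))"
  have pos: "?Z t > 0" for t
    using node_weight.Zn_pos[OF node_weight_wt n, of g t] by (simp add: Zn_wt)
  have "(?Z has_real_derivative (\<Sum>S\<in>ens n. sw S * exp (t * (\<Sum>m\<in>S. g m)) * (\<Sum>m\<in>S. g m))) (at t)"
    using exp_sum_deriv[where X = "\<lambda>S. \<Sum>m\<in>S. g m" and F = "\<lambda>_. 1"] by simp
  from DERIV_ln_divide[OF pos] this
  have "((\<lambda>t. ln (?Z t)) has_real_derivative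
      1 / ?Z t * (\<Sum>S\<in>ens n. sw S * exp (t * (\<Sum>m\<in>S. g m)) * (\<Sum>m\<in>S. g m))) (at t)"
    by (rule DERIV_chain2)
  then show ?thesis unfolding log_Zn_def[abs_def] Zn_wt EE_wt by simp
qed

lemma EE_deriv:
  assumes n: "n \<le> N"
  shows "((\<lambda>t. node_weight.EE N x (wt g t) n (\<lambda>S. \<Sum>m\<in>S. u m)) has_real_derivative
     node_weight.cov N x (wt g t) n u g) (at t)"
proof -
  let ?X = "\<lambda>S. \<Sum>m\<in>S. g m" and ?U = "\<lambda>S. \<Sum>m\<in>S. u m"
  let ?Z = "\<lambda>t. \<Sum>S\<in>ens n. sw S * exp (t * ?X S)"
  have pos: "?Z t > 0" for t
    using node_weight.Zn_pos[OF node_weight_wt n, of g t] by (simp add: Zn_wt)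
  have dZ: "(?Z has_real_derivative (\<Sum>S\<in>ens n. sw S * exp (t * ?X S) * ?X S)) (at t)"
    using exp_sum_deriv[where X = ?X and F = "\<lambda>_. 1"] by simp
  have "((\<lambda>t. (\<Sum>S\<in>ens n. sw S * exp (t * ?X S) * ?U S) / ?Z t) has_real_derivative
      ((\<Sum>S\<in>ens n. sw S * exp (t * ?X S) * (?X S * ?U S)) * ?Z t -
       (\<Sum>S\<in>ens n. sw S * exp (t * ?X S) * ?U S) * (\<Sum>S\<in>ens n. sw S * exp (t * ?X S) * ?X S)) /
      (?Z t * ?Z t)) (at t)"
    using pos[of t] by (intro DERIV_divide exp_sum_deriv dZ) simp
  also have "((\<Sum>S\<in>ens n. sw S * exp (t * ?X S) * (?X S * ?U S)) * ?Z t -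
       (\<Sum>S\<in>ens n. sw S * exp (t * ?X S) * ?U S) * (\<Sum>S\<in>ens n. sw S * exp (t * ?X S) * ?X S)) /
      (?Z t * ?Z t) = node_weight.cov N x (wt g t) n u g"
    unfolding node_weight.cov_def[OF node_weight_wt] EE_wt
    using pos[of t] by (simp add: diff_divide_distrib mult.commute[of "?X _"])
  finally show ?thesis unfolding EE_wt .
qed

text \<open>
  Recurrence coefficients are differences in \<open>n\<close> of expectations and of log partition functions.
  This reduces their evolution to the derivatives already known.
\<close>

lemma rb_wt:
  assumes "n < N"
  shows "node_weight.rb N x (wt g t) n =
    node_weight.EE N x (wt g t) (Suc n) (\<lambda>S. \<Sum>m\<in>S. x m) - node_weight.EE N x (wt g t) n (\<lambda>S. \<Sum>m\<in>S. x m)"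
proof -
  interpret T: node_weight N x "wt g t" by (rule node_weight_wt)
  show ?thesis using assms by (simp add: T.EE_linear T.me_x_diag)
qed

lemma ra_wt:
  assumes "0 < n" "n < N"
  shows "node_weight.ra N x (wt g t) n = exp ((log_Zn g (Suc n) t - 2 * log_Zn g n t + log_Zn g (n - 1) t) / 2)"
proof -
  interpret T: node_weight N x "wt g t" by (rule node_weight_wt)
  have Z: "T.Zn (Suc n) > 0" "T.Zn n > 0" "T.Zn (n - 1) > 0"
    using assms by (auto intro!: T.Zn_pos)
  have Z_Suc: "T.Zn (Suc i) = T.Zn i * T.hn i" if "i < N" for i
    using that by (simp add: T.Zn_eq)
  have "T.hn n = T.Zn (Suc n) / T.Zn n"
    using assms Z Z_Suc[of n] by simp
  moreover have "T.hn (n - 1) = T.Zn n / T.Zn (n - 1)"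
    using assms Z Z_Suc[of "n - 1"] by simp
  ultimately have "T.ra n = sqrt (T.Zn (Suc n) / T.Zn n / (T.Zn n / T.Zn (n - 1)))"
    using assms by (simp add: T.ra_def)
  also have "T.Zn (Suc n) / T.Zn n / (T.Zn n / T.Zn (n - 1)) = exp (log_Zn g (Suc n) t - 2 * log_Zn g n t + log_Zn g (n - 1) t)"
    using Z by (simp add: log_Zn_def exp_add exp_diff exp_double power2_eq_square)
  also have "sqrt \<dots> = exp ((log_Zn g (Suc n) t - 2 * log_Zn g n t + log_Zn g (n - 1) t) / 2)"
    by (rule real_sqrt_unique) (simp_all flip: exp_double)
  finally show ?thesis .
qed

text \<open>
  The Toda equations. They involve only matrix elements of \<open>g\<close> next to the index \<open>n\<close>.
\<close>

lemma toda_rb: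
  assumes n: "0 < n" "Suc n < N"
  shows "((\<lambda>t. node_weight.rb N x (wt g t) n) has_real_derivative
    node_weight.ra N x (wt g t) (Suc n) * node_weight.me N x (wt g t) g n (Suc n) -
    node_weight.ra N x (wt g t) n * node_weight.me N x (wt g t) g (n - 1) n) (at t)"
proof -
  interpret T: node_weight N x "wt g t" by (rule node_weight_wt)
  have "((\<lambda>t. node_weight.EE N x (wt g t) (Suc n) (\<lambda>S. \<Sum>m\<in>S. x m) -
      node_weight.EE N x (wt g t) n (\<lambda>S. \<Sum>m\<in>S. x m)) has_real_derivative
      T.cov (Suc n) x g - T.cov n x g) (at t)"
    using n by (intro DERIV_diff EE_deriv) auto
  also have "T.cov (Suc n) x g - T.cov n x g = T.ra (Suc n) * T.me g n (Suc n) - T.ra n * T.me g (n - 1) n"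
    using n T.cov_x_left[of n g] T.cov_x_left[of "Suc n" g] by simp
  finally show ?thesis using n by (simp add: rb_wt)
qed

lemma toda_ra:
  assumes n: "0 < n" "n < N"
  shows "((\<lambda>t. node_weight.ra N x (wt g t) n) has_real_derivative
    node_weight.ra N x (wt g t) n / 2 *
      (node_weight.me N x (wt g t) g n n - node_weight.me N x (wt g t) g (n - 1) (n - 1))) (at t)"
proof -
  interpret T: node_weight N x "wt g t" by (rule node_weight_wt)
  let ?E = "\<lambda>n. T.EE n (\<lambda>S. \<Sum>m\<in>S. g m)"
  have "((\<lambda>t. exp ((log_Zn g (Suc n) t - 2 * log_Zn g n t + log_Zn g (n - 1) t) / 2)) has_real_derivative
      exp ((log_Zn g (Suc n) t - 2 * log_Zn g n t + log_Zn g (n - 1) t) / 2) * ((?E (Suc n) - 2 * ?E n + ?E (n - 1)) / 2)) (at t)"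
    using n by (intro DERIV_chain2[OF DERIV_exp] DERIV_cdivide DERIV_add DERIV_diff DERIV_cmult log_Zn_deriv) auto
  also have "exp ((log_Zn g (Suc n) t - 2 * log_Zn g n t + log_Zn g (n - 1) t) / 2) = T.ra n"
    using n by (simp add: ra_wt)
  also have "?E (Suc n) - 2 * ?E n + ?E (n - 1) = T.me g n n - T.me g (n - 1) (n - 1)"
    using n by (cases n) (simp_all add: T.EE_linear)
  finally show ?thesis using n by (simp add: ra_wt mult_ac)
qed

end

section \<open>Toeplitz coefficients\<close>

text \<open>
  Fourier coefficients of \<open>f (2 a cos \<theta> + b)\<close>: the entries of the Toeplitz matrix \<open>f (J)\<close>, where \<open>J\<close>
  is the doubly infinite Jacobi matrix with constant entries \<open>a\<close> and \<open>b\<close>.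
\<close>

definition fc :: "real \<Rightarrow> real \<Rightarrow> real poly \<Rightarrow> int \<Rightarrow> real" where
  "fc a b f l = 1 / (2 * pi) * integral {0..2*pi} (\<lambda>\<theta>. poly f (2 * a * cos \<theta> + b) * cos (l * \<theta>))"

lemma fc_integrable: "(\<lambda>\<theta>. poly f (2 * a * cos \<theta> + b) * cos (c * \<theta>)) integrable_on {0..2*pi}"
  by (intro integrable_continuous_real continuous_intros)

lemma integral_cos_int: "integral {0..2*pi} (\<lambda>\<theta>. cos (of_int l * \<theta>)) = (if l = 0 then 2 * pi else 0)"
proof (cases "l = 0")
  case False
  have "((\<lambda>\<theta>. cos (of_int l * \<theta>)) has_integral sin (of_int l * (2 * pi)) / l - sin (of_int l * 0) / l) {0..2*pi}"
    using False by (intro fundamental_theorem_of_calculus)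
      (auto intro!: derivative_eq_intros simp flip: has_real_derivative_iff_has_vector_derivative)
  moreover have "sin (of_int l * (2 * pi)) = 0"
    using sin_int_2pin[of l] by (simp add: mult_ac)
  ultimately show ?thesis using False by (simp add: integral_unique)
qed simp

lemma fc_0: "fc a b 0 l = 0"
  by (simp add: fc_def)

text \<open>
  Multiplication by the argument acts on Fourier coefficients as the constant Jacobi matrix does.
\<close>

lemma fc_pCons: "fc a b (pCons c p) l =
    (if l = 0 then c else 0) + a * fc a b p (l - 1) + b * fc a b p l + a * fc a b p (l + 1)"
proof -
  let ?P = "\<lambda>\<theta>. poly p (2 * a * cos \<theta> + b)"
  let ?I = "\<lambda>l. integral {0..2*pi} (\<lambda>\<theta>. ?P \<theta> * cos (of_int l * \<theta>))"
  have "poly (pCons c p) (2 * a * cos \<theta> + b) * cos (of_int l * \<theta>) =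
      c * cos (of_int l * \<theta>) + (a * (?P \<theta> * cos (of_int (l - 1) * \<theta>)) +
        (b * (?P \<theta> * cos (of_int l * \<theta>)) + a * (?P \<theta> * cos (of_int (l + 1) * \<theta>))))" for \<theta>
  proof -
    have "cos (of_int (l - 1) * \<theta>) + cos (of_int (l + 1) * \<theta>) = 2 * cos \<theta> * cos (of_int l * \<theta>)"
      by (simp add: ring_distribs cos_add cos_diff)
    then have "a * ?P \<theta> * (cos (of_int (l - 1) * \<theta>) + cos (of_int (l + 1) * \<theta>)) =
        a * ?P \<theta> * (2 * cos \<theta> * cos (of_int l * \<theta>))" by simp
    then show ?thesis by (simp add: algebra_simps)
  qed
  then have "integral {0..2*pi} (\<lambda>\<theta>. poly (pCons c p) (2 * a * cos \<theta> + b) * cos (of_int l * \<theta>)) =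
     integral {0..2*pi} (\<lambda>\<theta>. c * cos (of_int l * \<theta>) + (a * (?P \<theta> * cos (of_int (l - 1) * \<theta>)) +
        (b * (?P \<theta> * cos (of_int l * \<theta>)) + a * (?P \<theta> * cos (of_int (l + 1) * \<theta>)))))"
    by presburger
  also have "\<dots> = c * integral {0..2*pi} (\<lambda>\<theta>. cos (of_int l * \<theta>)) + (a * ?I (l - 1) + (b * ?I l + a * ?I (l + 1)))"
    by (subst integral_add integral_mult_right | intro integrable_add integrable_on_mult_right fc_integrable
        integrable_continuous_real continuous_intros refl)+
  finally show ?thesis
    unfolding fc_def integral_cos_int by (simp add: field_simps)
qed

lemma fc_minus: "fc a b (- f) l = - fc a b f l"
  by (simp add: fc_def)

lemma fc_eq_0: "int (degree f) < \<bar>l\<bar> \<Longrightarrow> fc a b f l = 0"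
proof (induction f arbitrary: l)
  case (pCons c p)
  show ?case
  proof (cases "p = 0")
    case True
    then show ?thesis using pCons by (simp add: fc_pCons fc_0)
  next
    case False
    then have "int (degree p) + 1 < \<bar>l\<bar>" using pCons by simp
    then show ?thesis using pCons.IH[of "l - 1"] pCons.IH[of l] pCons.IH[of "l + 1"]
      by (simp add: fc_pCons)
  qed
qed (simp add: fc_0)

lemma fc_bounded: "\<exists>B\<ge>0. \<forall>l. \<bar>fc a b f l\<bar> \<le> B"
proof (induction f)
  case 0
  show ?case by (auto simp: fc_0)
next
  case (pCons c p)
  then obtain B where B: "B \<ge> 0" "\<And>l. \<bar>fc a b p l\<bar> \<le> B" by auto
  have "\<bar>fc a b (pCons c p) l\<bar> \<le> \<bar>c\<bar> + \<bar>a\<bar> * B + \<bar>b\<bar> * B + \<bar>a\<bar> * B" for l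
  proof -
    have "\<bar>a * fc a b p (l - 1)\<bar> \<le> \<bar>a\<bar> * B" "\<bar>b * fc a b p l\<bar> \<le> \<bar>b\<bar> * B" "\<bar>a * fc a b p (l + 1)\<bar> \<le> \<bar>a\<bar> * B"
      using B by (auto simp: abs_mult intro!: mult_left_mono)
    moreover have "\<bar>if l = 0 then c else 0\<bar> \<le> \<bar>c\<bar>" by simp
    ultimately show ?thesis unfolding fc_pCons by linarith
  qed
  then show ?case using B by (intro exI[of _ "\<bar>c\<bar> + \<bar>a\<bar> * B + \<bar>b\<bar> * B + \<bar>a\<bar> * B"]) auto
qed

text \<open>
  Locally around the index \<open>n\<close> the Jacobi matrix is almost a Toeplitz matrix. The predicate takes
  the nodes and the weight as arguments because they vary, with tilting and with the size of the
  system, while \<open>a\<close>, \<open>b\<close> and all bounds stay fixed.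
\<close>

definition near_toeplitz :: "real \<Rightarrow> real \<Rightarrow> nat \<Rightarrow> (nat \<Rightarrow> real) \<Rightarrow> nat \<Rightarrow> nat \<Rightarrow> (nat \<Rightarrow> real) \<Rightarrow> real \<Rightarrow> bool" where
  "near_toeplitz a b N x n D w \<epsilon> \<longleftrightarrow> D \<le> n \<and> n + D < N \<and>
     (\<forall>l\<in>{n - D..n + D}. \<bar>node_weight.ra N x w l - a\<bar> \<le> \<epsilon> \<and> \<bar>node_weight.rb N x w l - b\<bar> \<le> \<epsilon>)"

lemma near_toeplitz_shift:
  "near_toeplitz a b N x n D w \<epsilon> \<Longrightarrow> n \<le> i + D' \<Longrightarrow> i \<le> n + D' \<Longrightarrow> D' + D'' \<le> D \<Longrightarrow>
    near_toeplitz a b N x i D'' w \<epsilon>"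
  unfolding near_toeplitz_def by auto

context node_weight
begin

lemma ra_bound: "(\<And>m. m < N \<Longrightarrow> \<bar>x m\<bar> \<le> K) \<Longrightarrow> n < N \<Longrightarrow> K \<ge> 0 \<Longrightarrow> \<bar>ra n\<bar> \<le> K"
  using me_x_offdiag[of "n - 1"] me_bound[of x K "n - 1" n] by (cases n) (auto simp: ra_def)

lemma rb_bound: "(\<And>m. m < N \<Longrightarrow> \<bar>x m\<bar> \<le> K) \<Longrightarrow> n < N \<Longrightarrow> \<bar>rb n\<bar> \<le> K"
  using me_x_diag[of n] me_bound[of x K n n] by simp

end

lemma abs_mult_diff_le:
  fixes A A' B B' :: real
  assumes "\<bar>A\<bar> \<le> K" "\<bar>B - B'\<bar> \<le> e" "\<bar>A - A'\<bar> \<le> d" "\<bar>B'\<bar> \<le> M"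
  shows "\<bar>A * B - A' * B'\<bar> \<le> K * e + d * M"
proof -
  have "A * B - A' * B' = A * (B - B') + (A - A') * B'" by (simp add: algebra_simps)
  also have "\<bar>\<dots>\<bar> \<le> \<bar>A\<bar> * \<bar>B - B'\<bar> + \<bar>A - A'\<bar> * \<bar>B'\<bar>"
    by (metis abs_mult abs_triangle_ineq)
  also have "\<dots> \<le> K * e + d * M"
    using assms by (intro add_mono mult_mono) auto
  finally show ?thesis .
qed

text \<open>
  Matrix elements of a polynomial depend on finitely many recurrence coefficients, by induction on
  the polynomial through the recurrence. The constants are uniform in the system, which is what
  allows a limit later on.
\<close>

lemma me_near_toeplitz:
  assumes K: "K \<ge> 0"
  shows "\<exists>C\<ge>0. \<exists>D. \<forall>N x w i j \<epsilon>. node_weight N x w \<longrightarrow> (\<forall>m<N. \<bar>x m\<bar> \<le> K) \<longrightarrow> j < N \<longrightarrow>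
    near_toeplitz a b N x i D w \<epsilon> \<longrightarrow>
    \<bar>node_weight.me N x w (\<lambda>m. poly f (x m)) i j - fc a b f (int j - int i)\<bar> \<le> C * \<epsilon>"
proof (induction f)
  case 0
  show ?case
    by (intro exI[of _ 0]) (auto simp: fc_0 node_weight.me_def)
next
  case (pCons c p)
  then obtain C D where C: "C \<ge> 0" and
    IH: "\<And>N x w i j \<epsilon>. node_weight N x w \<Longrightarrow> (\<forall>m<N. \<bar>x m\<bar> \<le> K) \<Longrightarrow> j < N \<Longrightarrow>
    near_toeplitz a b N x i D w \<epsilon> \<Longrightarrow>
    \<bar>node_weight.me N x w (\<lambda>m. poly p (x m)) i j - fc a b p (int j - int i)\<bar> \<le> C * \<epsilon>"
    by blast
  obtain B where B: "B \<ge> 0" "\<And>l. \<bar>fc a b p l\<bar> \<le> B" using fc_bounded by blast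
  show ?case
  proof (intro exI[of _ "3 * (K * C + B)"] conjI exI[of _ "D + 1"] allI impI)
    show "0 \<le> 3 * (K * C + B)" using K C B by simp
    fix N x w i j \<epsilon>
    assume nw: "node_weight N x w" and x: "\<forall>m<N. \<bar>x m\<bar> \<le> K" and j: "j < N"
      and near: "near_toeplitz a b N x i (D + 1) w \<epsilon>"
    interpret node_weight N x w by (rule nw)
    have i: "0 < i" "Suc i < N" using near by (auto simp: near_toeplitz_def)
    have r: "\<bar>ra i - a\<bar> \<le> \<epsilon>" "\<bar>ra (Suc i) - a\<bar> \<le> \<epsilon>" "\<bar>rb i - b\<bar> \<le> \<epsilon>"
      using near by (auto simp: near_toeplitz_def)
    have rK: "\<bar>ra i\<bar> \<le> K" "\<bar>ra (Suc i)\<bar> \<le> K" "\<bar>rb i\<bar> \<le> K"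
      using x K i by (auto intro!: ra_bound rb_bound)
    let ?M = "me (\<lambda>m. poly p (x m))"
    have ind: "\<bar>?M (Suc i) j - fc a b p (int j - int i - 1)\<bar> \<le> C * \<epsilon>" "\<bar>?M i j - fc a b p (int j - int i)\<bar> \<le> C * \<epsilon>"
      "\<bar>?M (i - 1) j - fc a b p (int j - int i + 1)\<bar> \<le> C * \<epsilon>"
    proof -
      show "\<bar>?M (Suc i) j - fc a b p (int j - int i - 1)\<bar> \<le> C * \<epsilon>"
        using IH[OF nw x j near_toeplitz_shift[OF near, of "Suc i" 1 D]] by (simp add: algebra_simps)
      show "\<bar>?M i j - fc a b p (int j - int i)\<bar> \<le> C * \<epsilon>"
        using IH[OF nw x j near_toeplitz_shift[OF near, of i 1 D]] by (simp add: algebra_simps)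
      show "\<bar>?M (i - 1) j - fc a b p (int j - int i + 1)\<bar> \<le> C * \<epsilon>"
        using IH[OF nw x j near_toeplitz_shift[OF near, of "i - 1" 1 D]] i by (simp add: algebra_simps of_nat_diff)
    qed
    have "me (\<lambda>m. poly (pCons c p) (x m)) i j = c * me (\<lambda>_. 1) i j + me (\<lambda>m. x m * poly p (x m)) i j"
      by (simp add: me_def algebra_simps sum.distrib sum_distrib_left)
    also have "\<dots> = (if int j - int i = 0 then c else 0) +
       (ra (Suc i) * ?M (Suc i) j + rb i * ?M i j + ra i * ?M (i - 1) j)"
      using i j by (simp add: me_1 me_X_mult)
    finally have "me (\<lambda>m. poly (pCons c p) (x m)) i j - fc a b (pCons c p) (int j - int i) =
       (ra (Suc i) * ?M (Suc i) j - a * fc a b p (int j - int i - 1)) +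
       (rb i * ?M i j - b * fc a b p (int j - int i)) +
       (ra i * ?M (i - 1) j - a * fc a b p (int j - int i + 1))"
      unfolding fc_pCons by simp
    also have "\<bar>\<dots>\<bar> \<le> (K * (C * \<epsilon>) + \<epsilon> * B) + (K * (C * \<epsilon>) + \<epsilon> * B) + (K * (C * \<epsilon>) + \<epsilon> * B)"
      by (intro order.trans[OF abs_triangle_ineq] add_mono abs_mult_diff_le rK ind r B)
    also have "\<dots> = 3 * (K * C + B) * \<epsilon>" by (simp add: algebra_simps)
    finally show "\<bar>me (\<lambda>m. poly (pCons c p) (x m)) i j - fc a b (pCons c p) (int j - int i)\<bar> \<le> 3 * (K * C + B) * \<epsilon>" .
  qed
qed

section \<open>Propagation of the recurrence coefficients\<close>

text \<open>
  Mean value theorem for a function dominated by another one.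
\<close>

lemma increment_bound:
  fixes f g f' g' :: "real \<Rightarrow> real"
  assumes t: "0 \<le> t"
    and f: "\<And>s. 0 \<le> s \<Longrightarrow> s \<le> t \<Longrightarrow> (f has_real_derivative f' s) (at s)"
    and g: "\<And>s. 0 \<le> s \<Longrightarrow> s \<le> t \<Longrightarrow> (g has_real_derivative g' s) (at s)"
    and le: "\<And>s. 0 \<le> s \<Longrightarrow> s \<le> t \<Longrightarrow> \<bar>f' s\<bar> \<le> g' s"
  shows "\<bar>f t - f 0\<bar> \<le> g t - g 0"
proof -
  have "(\<lambda>s. g s - f s) 0 \<le> (\<lambda>s. g s - f s) t"
  proof (rule DERIV_nonneg_imp_nondecreasing[OF t])
    fix s assume s: "0 \<le> s" "s \<le> t"
    show "\<exists>y. ((\<lambda>s. g s - f s) has_real_derivative y) (at s) \<and> 0 \<le> y"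
      using f[OF s] g[OF s] le[OF s] by (intro exI[of _ "g' s - f' s"] conjI DERIV_diff) auto
  qed
  moreover have "(\<lambda>s. g s + f s) 0 \<le> (\<lambda>s. g s + f s) t"
  proof (rule DERIV_nonneg_imp_nondecreasing[OF t])
    fix s assume s: "0 \<le> s" "s \<le> t"
    show "\<exists>y. ((\<lambda>s. g s + f s) has_real_derivative y) (at s) \<and> 0 \<le> y"
      using f[OF s] g[OF s] le[OF s] by (intro exI[of _ "g' s + f' s"] conjI DERIV_add) auto
  qed
  ultimately show ?thesis by auto
qed

text \<open>
  A Gronwall estimate with finite propagation. If each velocity is controlled by the deviations
  within distance \<open>d\<close>, then iterating \<open>p\<close> times costs \<open>d * p\<close> indices on each side of the window;
  inside, the initial error grows exponentially and the crude a priori bound \<open>R\<close> acquires the factor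
  \<open>(C * t) ^ p / fact p\<close>. The boolean index separates the two kinds of recurrence coefficients.
\<close>

lemma window_gronwall:
  fixes y y' :: "nat \<Rightarrow> bool \<Rightarrow> real \<Rightarrow> real" and c :: "bool \<Rightarrow> real"
  assumes C: "C \<ge> 0" and R: "R \<ge> 0" and \<epsilon>: "\<epsilon> \<ge> 0"
    and deriv: "\<And>i k s. lo \<le> i \<Longrightarrow> i \<le> hi \<Longrightarrow> 0 \<le> s \<Longrightarrow> s \<le> T \<Longrightarrow>
        (y i k has_real_derivative y' i k s) (at s)"
    and local: "\<And>i k s e. lo + d \<le> i \<Longrightarrow> i + d \<le> hi \<Longrightarrow> 0 \<le> s \<Longrightarrow> s \<le> T \<Longrightarrow>
        (\<And>j k. i \<le> j + d \<Longrightarrow> j \<le> i + d \<Longrightarrow> \<bar>y j k s - c k\<bar> \<le> e) \<Longrightarrow> \<bar>y' i k s\<bar> \<le> C * e"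
    and init: "\<And>i k. lo \<le> i \<Longrightarrow> i \<le> hi \<Longrightarrow> \<bar>y i k 0 - c k\<bar> \<le> \<epsilon>"
    and bound: "\<And>i k s. lo \<le> i \<Longrightarrow> i \<le> hi \<Longrightarrow> 0 \<le> s \<Longrightarrow> s \<le> T \<Longrightarrow> \<bar>y i k s - c k\<bar> \<le> R"
  shows "lo + d * p \<le> i \<Longrightarrow> i + d * p \<le> hi \<Longrightarrow> 0 \<le> t \<Longrightarrow> t \<le> T \<Longrightarrow>
    \<bar>y i k t - c k\<bar> \<le> \<epsilon> * exp (C * t) + R * ((C * t) ^ p / fact p)"
proof (induction p arbitrary: i k t)
  case 0
  have "0 \<le> \<epsilon> * exp (C * t)" using \<epsilon> by simp
  moreover have "\<bar>y i k t - c k\<bar> \<le> R" using 0 by (intro bound) auto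
  ultimately show ?case by simp
next
  case (Suc p)
  let ?g = "\<lambda>s. \<epsilon> * exp (C * s) + R * ((C * s) ^ Suc p / fact (Suc p))"
  let ?h = "\<lambda>s. \<epsilon> * exp (C * s) + R * ((C * s) ^ p / fact p)"
  have i: "lo \<le> i" "i \<le> hi" using Suc.prems by auto
  have "\<bar>y i k t - y i k 0\<bar> \<le> ?g t - ?g 0"
  proof (rule increment_bound[OF Suc.prems(3)])
    fix s assume s: "0 \<le> s" "s \<le> t"
    show "(y i k has_real_derivative y' i k s) (at s)"
      using s Suc.prems i by (intro deriv) auto
    have "(?g has_real_derivative \<epsilon> * (exp (C * s) * C) + R * ((real (Suc p) * (C * s) ^ p * C) / fact (Suc p))) (at s)"
      by (auto intro!: derivative_eq_intros simp del: power_Suc fact_Suc)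
    also have "\<epsilon> * (exp (C * s) * C) + R * ((real (Suc p) * (C * s) ^ p * C) / fact (Suc p)) = C * ?h s"
    proof -
      have "real (Suc p) / fact (Suc p) = 1 / (fact p :: real)"
        by (simp del: of_nat_Suc add: fact_Suc)
      moreover have "real (Suc p) * (C * s) ^ p * C / fact (Suc p) = real (Suc p) / fact (Suc p) * (C * (C * s) ^ p)"
        by (simp del: of_nat_Suc fact_Suc)
      ultimately have "real (Suc p) * (C * s) ^ p * C / fact (Suc p) = C * ((C * s) ^ p / fact p)"
        by simp
      then show ?thesis by (simp add: algebra_simps del: of_nat_Suc fact_Suc)
    qed
    finally show "(?g has_real_derivative C * ?h s) (at s)" .
    show "\<bar>y' i k s\<bar> \<le> C * ?h s"
    proof (rule local)
      fix j k assume "i \<le> j + d" "j \<le> i + d"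
      then show "\<bar>y j k s - c k\<bar> \<le> ?h s"
        using Suc.prems s by (intro Suc.IH) auto
    qed (use Suc.prems s in auto)
  qed
  moreover have "\<bar>y i k 0 - c k\<bar> \<le> \<epsilon>" using i by (rule init)
  ultimately show ?case by simp
qed

text \<open>
  Constant sequences are equilibria of the Toda equations: with constant recurrence coefficients
  both right hand sides vanish, because both of them are differences of equal Toeplitz entries.
\<close>

lemma toda_locality:
  assumes K: "K \<ge> 0"
  shows "\<exists>C\<ge>0. \<exists>d>0. \<forall>N x w i s \<epsilon>. node_weight N x w \<longrightarrow> (\<forall>m<N. \<bar>x m\<bar> \<le> K) \<longrightarrow>
    near_toeplitz a b N x i d (node_weight.wt w (\<lambda>m. poly f (x m)) s) \<epsilon> \<longrightarrow>
    (\<bar>node_weight.ra N x (node_weight.wt w (\<lambda>m. poly f (x m)) s) (Suc i) *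
        node_weight.me N x (node_weight.wt w (\<lambda>m. poly f (x m)) s) (\<lambda>m. poly f (x m)) i (Suc i) -
      node_weight.ra N x (node_weight.wt w (\<lambda>m. poly f (x m)) s) i *
        node_weight.me N x (node_weight.wt w (\<lambda>m. poly f (x m)) s) (\<lambda>m. poly f (x m)) (i - 1) i\<bar> \<le> C * \<epsilon> \<and>
     \<bar>node_weight.ra N x (node_weight.wt w (\<lambda>m. poly f (x m)) s) i / 2 *
       (node_weight.me N x (node_weight.wt w (\<lambda>m. poly f (x m)) s) (\<lambda>m. poly f (x m)) i i -
        node_weight.me N x (node_weight.wt w (\<lambda>m. poly f (x m)) s) (\<lambda>m. poly f (x m)) (i - 1) (i - 1))\<bar> \<le> C * \<epsilon>)"
proof -
  obtain C D where C: "C \<ge> 0" and me: "\<And>N x w i j \<epsilon>. node_weight N x w \<Longrightarrow> (\<forall>m<N. \<bar>x m\<bar> \<le> K) \<Longrightarrow> j < N \<Longrightarrow>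
    near_toeplitz a b N x i D w \<epsilon> \<Longrightarrow>
    \<bar>node_weight.me N x w (\<lambda>m. poly f (x m)) i j - fc a b f (int j - int i)\<bar> \<le> C * \<epsilon>"
    using me_near_toeplitz[OF K, of a b f] by blast
  obtain B where B: "B \<ge> 0" "\<And>l. \<bar>fc a b f l\<bar> \<le> B" using fc_bounded by blast
  show ?thesis
  proof (intro exI[of _ "2 * (K * C + B)"] conjI exI[of _ "D + 1"] allI impI)
    show "0 \<le> 2 * (K * C + B)" using K C B by simp
    fix N i :: nat and x w :: "nat \<Rightarrow> real" and s \<epsilon> :: real
    let ?g = "\<lambda>m. poly f (x m)"
    assume nw0: "node_weight N x w" and x: "\<forall>m<N. \<bar>x m\<bar> \<le> K"
      and near: "near_toeplitz a b N x i (D + 1) (node_weight.wt w ?g s) \<epsilon>"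
    have nw: "node_weight N x (node_weight.wt w ?g s)" by (rule node_weight.node_weight_wt[OF nw0])
    interpret T: node_weight N x "node_weight.wt w ?g s" by (rule nw)
    have i: "0 < i" "Suc i < N" using near by (auto simp: near_toeplitz_def)
    have r: "\<bar>T.ra i - a\<bar> \<le> \<epsilon>" "\<bar>T.ra (Suc i) - a\<bar> \<le> \<epsilon>"
      using near by (auto simp: near_toeplitz_def)
    have rK: "\<bar>T.ra i\<bar> \<le> K" "\<bar>T.ra (Suc i)\<bar> \<le> K"
      using x K i by (auto intro!: T.ra_bound)
    have m1: "\<bar>T.me ?g i (Suc i) - fc a b f 1\<bar> \<le> C * \<epsilon>" "\<bar>T.me ?g i i - fc a b f 0\<bar> \<le> C * \<epsilon>"
      using me[OF nw x, of "Suc i" i \<epsilon>] me[OF nw x, of i i \<epsilon>] i near_toeplitz_shift[OF near, of i 1 D] by auto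
    have m2: "\<bar>T.me ?g (i - 1) i - fc a b f 1\<bar> \<le> C * \<epsilon>" "\<bar>T.me ?g (i - 1) (i - 1) - fc a b f 0\<bar> \<le> C * \<epsilon>"
      using me[OF nw x, of i "i - 1" \<epsilon>] me[OF nw x, of "i - 1" "i - 1" \<epsilon>] i
        near_toeplitz_shift[OF near, of "i - 1" 1 D] by (auto simp: of_nat_diff)
    have "\<bar>T.ra (Suc i) * T.me ?g i (Suc i) - a * fc a b f 1\<bar> \<le> K * (C * \<epsilon>) + \<epsilon> * B"
      by (intro abs_mult_diff_le rK m1 r B)
    moreover have "\<bar>T.ra i * T.me ?g (i - 1) i - a * fc a b f 1\<bar> \<le> K * (C * \<epsilon>) + \<epsilon> * B"
      by (intro abs_mult_diff_le rK m2 r B)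
    ultimately show "\<bar>T.ra (Suc i) * T.me ?g i (Suc i) - T.ra i * T.me ?g (i - 1) i\<bar> \<le> 2 * (K * C + B) * \<epsilon>"
      by (simp add: algebra_simps)
    have "\<epsilon> \<ge> 0" using r by linarith
    have "\<bar>T.ra i / 2 * (T.me ?g i i - T.me ?g (i - 1) (i - 1))\<bar> \<le> K / 2 * (2 * (C * \<epsilon>))"
      unfolding abs_mult using rK(1) m1(2) m2(2) K by (intro mult_mono) auto
    also have "\<dots> \<le> 2 * (K * C + B) * \<epsilon>"
      using K C B \<open>\<epsilon> \<ge> 0\<close> by (simp add: algebra_simps)
    finally show "\<bar>T.ra i / 2 * (T.me ?g i i - T.me ?g (i - 1) (i - 1))\<bar> \<le> 2 * (K * C + B) * \<epsilon>" .
  qed auto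
qed

text \<open>
  The Toda evolution does not move the coefficients near \<open>n\<close> away from their limits within a bounded
  time. The number \<open>p\<close> of iterations, hence the required window, is the same for all systems.
\<close>

lemma near_toeplitz_tilt:
  assumes K: "K \<ge> 0" and T: "T \<ge> 0" and \<epsilon>: "\<epsilon> > 0"
  shows "\<exists>W. \<exists>\<delta>>0. \<forall>N x w n s. node_weight N x w \<longrightarrow> (\<forall>m<N. \<bar>x m\<bar> \<le> K) \<longrightarrow>
    near_toeplitz a b N x n W w \<delta> \<longrightarrow> 0 \<le> s \<longrightarrow> s \<le> T \<longrightarrow>
    near_toeplitz a b N x n D (node_weight.wt w (\<lambda>m. poly f (x m)) s) \<epsilon>"
proof -
  obtain C d where C: "C \<ge> 0" and d: "d > 0" and loc: "\<And>N x w i s \<epsilon>. node_weight N x w \<Longrightarrow> (\<forall>m<N. \<bar>x m\<bar> \<le> K) \<Longrightarrow>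
    near_toeplitz a b N x i d (node_weight.wt w (\<lambda>m. poly f (x m)) s) \<epsilon> \<Longrightarrow>
    \<bar>node_weight.ra N x (node_weight.wt w (\<lambda>m. poly f (x m)) s) (Suc i) *
        node_weight.me N x (node_weight.wt w (\<lambda>m. poly f (x m)) s) (\<lambda>m. poly f (x m)) i (Suc i) -
      node_weight.ra N x (node_weight.wt w (\<lambda>m. poly f (x m)) s) i *
        node_weight.me N x (node_weight.wt w (\<lambda>m. poly f (x m)) s) (\<lambda>m. poly f (x m)) (i - 1) i\<bar> \<le> C * \<epsilon> \<and>
     \<bar>node_weight.ra N x (node_weight.wt w (\<lambda>m. poly f (x m)) s) i / 2 *
       (node_weight.me N x (node_weight.wt w (\<lambda>m. poly f (x m)) s) (\<lambda>m. poly f (x m)) i i -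
        node_weight.me N x (node_weight.wt w (\<lambda>m. poly f (x m)) s) (\<lambda>m. poly f (x m)) (i - 1) (i - 1))\<bar> \<le> C * \<epsilon>"
    using toda_locality[OF K, of a b f] by blast
  define R where "R = K + \<bar>a\<bar> + \<bar>b\<bar>"
  have R: "R \<ge> 0" using K by (simp add: R_def)
  have "(\<lambda>p. inverse (fact p) * (C * T) ^ p) \<longlonglongrightarrow> 0"
    by (rule summable_LIMSEQ_zero[OF summable_exp])
  then have "(\<lambda>p. (C * T) ^ p / fact p) \<longlonglongrightarrow> 0"
    by (simp add: field_simps)
  then have "(\<lambda>p. R * ((C * T) ^ p / fact p)) \<longlonglongrightarrow> R * 0"
    by (rule tendsto_mult_left)
  then have "(\<lambda>p. R * ((C * T) ^ p / fact p)) \<longlonglongrightarrow> 0" by simp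
  then have "eventually (\<lambda>p. R * ((C * T) ^ p / fact p) < \<epsilon> / 2) sequentially"
    using \<epsilon> by (intro order_tendstoD(2)[of _ 0]) auto
  then obtain p where p: "R * ((C * T) ^ p / fact p) < \<epsilon> / 2"
    by (auto simp: eventually_at_top_linorder)
  \<comment> \<open>Half of the error budget is left for the exponential growth of the initial error.\<close>
  define \<delta> where "\<delta> = \<epsilon> / (2 * exp (C * T))"
  have \<delta>: "\<delta> > 0" "\<delta> * exp (C * T) = \<epsilon> / 2" using \<epsilon> by (auto simp: \<delta>_def field_simps)
  show ?thesis
  proof (intro exI[of _ "D + d * p + 1"] exI[of _ \<delta>] conjI allI impI)
    show "\<delta> > 0" by (rule \<delta>)
    fix N n :: nat and x w :: "nat \<Rightarrow> real" and s :: real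
    let ?g = "\<lambda>m. poly f (x m)"
    let ?w = "node_weight.wt w ?g"
    assume nw: "node_weight N x w" and x: "\<forall>m<N. \<bar>x m\<bar> \<le> K"
      and near: "near_toeplitz a b N x n (D + d * p + 1) w \<delta>" and s: "0 \<le> s" "s \<le> T"
    interpret node_weight N x w by (rule nw)
    have nt: "node_weight N x (?w s)" for s by (rule node_weight_wt)
    define lo hi where "lo = n - (D + d * p)" and "hi = n + D + d * p"
    have win: "0 < lo" "Suc hi < N" using near by (auto simp: near_toeplitz_def lo_def hi_def)
    define y where "y = (\<lambda>i k s. if k then node_weight.ra N x (?w s) i else node_weight.rb N x (?w s) i)"
    define y' where "y' = (\<lambda>i k s. if k then node_weight.ra N x (?w s) i / 2 *
           (node_weight.me N x (?w s) ?g i i - node_weight.me N x (?w s) ?g (i - 1) (i - 1))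
        else node_weight.ra N x (?w s) (Suc i) * node_weight.me N x (?w s) ?g i (Suc i) -
           node_weight.ra N x (?w s) i * node_weight.me N x (?w s) ?g (i - 1) i)"
    define c where "c = (\<lambda>k. if k then a else b)"
    have main: "\<bar>y i k s - c k\<bar> \<le> \<delta> * exp (C * s) + R * ((C * s) ^ p / fact p)"
      if "lo + d * p \<le> i" "i + d * p \<le> hi" for i k
    proof (rule window_gronwall[where y' = y' and c = c, OF C R less_imp_le[OF \<delta>(1)] _ _ _ _ that s])
      fix i k u assume i: "lo \<le> i" "i \<le> hi" and u: "0 \<le> u" "u \<le> T"
      show "(y i k has_real_derivative y' i k u) (at u)"
        using i win toda_ra[of i ?g u] toda_rb[of i ?g u] by (cases k) (auto simp: y_def y'_def)
      have "\<bar>node_weight.ra N x (?w u) i\<bar> \<le> K" "\<bar>node_weight.rb N x (?w u) i\<bar> \<le> K"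
        using i win x K by (auto intro!: node_weight.ra_bound[OF nt] node_weight.rb_bound[OF nt])
      then show "\<bar>y i k u - c k\<bar> \<le> R"
        by (auto simp: y_def c_def R_def)
    next
      fix i k assume "lo \<le> i" "i \<le> hi"
      then show "\<bar>y i k 0 - c k\<bar> \<le> \<delta>"
        using near by (auto simp: near_toeplitz_def y_def c_def lo_def hi_def wt_0)
    next
      fix i k u e assume i: "lo + d \<le> i" "i + d \<le> hi" and u: "0 \<le> u" "u \<le> T"
        and e: "\<And>j k. i \<le> j + d \<Longrightarrow> j \<le> i + d \<Longrightarrow> \<bar>y j k u - c k\<bar> \<le> e"
      have "near_toeplitz a b N x i d (?w u) e"
        unfolding near_toeplitz_def
      proof (intro conjI ballI)
        show "d \<le> i" "i + d < N" using i win by auto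
        fix l assume "l \<in> {i - d..i + d}"
        then have l: "i \<le> l + d" "l \<le> i + d" by auto
        show "\<bar>node_weight.ra N x (?w u) l - a\<bar> \<le> e" using e[OF l, of True] by (simp add: y_def c_def)
        show "\<bar>node_weight.rb N x (?w u) l - b\<bar> \<le> e" using e[OF l, of False] by (simp add: y_def c_def)
      qed
      from loc[OF nw x this] show "\<bar>y' i k u\<bar> \<le> C * e"
        by (auto simp: y'_def)
    qed
    have "\<delta> * exp (C * s) + R * ((C * s) ^ p / fact p) \<le> \<delta> * exp (C * T) + R * ((C * T) ^ p / fact p)"
      using s C R \<delta> by (intro add_mono mult_left_mono divide_right_mono power_mono) (auto intro!: mult_left_mono)
    also have "\<dots> \<le> \<epsilon>" using \<delta>(2) p by linarith
    finally have fin: "\<bar>y i k s - c k\<bar> \<le> \<epsilon>" if "lo + d * p \<le> i" "i + d * p \<le> hi" for i k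
      using main[OF that, of k] by simp
    show "near_toeplitz a b N x n D (?w s) \<epsilon>"
      unfolding near_toeplitz_def
    proof (intro conjI ballI)
      show "D \<le> n" "n + D < N" using near by (auto simp: near_toeplitz_def)
      fix l assume "l \<in> {n - D..n + D}"
      then have l: "lo + d * p \<le> l" "l + d * p \<le> hi"
        using near by (auto simp: near_toeplitz_def lo_def hi_def)
      show "\<bar>node_weight.ra N x (?w s) l - a\<bar> \<le> \<epsilon>" using fin[OF l, of True] by (simp add: y_def c_def)
      show "\<bar>node_weight.rb N x (?w s) l - b\<bar> \<le> \<epsilon>" using fin[OF l, of False] by (simp add: y_def c_def)
    qed
  qed
qed

section \<open>Variance and Laplace transform of polynomial statistics\<close>

text \<open>
  The limiting variance for a polynomial, where the series is finite.
\<close>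

definition poly_variance :: "real \<Rightarrow> real \<Rightarrow> real poly \<Rightarrow> real" where
  "poly_variance a b f = (\<Sum>l<degree f. real (Suc l) * (fc a b f (int (Suc l)))\<^sup>2)"

text \<open>
  Each value \<open>F l\<close> occurs on an antidiagonal of length \<open>l + 1\<close>: this is the origin of the factor \<open>l\<close>
  in the variance.
\<close>

lemma hankel_square_sum:
  fixes F :: "nat \<Rightarrow> real"
  assumes F: "\<And>l. D \<le> l \<Longrightarrow> F l = 0"
  shows "(\<Sum>i<D. \<Sum>l<D. F (i + l)) = (\<Sum>l<D. real (Suc l) * F l)"
proof -
  have F': "F l \<noteq> 0 \<Longrightarrow> l < D" for l using F by (meson not_less)
  have "(\<Sum>i<D. \<Sum>l<D. F (i + l)) = (\<Sum>(i, l)\<in>{..<D} \<times> {..<D}. F (i + l))"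
    by (simp add: sum.cartesian_product)
  also have "\<dots> = (\<Sum>(i, l)\<in>{(i, l). i + l < D}. F (i + l))"
    by (rule sum.mono_neutral_right) (auto intro: F')
  also have "\<dots> = (\<Sum>k<D. \<Sum>i\<le>k. F (i + (k - i)))"
    by (rule sum.triangle_reindex)
  also have "\<dots> = (\<Sum>l<D. real (Suc l) * F l)"
    by (intro sum.cong refl) simp
  finally show ?thesis .
qed

text \<open>
  Bandedness reduces the corner sum to a block of size \<open>degree f\<close> around the index \<open>n\<close>, where the
  matrix elements depend, up to a small error, only on the distance to the diagonal.
\<close>

lemma cov_near_toeplitz:
  assumes K: "K \<ge> 0"
  shows "\<exists>C\<ge>0. \<exists>D. \<forall>N x w n \<epsilon>. node_weight N x w \<longrightarrow> (\<forall>m<N. \<bar>x m\<bar> \<le> K) \<longrightarrow>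
    near_toeplitz a b N x n D w \<epsilon> \<longrightarrow>
    \<bar>node_weight.cov N x w n (\<lambda>m. poly f (x m)) (\<lambda>m. poly f (x m)) - poly_variance a b f\<bar> \<le> C * \<epsilon>"
proof -
  obtain C D where C: "C \<ge> 0" and me: "\<And>N x w i j \<epsilon>. node_weight N x w \<Longrightarrow> (\<forall>m<N. \<bar>x m\<bar> \<le> K) \<Longrightarrow> j < N \<Longrightarrow>
    near_toeplitz a b N x i D w \<epsilon> \<Longrightarrow>
    \<bar>node_weight.me N x w (\<lambda>m. poly f (x m)) i j - fc a b f (int j - int i)\<bar> \<le> C * \<epsilon>"
    using me_near_toeplitz[OF K, of a b f] by blast
  obtain B where B: "B \<ge> 0" "\<And>l. \<bar>fc a b f l\<bar> \<le> B" using fc_bounded by blast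
  obtain B' where B': "\<And>y. \<bar>y\<bar> \<le> K \<Longrightarrow> \<bar>poly f y\<bar> \<le> B'"
  proof -
    have "compact (poly f ` {-K..K})" by (intro compact_continuous_image continuous_intros) auto
    then obtain B' where "\<forall>z\<in>poly f ` {-K..K}. norm z \<le> B'"
      using compact_imp_bounded bounded_iff by metis
    then show ?thesis using that by (force simp: abs_le_iff)
  qed
  have B'0: "B' \<ge> 0" using B'[of 0] K by simp
  let ?d = "degree f"
  show ?thesis
  proof (intro exI[of _ "real ?d * (real ?d * (B' * C + C * B))"] exI[of _ "D + ?d"] conjI allI impI)
    show "0 \<le> real ?d * (real ?d * (B' * C + C * B))" using B'0 C B by simp
    fix N n :: nat and x w :: "nat \<Rightarrow> real" and \<epsilon> :: real
    let ?g = "\<lambda>m. poly f (x m)"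
    assume nw: "node_weight N x w" and x: "\<forall>m<N. \<bar>x m\<bar> \<le> K"
      and near: "near_toeplitz a b N x n (D + ?d) w \<epsilon>"
    interpret node_weight N x w by (rule nw)
    have win: "D + ?d \<le> n" "n + D + ?d < N" using near by (auto simp: near_toeplitz_def)
    have "cov n ?g ?g = (\<Sum>i<n. \<Sum>l\<in>{n..<N}. (me ?g i l)\<^sup>2)"
      using win by (subst cov_corner) (auto simp: power2_eq_square)
    also have "\<dots> = (\<Sum>i\<in>{n - ?d..<n}. \<Sum>l\<in>{n..<N}. (me ?g i l)\<^sup>2)"
      by (rule sum.mono_neutral_right) (use win me_banded in \<open>auto intro!: sum.neutral\<close>)
    also have "\<dots> = (\<Sum>i\<in>{n - ?d..<n}. \<Sum>l\<in>{n..<n + ?d}. (me ?g i l)\<^sup>2)"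
      by (rule sum.cong[OF refl], rule sum.mono_neutral_right) (use win me_banded in auto)
    also have "\<dots> = (\<Sum>i<?d. \<Sum>l<?d. (me ?g (n - Suc i) (n + l))\<^sup>2)"
    proof (rule sum.reindex_bij_witness[of _ "\<lambda>i. n - Suc i" "\<lambda>i. n - Suc i"])
      fix i assume i: "i \<in> {n - ?d..<n}"
      then have "n - Suc (n - Suc i) = i" by auto
      then show "(\<Sum>l<?d. (me ?g (n - Suc (n - Suc i)) (n + l))\<^sup>2) = (\<Sum>l\<in>{n..<n + ?d}. (me ?g i l)\<^sup>2)"
        by (simp only:) (rule sum.reindex_bij_witness[of _ "\<lambda>l. l - n" "\<lambda>l. n + l"], auto)
    qed (use win in auto)
    finally have cov: "cov n ?g ?g = (\<Sum>i<?d. \<Sum>l<?d. (me ?g (n - Suc i) (n + l))\<^sup>2)" .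
    have pv: "poly_variance a b f = (\<Sum>i<?d. \<Sum>l<?d. (fc a b f (int (Suc (i + l))))\<^sup>2)"
      unfolding poly_variance_def by (subst hankel_square_sum) (auto simp: fc_eq_0)
    have "\<bar>(me ?g (n - Suc i) (n + l))\<^sup>2 - (fc a b f (int (Suc (i + l))))\<^sup>2\<bar> \<le> (B' * C + C * B) * \<epsilon>"
      if "i < ?d" "l < ?d" for i l
    proof -
      have nr: "near_toeplitz a b N x (n - Suc i) D w \<epsilon>"
        using near_toeplitz_shift[OF near, of "n - Suc i" ?d D] win that by auto
      have 1: "\<bar>me ?g (n - Suc i) (n + l) - fc a b f (int (Suc (i + l)))\<bar> \<le> C * \<epsilon>"
        using me[OF nw x _ nr, of "n + l"] win that by (simp add: of_nat_diff algebra_simps)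
      have 2: "\<bar>me ?g (n - Suc i) (n + l)\<bar> \<le> B'"
        using x B' win that by (intro me_bound) auto
      have "\<bar>me ?g (n - Suc i) (n + l) * me ?g (n - Suc i) (n + l) - fc a b f (int (Suc (i + l))) * fc a b f (int (Suc (i + l)))\<bar> \<le>
        B' * (C * \<epsilon>) + (C * \<epsilon>) * B"
        by (intro abs_mult_diff_le 1 2 B)
      then show ?thesis by (simp add: power2_eq_square algebra_simps)
    qed
    then have "\<bar>cov n ?g ?g - poly_variance a b f\<bar> \<le> (\<Sum>i<?d. \<Sum>l<?d. (B' * C + C * B) * \<epsilon>)"
      unfolding cov pv sum_subtractf[symmetric]
      by (intro order.trans[OF sum_abs] sum_mono) auto
    then show "\<bar>cov n ?g ?g - poly_variance a b f\<bar> \<le> real ?d * (real ?d * (B' * C + C * B)) * \<epsilon>"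
      by (simp add: mult_ac)
  qed
qed

definition (in node_weight) centered_laplace :: "nat \<Rightarrow> (nat \<Rightarrow> real) \<Rightarrow> real \<Rightarrow> real" where
  "centered_laplace n g t = EE n (\<lambda>S. exp (t * ((\<Sum>m\<in>S. g m) - EE n (\<lambda>S. \<Sum>m\<in>S. g m))))"

lemma (in node_weight) centered_laplace_eq:
  assumes n: "n \<le> N"
  shows "centered_laplace n g t = exp (log_Zn g n t - log_Zn g n 0 - t * EE n (\<lambda>S. \<Sum>m\<in>S. g m))"
proof -
  let ?X = "\<lambda>S. \<Sum>m\<in>S. g m"
  have pos: "node_weight.Zn N x (wt g s) n > 0" for s
    using node_weight.Zn_pos[OF node_weight_wt n] .
  have "centered_laplace n g t = (\<Sum>S\<in>ens n. sw S * exp (t * (?X S - EE n ?X))) / Zn n"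
    unfolding centered_laplace_def by (rule EE_def)
  also have "\<dots> = (\<Sum>S\<in>ens n. sw S * exp (t * ?X S)) * exp (- t * EE n ?X) / Zn n"
    by (simp add: sum_distrib_left exp_diff exp_minus right_diff_distrib divide_inverse mult_ac)
  also have "\<dots> = node_weight.Zn N x (wt g t) n * exp (- t * EE n ?X) / node_weight.Zn N x (wt g 0) n"
    by (simp add: Zn_wt wt_0)
  also have "\<dots> = exp (log_Zn g n t - log_Zn g n 0 - t * EE n ?X)"
    using pos[of t] pos[of 0] by (simp add: log_Zn_def exp_diff exp_add exp_minus field_simps)
  finally show ?thesis .
qed

text \<open>
  The second derivative of the cumulant generating function is the variance in the tilted ensemble,
  which is nearly constant. Integrating twice gives a quadratic function.
\<close>

lemma laplace_near_toeplitz: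
  assumes K: "K \<ge> 0" and t: "t \<ge> 0" and \<eta>: "\<eta> > 0"
  shows "\<exists>W. \<exists>\<delta>>0. \<forall>N x w n. node_weight N x w \<longrightarrow> (\<forall>m<N. \<bar>x m\<bar> \<le> K) \<longrightarrow>
    near_toeplitz a b N x n W w \<delta> \<longrightarrow>
    \<bar>ln (node_weight.centered_laplace N x w n (\<lambda>m. poly f (x m)) t) - poly_variance a b f * t\<^sup>2 / 2\<bar> \<le> \<eta>"
proof -
  obtain C D where C: "C \<ge> 0" and cov: "\<And>N x w n \<epsilon>. node_weight N x w \<Longrightarrow> (\<forall>m<N. \<bar>x m\<bar> \<le> K) \<Longrightarrow>
    near_toeplitz a b N x n D w \<epsilon> \<Longrightarrow>
    \<bar>node_weight.cov N x w n (\<lambda>m. poly f (x m)) (\<lambda>m. poly f (x m)) - poly_variance a b f\<bar> \<le> C * \<epsilon>"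
    using cov_near_toeplitz[OF K, of a b f] by blast
  define P where "P = (C + 1) * (t\<^sup>2 + 1)"
  define \<epsilon> where "\<epsilon> = \<eta> / P"
  have t2: "t\<^sup>2 \<ge> 0" by simp
  then have pos: "P > 0" unfolding P_def using C by (intro mult_pos_pos) linarith+
  then have \<epsilon>: "\<epsilon> > 0" using \<eta> by (simp add: \<epsilon>_def)
  have "C * \<epsilon> * t\<^sup>2 / 2 \<le> (C + 1) * \<epsilon> * (t\<^sup>2 + 1)"
  proof -
    have "C * \<epsilon> * t\<^sup>2 \<le> (C + 1) * \<epsilon> * (t\<^sup>2 + 1)"
      using C \<epsilon> t2 by (intro mult_mono) auto
    moreover have "0 \<le> C * \<epsilon> * t\<^sup>2" using C \<epsilon> t2 by simp
    ultimately show ?thesis by linarith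
  qed
  also have "\<dots> = P * \<epsilon>" by (simp add: P_def)
  also have "\<dots> = \<eta>" using pos by (simp add: \<epsilon>_def)
  finally have small: "C * \<epsilon> * t\<^sup>2 / 2 \<le> \<eta>" .
  obtain W \<delta> where \<delta>: "\<delta> > 0" and tilt: "\<And>N x w n s. node_weight N x w \<Longrightarrow> (\<forall>m<N. \<bar>x m\<bar> \<le> K) \<Longrightarrow>
    near_toeplitz a b N x n W w \<delta> \<Longrightarrow> 0 \<le> s \<Longrightarrow> s \<le> t \<Longrightarrow>
    near_toeplitz a b N x n D (node_weight.wt w (\<lambda>m. poly f (x m)) s) \<epsilon>"
    using near_toeplitz_tilt[OF K t \<epsilon>, of a b D f] by blast
  show ?thesis
  proof (intro exI[of _ W] exI[of _ \<delta>] conjI allI impI)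
    show "\<delta> > 0" by (rule \<delta>)
    fix N n :: nat and x w :: "nat \<Rightarrow> real"
    let ?g = "\<lambda>m. poly f (x m)"
    let ?w = "node_weight.wt w ?g"
    assume nw: "node_weight N x w" and x: "\<forall>m<N. \<bar>x m\<bar> \<le> K"
      and near: "near_toeplitz a b N x n W w \<delta>"
    interpret node_weight N x w by (rule nw)
    have n: "n \<le> N" using near by (auto simp: near_toeplitz_def)
    let ?E = "\<lambda>s. node_weight.EE N x (?w s) n (\<lambda>S. \<Sum>m\<in>S. ?g m)"
    let ?v = "poly_variance a b f"
    define h where "h = (\<lambda>s. ?E s - ?E 0 - ?v * s)"
    have dh: "(h has_real_derivative node_weight.cov N x (?w s) n ?g ?g - ?v) (at s)" for s
      unfolding h_def using n by (auto intro!: derivative_eq_intros EE_deriv)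
    have hb: "\<bar>h s\<bar> \<le> C * \<epsilon> * s" if s: "0 \<le> s" "s \<le> t" for s
    proof -
      have "\<bar>h s - h 0\<bar> \<le> C * \<epsilon> * s - C * \<epsilon> * 0"
      proof (rule increment_bound[OF s(1) dh])
        fix r assume r: "0 \<le> r" "r \<le> s"
        show "((\<lambda>s. C * \<epsilon> * s) has_real_derivative C * \<epsilon>) (at r)"
          by (auto intro!: derivative_eq_intros)
        show "\<bar>node_weight.cov N x (?w r) n ?g ?g - ?v\<bar> \<le> C * \<epsilon>"
          using r s by (intro cov[OF node_weight_wt x] tilt[OF nw x near]) auto
      qed
      then show ?thesis by (simp add: h_def)
    qed
    define H where "H = (\<lambda>s. log_Zn ?g n s - s * ?E 0 - ?v * s\<^sup>2 / 2)"
    have "\<bar>H t - H 0\<bar> \<le> C * \<epsilon> * t\<^sup>2 / 2 - C * \<epsilon> * 0\<^sup>2 / 2"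
    proof (rule increment_bound[OF t])
      fix s assume s: "0 \<le> s" "s \<le> t"
      show "(H has_real_derivative h s) (at s)"
        unfolding H_def h_def using n by (auto intro!: derivative_eq_intros log_Zn_deriv)
      show "((\<lambda>s. C * \<epsilon> * s\<^sup>2 / 2) has_real_derivative C * \<epsilon> * s) (at s)"
        by (auto intro!: derivative_eq_intros)
      show "\<bar>h s\<bar> \<le> C * \<epsilon> * s" by (rule hb[OF s])
    qed
    then have "\<bar>H t - H 0\<bar> \<le> \<eta>" using small by simp
    moreover have "ln (centered_laplace n ?g t) - ?v * t\<^sup>2 / 2 = H t - H 0"
      unfolding centered_laplace_eq[OF n] H_def by (simp add: wt_0)
    ultimately show "\<bar>ln (centered_laplace n ?g t) - ?v * t\<^sup>2 / 2\<bar> \<le> \<eta>" by simp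
  qed
qed

section \<open>From Laplace transforms to characteristic functions\<close>

text \<open>
  Entire functions that are uniformly bounded on vertical strips form a normal family; every
  subsequential limit is entire and is determined by its values on the real axis.
\<close>

lemma vitali_real_axis:
  fixes H :: "nat \<Rightarrow> complex \<Rightarrow> complex" and G :: "complex \<Rightarrow> complex"
  assumes hol: "\<And>n. H n holomorphic_on UNIV" and G: "G holomorphic_on UNIV"
    and bound: "\<And>R. \<exists>B. \<forall>n z. \<bar>Re z\<bar> \<le> R \<longrightarrow> cmod (H n z) \<le> B"
    and conv: "\<And>t :: real. (\<lambda>n. H n (of_real t)) \<longlonglongrightarrow> G (of_real t)"
  shows "(\<lambda>n. H n z) \<longlonglongrightarrow> G z"
proof (rule ccontr)
  assume "\<not> (\<lambda>n. H n z) \<longlonglongrightarrow> G z"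
  then obtain e where e: "e > 0" "\<And>N. \<exists>n\<ge>N. dist (H n z) (G z) \<ge> e"
    unfolding lim_sequentially by (meson not_le)
  then have "infinite {n. dist (H n z) (G z) \<ge> e}"
    unfolding infinite_nat_iff_unbounded_le by auto
  then obtain r :: "nat \<Rightarrow> nat" where r: "strict_mono r" "\<And>n. dist (H (r n) z) (G z) \<ge> e"
    using infinite_enumerate[of "{n. dist (H n z) (G z) \<ge> e}"] by auto
  obtain g s where g: "g holomorphic_on UNIV" and s: "strict_mono (s :: nat \<Rightarrow> nat)"
    and lim: "\<And>y. (\<lambda>n. H (r (s n)) y) \<longlonglongrightarrow> g y"
  proof (rule Montel[of UNIV "range (\<lambda>n. H (r n))" "\<lambda>n. H (r n)"])
    show "\<exists>B. \<forall>h\<in>range (\<lambda>n. H (r n)). \<forall>z\<in>K. cmod (h z) \<le> B" if K: "compact K" for K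
    proof -
      obtain R where "\<And>y. y \<in> K \<Longrightarrow> cmod y \<le> R"
        using compact_imp_bounded[OF K] bounded_iff by metis
      moreover obtain B where "\<forall>n z. \<bar>Re z\<bar> \<le> R \<longrightarrow> cmod (H n z) \<le> B" using bound by blast
      ultimately show ?thesis
        by (intro exI[of _ B]) (auto intro: order.trans[OF abs_Re_le_cmod])
    qed
  qed (use hol that in auto)
  have "g (of_real t) = G (of_real t)" for t
    using LIMSEQ_unique[OF lim[of "of_real t"]
        LIMSEQ_subseq_LIMSEQ[OF conv[of t] strict_mono_o[OF r(1) s], unfolded o_def]] .
  then have eq0: "g y - G y = 0" if "y \<in> \<real>" for y
    using that by (auto elim!: Reals_cases)
  have lp: "(0 :: complex) islimpt \<real>"
    unfolding islimpt_approachable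
  proof (intro allI impI)
    fix e :: real assume "e > 0"
    then show "\<exists>x'\<in>\<real>. x' \<noteq> 0 \<and> dist x' (0 :: complex) < e"
      by (intro bexI[of _ "of_real (e / 2)"]) (auto simp: norm_divide)
  qed
  have "(\<lambda>y. g y - G y) holomorphic_on UNIV" using g G by (intro holomorphic_on_diff)
  from analytic_continuation[OF this open_UNIV connected_UNIV subset_UNIV UNIV_I lp eq0 UNIV_I]
  have "g y - G y = 0" for y .
  then have "(\<lambda>n. H (r (s n)) z) \<longlonglongrightarrow> G z" using lim[of z] by simp
  then obtain n where "dist (H (r (s n)) z) (G z) < e"
    using e(1) unfolding lim_sequentially by blast
  with r(2)[of "s n"] show False by simp
qed

text \<open>
  The Laplace transforms are entire in \<open>t\<close> and their modulus is bounded by their values at real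
  points, so convergence on the real axis extends to the imaginary axis.
\<close>

lemma laplace_imp_char:
  fixes \<Omega> :: "nat \<Rightarrow> 'b set" and P Y :: "nat \<Rightarrow> 'b \<Rightarrow> real"
  assumes fin: "\<And>n. finite (\<Omega> n)" and pos: "\<And>n s. s \<in> \<Omega> n \<Longrightarrow> P n s \<ge> 0"
    and conv: "\<And>t. (\<lambda>n. \<Sum>s\<in>\<Omega> n. P n s * exp (t * Y n s)) \<longlonglongrightarrow> exp (v * t\<^sup>2 / 2)"
  shows "(\<lambda>n. \<Sum>s\<in>\<Omega> n. of_real (P n s) * exp (\<i> * of_real (t * Y n s))) \<longlonglongrightarrow> of_real (exp (- v * t\<^sup>2 / 2))"
proof -
  define H where "H = (\<lambda>n (z :: complex). \<Sum>s\<in>\<Omega> n. of_real (P n s) * exp (z * of_real (Y n s)))"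
  define L where "L = (\<lambda>n t. \<Sum>s\<in>\<Omega> n. P n s * exp (t * Y n s))"
  have HL: "H n (of_real t) = of_real (L n t)" for n t
    by (simp add: H_def L_def exp_of_real flip: of_real_mult)
  have "(\<lambda>n. H n (\<i> * of_real t)) \<longlonglongrightarrow> exp (of_real v * (\<i> * of_real t)\<^sup>2 / 2)"
  proof (rule vitali_real_axis[where G = "\<lambda>z. exp (of_real v * z\<^sup>2 / 2)"])
    show "H n holomorphic_on UNIV" for n
      unfolding H_def by (intro holomorphic_intros)
    show "(\<lambda>z. exp (of_real v * z\<^sup>2 / 2)) holomorphic_on UNIV"
      by (intro holomorphic_intros) auto
    show "(\<lambda>n. H n (of_real t)) \<longlonglongrightarrow> exp (of_real v * (of_real t)\<^sup>2 / 2)" for t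
    proof -
      have "(\<lambda>n. of_real (L n t) :: complex) \<longlonglongrightarrow> of_real (exp (v * t\<^sup>2 / 2))"
        using conv[of t] unfolding L_def by (rule tendsto_of_real)
      then show ?thesis unfolding HL by (simp flip: exp_of_real)
    qed
    fix R :: real
    have "Bseq (\<lambda>n. L n R + L n (- R))"
    proof (rule convergent_imp_Bseq, rule convergentI)
      show "(\<lambda>n. L n R + L n (- R)) \<longlonglongrightarrow> exp (v * R\<^sup>2 / 2) + exp (v * (- R)\<^sup>2 / 2)"
        unfolding L_def by (intro tendsto_add conv)
    qed
    then obtain B where B: "\<And>n. norm (L n R + L n (- R)) \<le> B" by (auto simp: Bseq_def)
    have "cmod (H n z) \<le> B" if z: "\<bar>Re z\<bar> \<le> R" for n z
    proof -
      have "cmod (H n z) \<le> (\<Sum>s\<in>\<Omega> n. P n s * exp (Re z * Y n s))"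
        unfolding H_def using pos by (intro sum_norm_le) (simp add: norm_mult norm_exp_eq_Re)
      also have "\<dots> \<le> (\<Sum>s\<in>\<Omega> n. P n s * (exp (R * Y n s) + exp (- R * Y n s)))"
      proof (intro sum_mono mult_left_mono pos)
        fix s
        have "Re z * Y n s \<le> R * \<bar>Y n s\<bar>"
          using mult_right_mono[OF z, of "\<bar>Y n s\<bar>"] abs_ge_self[of "Re z * Y n s"] by (simp add: abs_mult)
        then have "exp (Re z * Y n s) \<le> exp (R * \<bar>Y n s\<bar>)" by simp
        also have "\<dots> \<le> exp (R * Y n s) + exp (- R * Y n s)" by (cases "Y n s \<ge> 0") auto
        finally show "exp (Re z * Y n s) \<le> exp (R * Y n s) + exp (- R * Y n s)" .
      qed
      also have "\<dots> = L n R + L n (- R)"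
        by (simp add: L_def sum.distrib distrib_left)
      also have "\<dots> \<le> B" using B[of n] by simp
      finally show ?thesis .
    qed
    then show "\<exists>B. \<forall>n z. \<bar>Re z\<bar> \<le> R \<longrightarrow> cmod (H n z) \<le> B" by blast
  qed
  also have "exp (of_real v * (\<i> * of_real t)\<^sup>2 / 2) = (of_real (exp (- v * t\<^sup>2 / 2)) :: complex)"
    by (simp add: power_mult_distrib flip: exp_of_real)
  finally show ?thesis by (simp add: H_def mult_ac)
qed

context node_weight
begin

definition stat :: "(nat \<Rightarrow> real) \<Rightarrow> nat set \<Rightarrow> real" where "stat g S = (\<Sum>m\<in>S. g m)"

definition centered_char :: "nat \<Rightarrow> (nat \<Rightarrow> real) \<Rightarrow> real \<Rightarrow> complex" where
  "centered_char n g t = (\<Sum>S\<in>ens n. of_real (sw S / Zn n) * exp (\<i> * of_real (t * (stat g S - EE n (stat g)))))"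

lemma prob_sum_1: "n \<le> N \<Longrightarrow> (\<Sum>S\<in>ens n. sw S / Zn n) = 1"
  using Zn_pos[of n] by (simp add: Zn_def flip: sum_divide_distrib)

lemma centered_laplace_sum: "centered_laplace n g t = (\<Sum>S\<in>ens n. sw S / Zn n * exp (t * (stat g S - EE n (stat g))))"
  unfolding centered_laplace_def stat_def by (subst EE_def) (simp add: sum_divide_distrib)

lemma centered_laplace_uminus: "centered_laplace n (\<lambda>m. - g m) t = centered_laplace n g (- t)"
  by (simp add: centered_laplace_def EE_def sum_negf algebra_simps)

lemma centered_laplace_pos: "n \<le> N \<Longrightarrow> centered_laplace n g t > 0"
  by (simp add: centered_laplace_eq)

text \<open>
  Cauchy-Schwarz: characteristic functions are compared through the standard deviation of the
  difference.
\<close>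

lemma centered_char_diff_le:
  assumes n: "n \<le> N"
  shows "cmod (centered_char n f t - centered_char n g t) \<le> \<bar>t\<bar> * sqrt (cov n (\<lambda>m. f m - g m) (\<lambda>m. f m - g m))"
proof -
  define p where "p = (\<lambda>S. sw S / Zn n)"
  have p: "p S \<ge> 0" if "S \<in> ens n" for S
    using sw_pos[OF that] Zn_pos[OF n] by (simp add: p_def)
  have p1: "(\<Sum>S\<in>ens n. p S) = 1" using prob_sum_1[OF n] by (simp add: p_def)
  let ?h = "\<lambda>m. f m - g m"
  define D where "D = (\<lambda>S. stat ?h S - EE n (stat ?h))"
  have EEp: "EE n F = (\<Sum>S\<in>ens n. p S * F S)" for F
    by (simp add: EE_def p_def sum_divide_distrib)
  have sd: "stat ?h S = stat f S - stat g S" for S by (simp add: stat_def sum_subtractf)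
  have Ed: "EE n (stat ?h) = EE n (stat f) - EE n (stat g)"
    by (simp add: EEp sd algebra_simps sum_subtractf)
  have exp1: "cmod (exp (\<i> * of_real u) - exp (\<i> * of_real v)) \<le> \<bar>u - v\<bar>" for u v :: real
  proof -
    have "exp (\<i> * of_real u) - exp (\<i> * of_real v) = exp (\<i> * of_real v) * (iexp (u - v) - 1)"
      by (simp add: right_diff_distrib exp_diff)
    then have "cmod (exp (\<i> * of_real u) - exp (\<i> * of_real v)) = cmod (iexp (u - v) - 1)"
      by (simp add: norm_mult)
    also have "\<dots> \<le> \<bar>u - v\<bar>" using iexp_approx1[of "u - v" 0] by simp
    finally show ?thesis .
  qed
  have eq: "centered_char n f t - centered_char n g t = (\<Sum>S\<in>ens n. of_real (p S) * (exp (\<i> * of_real (t * (stat f S - EE n (stat f)))) -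
        exp (\<i> * of_real (t * (stat g S - EE n (stat g))))))"
    unfolding centered_char_def p_def by (simp add: sum_subtractf right_diff_distrib)
  have "cmod (centered_char n f t - centered_char n g t) \<le> (\<Sum>S\<in>ens n. p S * (\<bar>t\<bar> * \<bar>D S\<bar>))"
    unfolding eq
  proof (rule sum_norm_le)
    fix S assume S: "S \<in> ens n"
    have "cmod (exp (\<i> * of_real (t * (stat f S - EE n (stat f)))) - exp (\<i> * of_real (t * (stat g S - EE n (stat g)))))
        \<le> \<bar>t * (stat f S - EE n (stat f)) - t * (stat g S - EE n (stat g))\<bar>" by (rule exp1)
    also have "\<dots> = \<bar>t\<bar> * \<bar>D S\<bar>"
      unfolding D_def sd Ed by (simp add: algebra_simps flip: abs_mult)
    finally show "cmod (of_real (p S) * (exp (\<i> * of_real (t * (stat f S - EE n (stat f)))) -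
        exp (\<i> * of_real (t * (stat g S - EE n (stat g)))))) \<le> p S * (\<bar>t\<bar> * \<bar>D S\<bar>)"
      using p[OF S] by (simp add: norm_mult mult_left_mono)
  qed
  also have "\<dots> = \<bar>t\<bar> * (\<Sum>S\<in>ens n. p S * \<bar>D S\<bar>)"
    by (simp add: sum_distrib_left mult_ac)
  also have "(\<Sum>S\<in>ens n. p S * \<bar>D S\<bar>) \<le> sqrt (cov n ?h ?h)"
  proof (rule real_le_rsqrt)
    have "(\<Sum>S\<in>ens n. p S * \<bar>D S\<bar>)\<^sup>2 = (\<Sum>S\<in>ens n. sqrt (p S) * (sqrt (p S) * \<bar>D S\<bar>))\<^sup>2"
      using p by (intro arg_cong[where f = "\<lambda>x. x\<^sup>2"] sum.cong) (auto simp flip: mult.assoc)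
    also have "\<dots> \<le> (\<Sum>S\<in>ens n. (sqrt (p S))\<^sup>2) * (\<Sum>S\<in>ens n. (sqrt (p S) * \<bar>D S\<bar>)\<^sup>2)"
      by (rule Cauchy_Schwarz_ineq_sum)
    also have "\<dots> = (\<Sum>S\<in>ens n. p S) * (\<Sum>S\<in>ens n. p S * (D S)\<^sup>2)"
      using p by (simp add: power_mult_distrib)
    also have "\<dots> = (\<Sum>S\<in>ens n. p S * (D S)\<^sup>2)" using p1 by simp
    also have "\<dots> = cov n ?h ?h"
    proof -
      let ?E = "EE n (stat ?h)"
      have "(\<Sum>S\<in>ens n. p S * (D S)\<^sup>2) = (\<Sum>S\<in>ens n. p S * (stat ?h S * stat ?h S)) -
          2 * ?E * (\<Sum>S\<in>ens n. p S * stat ?h S) + ?E * ?E * (\<Sum>S\<in>ens n. p S)"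
        unfolding D_def sum_distrib_left sum_subtractf[symmetric] sum.distrib[symmetric]
        by (intro sum.cong refl) (simp add: power2_eq_square algebra_simps)
      also have "\<dots> = EE n (\<lambda>S. stat ?h S * stat ?h S) - ?E * ?E"
        using p1 by (simp add: EEp)
      finally show ?thesis by (simp add: cov_def stat_def[abs_def])
    qed
    finally show "(\<Sum>S\<in>ens n. p S * \<bar>D S\<bar>)\<^sup>2 \<le> cov n ?h ?h" .
  qed
  finally show ?thesis by (simp add: mult_left_mono)
qed

end

lemma poly_variance_minus: "poly_variance a b (- f) = poly_variance a b f"
  by (simp add: poly_variance_def fc_minus)

text \<open>
  The Laplace transforms converge for \<open>t \<ge> 0\<close> by the preceding section; negative arguments are
  covered by replacing \<open>f\<close> by \<open>- f\<close>.
\<close>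

theorem polynomial_clt:
  fixes N n :: "nat \<Rightarrow> nat" and x w :: "nat \<Rightarrow> nat \<Rightarrow> real"
  assumes nw: "\<And>\<nu>. node_weight (N \<nu>) (x \<nu>) (w \<nu>)"
    and x: "\<And>\<nu> m. m < N \<nu> \<Longrightarrow> \<bar>x \<nu> m\<bar> \<le> K"
    and near: "\<And>D \<epsilon>. \<epsilon> > 0 \<Longrightarrow> eventually (\<lambda>\<nu>. near_toeplitz a b (N \<nu>) (x \<nu>) (n \<nu>) D (w \<nu>) \<epsilon>) sequentially"
  shows "(\<lambda>\<nu>. node_weight.centered_char (N \<nu>) (x \<nu>) (w \<nu>) (n \<nu>) (\<lambda>m. poly f (x \<nu> m)) t) \<longlonglongrightarrow>
    of_real (exp (- poly_variance a b f * t\<^sup>2 / 2))"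
proof -
  have K: "max K 0 \<ge> 0" and x': "\<forall>m<N \<nu>. \<bar>x \<nu> m\<bar> \<le> max K 0" for \<nu> using x by (auto simp: le_max_iff_disj)
  let ?L = "\<lambda>\<nu> f t. node_weight.centered_laplace (N \<nu>) (x \<nu>) (w \<nu>) (n \<nu>) (\<lambda>m. poly f (x \<nu> m)) t"
  have ev_n: "eventually (\<lambda>\<nu>. n \<nu> \<le> N \<nu>) sequentially"
    using near[of 1 0] by (rule eventually_mono) (auto simp: near_toeplitz_def)
  have conv_pos: "(\<lambda>\<nu>. ?L \<nu> f t) \<longlonglongrightarrow> exp (poly_variance a b f * t\<^sup>2 / 2)" if t: "t \<ge> 0" for f t
  proof -
    have "(\<lambda>\<nu>. ln (?L \<nu> f t)) \<longlonglongrightarrow> poly_variance a b f * t\<^sup>2 / 2"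
    proof (rule LIMSEQ_I, goal_cases)
      case (1 r)
      obtain W \<delta> where \<delta>: "\<delta> > 0" and *: "\<And>N x w n. node_weight N x w \<Longrightarrow> (\<forall>m<N. \<bar>x m\<bar> \<le> max K 0) \<Longrightarrow>
          near_toeplitz a b N x n W w \<delta> \<Longrightarrow>
          \<bar>ln (node_weight.centered_laplace N x w n (\<lambda>m. poly f (x m)) t) - poly_variance a b f * t\<^sup>2 / 2\<bar> \<le> r / 2"
        using laplace_near_toeplitz[OF K t half_gt_zero[OF 1], of a b f] by blast
      from near[OF \<delta>, of W] obtain \<nu>0 where
        "\<And>\<nu>. \<nu> \<ge> \<nu>0 \<Longrightarrow> near_toeplitz a b (N \<nu>) (x \<nu>) (n \<nu>) W (w \<nu>) \<delta>"
        by (auto simp: eventually_at_top_linorder)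
      then have "norm (ln (?L \<nu> f t) - poly_variance a b f * t\<^sup>2 / 2) < r" if "\<nu> \<ge> \<nu>0" for \<nu>
        using *[OF nw x', of \<nu>] that 1 by fastforce
      then show ?case by blast
    qed
    then have "(\<lambda>\<nu>. exp (ln (?L \<nu> f t))) \<longlonglongrightarrow> exp (poly_variance a b f * t\<^sup>2 / 2)"
      by (rule tendsto_exp)
    then show ?thesis
    proof (rule Lim_transform_eventually)
      show "eventually (\<lambda>\<nu>. exp (ln (?L \<nu> f t)) = ?L \<nu> f t) sequentially"
        using ev_n by (rule eventually_mono) (simp add: node_weight.centered_laplace_pos[OF nw])
    qed
  qed
  have conv: "(\<lambda>\<nu>. ?L \<nu> f t) \<longlonglongrightarrow> exp (poly_variance a b f * t\<^sup>2 / 2)" for t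
  proof (cases "t \<ge> 0")
    case False
    then have "(\<lambda>\<nu>. ?L \<nu> (- f) (- t)) \<longlonglongrightarrow> exp (poly_variance a b (- f) * (- t)\<^sup>2 / 2)"
      by (intro conv_pos) auto
    then show ?thesis by (simp add: poly_variance_minus node_weight.centered_laplace_uminus[OF nw])
  qed (rule conv_pos)
  show ?thesis
    unfolding node_weight.centered_char_def[OF nw]
  proof (rule laplace_imp_char)
    show "finite (node_weight.ens (N \<nu>) (n \<nu>))" for \<nu> by (rule node_weight.finite_ens[OF nw])
    show "0 \<le> node_weight.sw (x \<nu>) (w \<nu>) S / node_weight.Zn (N \<nu>) (x \<nu>) (w \<nu>) (n \<nu>)"
      if S: "S \<in> node_weight.ens (N \<nu>) (n \<nu>)" for \<nu> S
    proof -
      interpret node_weight "N \<nu>" "x \<nu>" "w \<nu>" by (rule nw)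
      show ?thesis using S sw_pos by (auto simp: Zn_def less_imp_le intro!: divide_nonneg_nonneg sum_nonneg)
    qed
    show "(\<lambda>\<nu>. \<Sum>S\<in>node_weight.ens (N \<nu>) (n \<nu>). node_weight.sw (x \<nu>) (w \<nu>) S / node_weight.Zn (N \<nu>) (x \<nu>) (w \<nu>) (n \<nu>) *
        exp (t * (node_weight.stat (\<lambda>m. poly f (x \<nu> m)) S -
            node_weight.EE (N \<nu>) (x \<nu>) (w \<nu>) (n \<nu>) (node_weight.stat (\<lambda>m. poly f (x \<nu> m)))))) \<longlonglongrightarrow>
      exp (poly_variance a b f * t\<^sup>2 / 2)" for t
      using conv[of t] by (simp add: node_weight.centered_laplace_sum[OF nw])
  qed
qed

section \<open>Fourier coefficients and the limiting variance\<close>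

definition fcos :: "real \<Rightarrow> real \<Rightarrow> (real \<Rightarrow> real) \<Rightarrow> nat \<Rightarrow> real" where
  "fcos a b f l = 1 / (2 * pi) * integral {0..2*pi} (\<lambda>\<theta>. f (2 * a * cos \<theta> + b) * cos (real l * \<theta>))"

lemma power2_le_if_abs_le: "\<bar>u\<bar> \<le> v \<Longrightarrow> u\<^sup>2 \<le> (v :: real)\<^sup>2"
  using power_mono[of "\<bar>u\<bar>" v 2] by simp

lemma pderiv_sum: "pderiv (\<Sum>i\<in>I. p i) = (\<Sum>i\<in>I. pderiv (p i))"
  by (induction I rule: infinite_finite_induct) (simp_all add: pderiv_add)

lemma fcos_poly: "fcos a b (poly f) l = fc a b f (int l)"
  by (simp add: fcos_def fc_def)

text \<open>
  The function \<open>f (2 a cos \<theta> + b)\<close> is even about \<open>\<pi>\<close>; hence its Fourier coefficients are real cosine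
  coefficients.
\<close>

lemma fsin_integral_0:
  assumes "continuous_on UNIV f"
  shows "integral {0..2*pi} (\<lambda>\<theta>. f (2 * a * cos \<theta> + b) * sin (real l * \<theta>)) = 0"
proof -
  define g where "g = (\<lambda>\<theta>. f (2 * a * cos \<theta> + b) * sin (real l * \<theta>))"
  have cont: "continuous_on {0..2*pi} g"
    unfolding g_def by (intro continuous_intros continuous_on_compose2[OF assms]) auto
  then have I: "(g has_integral integral {0..2*pi} g) (cbox 0 (2*pi))"
    by (simp add: integrable_integral integrable_continuous_real)
  have "((\<lambda>\<theta>. g ((-1) *\<^sub>R \<theta> + 2*pi)) has_integral (1 / (\<bar>-1\<bar> ^ DIM(real))) *\<^sub>R integral {0..2*pi} g)
      ((\<lambda>x. (1 / (-1)) *\<^sub>R x + -((1 / (-1)) *\<^sub>R (2*pi))) ` cbox 0 (2*pi))"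
    by (rule has_integral_affinity[OF I]) simp
  moreover have "(\<lambda>x. (1 / (-1)) *\<^sub>R x + -((1 / (-1)) *\<^sub>R (2*pi))) ` cbox 0 (2*pi) = {0..2*pi}"
  proof -
    have "(\<lambda>x::real. (1 / (-1)) *\<^sub>R x + -((1 / (-1)) *\<^sub>R (2*pi))) = (\<lambda>x. 2*pi - x)" by auto
    then show ?thesis by (simp only: cbox_interval) (simp add: image_diff_atLeastAtMost)
  qed
  moreover have "g ((-1) *\<^sub>R \<theta> + 2*pi) = - g \<theta>" for \<theta>
  proof -
    have "sin (real l * (2*pi - \<theta>)) = - sin (real l * \<theta>)"
      using sin_npi[of "2*l"] cos_npi[of "2*l"] by (simp add: right_diff_distrib sin_diff mult_ac)
    moreover have "cos (2*pi - \<theta>) = cos \<theta>" by (simp add: cos_diff)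
    ultimately show ?thesis by (simp add: g_def)
  qed
  ultimately have "((\<lambda>\<theta>. - g \<theta>) has_integral integral {0..2*pi} g) {0..2*pi}" by simp
  then have "integral {0..2*pi} (\<lambda>\<theta>. - g \<theta>) = integral {0..2*pi} g" by (rule integral_unique)
  then have "integral {0..2*pi} g = 0" by simp
  then show ?thesis by (simp add: g_def)
qed

lemma fourier_coeff_eq_fcos:
  assumes f: "continuous_on UNIV f"
  shows "fourier_coeff a b f l = of_real (fcos a b f l)"
proof -
  let ?c = "\<lambda>\<theta>. f (2 * a * cos \<theta> + b) * cos (real l * \<theta>)"
  let ?s = "\<lambda>\<theta>. f (2 * a * cos \<theta> + b) * sin (real l * \<theta>)"
  have "(?c has_integral integral {0..2*pi} ?c) {0..2*pi}" "(?s has_integral integral {0..2*pi} ?s) {0..2*pi}"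
    by (intro integrable_integral integrable_continuous_real continuous_intros continuous_on_compose2[OF f]; simp)+
  from this[THEN has_integral_linear, OF bounded_linear_of_real]
  have "((\<lambda>\<theta>. of_real (?c \<theta>)) has_integral complex_of_real (integral {0..2*pi} ?c)) {0..2*pi}"
    "((\<lambda>\<theta>. of_real (?s \<theta>)) has_integral complex_of_real (integral {0..2*pi} ?s)) {0..2*pi}"
    by (simp_all add: o_def)
  then have "((\<lambda>\<theta>. of_real (?c \<theta>) - \<i> * of_real (?s \<theta>)) has_integral
      complex_of_real (integral {0..2*pi} ?c) - \<i> * complex_of_real (integral {0..2*pi} ?s)) {0..2*pi}"
    by (intro has_integral_diff has_integral_mult_right)
  then have "((\<lambda>\<theta>. of_real (?c \<theta>) - \<i> * of_real (?s \<theta>)) has_integral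
      complex_of_real (integral {0..2*pi} ?c)) {0..2*pi}"
    by (simp only: fsin_integral_0[OF f]) simp
  moreover have "of_real (f (2 * a * cos \<theta> + b)) * exp (- (\<i> * of_nat l * of_real \<theta>)) =
      complex_of_real (?c \<theta>) - \<i> * of_real (?s \<theta>)" for \<theta>
  proof -
    have "exp (- (\<i> * of_nat l * of_real \<theta>)) = cis (- (real l * \<theta>))"
      by (simp add: cis_conv_exp mult.assoc)
    also have "\<dots> = of_real (cos (real l * \<theta>)) - \<i> * of_real (sin (real l * \<theta>))"
      by (simp add: complex_eq_iff)
    finally have e: "exp (- (\<i> * of_nat l * of_real \<theta>)) = of_real (cos (real l * \<theta>)) - \<i> * of_real (sin (real l * \<theta>))" .
    show ?thesis unfolding e by (simp add: algebra_simps)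
  qed
  ultimately have "((\<lambda>\<theta>. of_real (f (2 * a * cos \<theta> + b)) * exp (- (\<i> * of_nat l * of_real \<theta>))) has_integral
      complex_of_real (integral {0..2*pi} ?c)) {0..2*pi}"
    by presburger
  then show ?thesis
    unfolding fourier_coeff_def fcos_def by (simp add: integral_unique)
qed

lemma integral_sin_sin:
  fixes l m :: nat
  assumes "l > 0"
  shows "integral {0..2*pi} (\<lambda>\<theta>. sin (real l * \<theta>) * sin (real m * \<theta>)) = (if l = m then pi else 0)"
proof -
  have "sin (real l * \<theta>) * sin (real m * \<theta>) =
      1 / 2 * (cos (of_int (int l - int m) * \<theta>) - cos (of_int (int l + int m) * \<theta>))" for \<theta>
    by (simp add: left_diff_distrib distrib_right cos_add cos_diff)
  then have "integral {0..2*pi} (\<lambda>\<theta>. sin (real l * \<theta>) * sin (real m * \<theta>)) =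
      1 / 2 * (integral {0..2*pi} (\<lambda>\<theta>. cos (of_int (int l - int m) * \<theta>)) -
         integral {0..2*pi} (\<lambda>\<theta>. cos (of_int (int l + int m) * \<theta>)))"
    by (simp only: integral_mult_right)
       (subst integral_diff, auto intro!: integrable_continuous_real continuous_intros)
  then show ?thesis using assms unfolding integral_cos_int by auto
qed

text \<open>
  Bessel's inequality for the orthogonal system of sines, from the nonnegative square of the
  remainder.
\<close>

lemma bessel_sin:
  assumes U: "continuous_on {0..2*pi} U"
  shows "(\<Sum>l=1..L. (integral {0..2*pi} (\<lambda>\<theta>. U \<theta> * sin (real l * \<theta>)))\<^sup>2) \<le> pi * integral {0..2*pi} (\<lambda>\<theta>. (U \<theta>)\<^sup>2)"
proof -
  define s where "s = (\<lambda>l. integral {0..2*pi} (\<lambda>\<theta>. U \<theta> * sin (real l * \<theta>)))"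
  define V where "V = (\<lambda>\<theta>. \<Sum>l=1..L. s l / pi * sin (real l * \<theta>))"
  have int: "f integrable_on {0..2*pi}" if "continuous_on {0..2*pi} f" for f :: "real \<Rightarrow> real"
    using that by (rule integrable_continuous_real)
  have V: "continuous_on {0..2*pi} V" unfolding V_def by (intro continuous_intros) auto
  have UV: "integral {0..2*pi} (\<lambda>\<theta>. U \<theta> * V \<theta>) = (\<Sum>l=1..L. (s l)\<^sup>2) / pi"
  proof -
    have "integral {0..2*pi} (\<lambda>\<theta>. U \<theta> * V \<theta>) = integral {0..2*pi} (\<lambda>\<theta>. \<Sum>l=1..L. s l / pi * (U \<theta> * sin (real l * \<theta>)))"
      by (simp add: V_def sum_distrib_left mult_ac)
    also have "\<dots> = (\<Sum>l=1..L. s l / pi * s l)"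
      unfolding s_def by (subst integral_sum) (auto intro!: int continuous_intros U)
    finally show ?thesis by (simp add: power2_eq_square sum_divide_distrib)
  qed
  have VV: "integral {0..2*pi} (\<lambda>\<theta>. (V \<theta>)\<^sup>2) = (\<Sum>l=1..L. (s l)\<^sup>2) / pi"
  proof -
    have "integral {0..2*pi} (\<lambda>\<theta>. (V \<theta>)\<^sup>2) = integral {0..2*pi} (\<lambda>\<theta>. \<Sum>l=1..L. \<Sum>m=1..L.
        s l / pi * (s m / pi) * (sin (real l * \<theta>) * sin (real m * \<theta>)))"
      by (simp add: V_def power2_eq_square sum_product mult_ac)
    also have "\<dots> = (\<Sum>l=1..L. integral {0..2*pi} (\<lambda>\<theta>. \<Sum>m=1..L. s l / pi * (s m / pi) * (sin (real l * \<theta>) * sin (real m * \<theta>))))"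
      by (rule integral_sum) (auto intro!: int continuous_intros)
    also have "\<dots> = (\<Sum>l=1..L. \<Sum>m=1..L. integral {0..2*pi} (\<lambda>\<theta>. s l / pi * (s m / pi) * (sin (real l * \<theta>) * sin (real m * \<theta>))))"
      by (intro sum.cong refl integral_sum) (auto intro!: int continuous_intros)
    also have "\<dots> = (\<Sum>l=1..L. \<Sum>m=1..L. s l / pi * (s m / pi) * (if l = m then pi else 0))"
    proof (rule sum.cong[OF refl], rule sum.cong[OF refl])
      fix l m :: nat assume "l \<in> {1..L}"
      then show "integral {0..2*pi} (\<lambda>\<theta>. s l / pi * (s m / pi) * (sin (real l * \<theta>) * sin (real m * \<theta>))) =
          s l / pi * (s m / pi) * (if l = m then pi else 0)"
        using integral_sin_sin[of l m] by simp
    qed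
    also have "\<dots> = (\<Sum>l=1..L. (s l)\<^sup>2) / pi"
      by (simp add: if_distrib power2_eq_square sum_divide_distrib cong: if_cong)
    finally show ?thesis .
  qed
  have "0 \<le> integral {0..2*pi} (\<lambda>\<theta>. (U \<theta> - V \<theta>)\<^sup>2)"
    by (intro integral_nonneg int continuous_intros U V) auto
  also have "\<dots> = integral {0..2*pi} (\<lambda>\<theta>. (U \<theta>)\<^sup>2 - 2 * (U \<theta> * V \<theta>) + (V \<theta>)\<^sup>2)"
    by (intro integral_cong) (simp add: power2_diff)
  also have "\<dots> = integral {0..2*pi} (\<lambda>\<theta>. (U \<theta>)\<^sup>2 - 2 * (U \<theta> * V \<theta>)) + integral {0..2*pi} (\<lambda>\<theta>. (V \<theta>)\<^sup>2)"
    by (intro integral_add int continuous_intros U V)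
  also have "integral {0..2*pi} (\<lambda>\<theta>. (U \<theta>)\<^sup>2 - 2 * (U \<theta> * V \<theta>)) =
      integral {0..2*pi} (\<lambda>\<theta>. (U \<theta>)\<^sup>2) - integral {0..2*pi} (\<lambda>\<theta>. 2 * (U \<theta> * V \<theta>))"
    by (intro integral_diff int continuous_intros U V)
  also have "integral {0..2*pi} (\<lambda>\<theta>. 2 * (U \<theta> * V \<theta>)) = 2 * integral {0..2*pi} (\<lambda>\<theta>. U \<theta> * V \<theta>)"
    by (rule integral_mult_right)
  finally have "(\<Sum>l=1..L. (s l)\<^sup>2) / pi \<le> integral {0..2*pi} (\<lambda>\<theta>. (U \<theta>)\<^sup>2)"
    unfolding UV VV by simp
  then have "(\<Sum>l=1..L. (s l)\<^sup>2) \<le> pi * integral {0..2*pi} (\<lambda>\<theta>. (U \<theta>)\<^sup>2)" by (simp add: field_simps)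
  then show ?thesis by (simp only: s_def)
qed

text \<open>
  Integration by parts turns \<open>l * fcos a b f l\<close> into a sine coefficient of the derivative of
  \<open>f (2 a cos \<theta> + b)\<close>.
\<close>

lemma fcos_bessel:
  assumes f: "\<And>y. (f has_real_derivative f' y) (at y)" and f': "continuous_on UNIV f'"
    and a: "a \<ge> 0" and M: "\<And>y. b - 2 * a \<le> y \<Longrightarrow> y \<le> b + 2 * a \<Longrightarrow> \<bar>f' y\<bar> \<le> M"
  shows "(\<Sum>l<L. real l * (fcos a b f l)\<^sup>2) \<le> 2 * a\<^sup>2 * M\<^sup>2"
proof -
  define U where "U = (\<lambda>\<theta>. f' (2 * a * cos \<theta> + b) * (- 2 * a * sin \<theta>))"
  have contf: "continuous_on UNIV f"
    using f by (meson DERIV_isCont continuous_at_imp_continuous_on)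
  have Uc: "continuous_on {0..2*pi} U"
    unfolding U_def by (intro continuous_intros continuous_on_compose2[OF f']) auto
  have parts: "real l * (2 * pi * fcos a b f l) = - integral {0..2*pi} (\<lambda>\<theta>. U \<theta> * sin (real l * \<theta>))" for l
  proof -
    let ?u = "\<lambda>\<theta>. f (2 * a * cos \<theta> + b)"
    have "((\<lambda>\<theta>. U \<theta> * sin (real l * \<theta>) + real l * (?u \<theta> * cos (real l * \<theta>))) has_integral
        ?u (2*pi) * sin (real l * (2*pi)) - ?u 0 * sin (real l * 0)) {0..2*pi}"
    proof (rule fundamental_theorem_of_calculus)
      fix \<theta> :: real
      have "((\<lambda>\<theta>. ?u \<theta> * sin (real l * \<theta>)) has_real_derivative U \<theta> * sin (real l * \<theta>) + real l * (?u \<theta> * cos (real l * \<theta>))) (at \<theta>)"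
        unfolding U_def
        by (auto intro!: derivative_eq_intros DERIV_chain2[OF f] simp: algebra_simps)
      then show "((\<lambda>\<theta>. ?u \<theta> * sin (real l * \<theta>)) has_vector_derivative U \<theta> * sin (real l * \<theta>) + real l * (?u \<theta> * cos (real l * \<theta>)))
          (at \<theta> within {0..2*pi})"
        by (simp add: has_real_derivative_iff_has_vector_derivative has_vector_derivative_at_within)
    qed simp
    moreover have "sin (real l * (2*pi)) = 0" using sin_npi[of "2*l"] by (simp add: mult_ac)
    ultimately have "integral {0..2*pi} (\<lambda>\<theta>. U \<theta> * sin (real l * \<theta>) + real l * (?u \<theta> * cos (real l * \<theta>))) = 0"
      by (simp add: integral_unique)
    moreover have "integral {0..2*pi} (\<lambda>\<theta>. U \<theta> * sin (real l * \<theta>) + real l * (?u \<theta> * cos (real l * \<theta>))) =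
       integral {0..2*pi} (\<lambda>\<theta>. U \<theta> * sin (real l * \<theta>)) + real l * integral {0..2*pi} (\<lambda>\<theta>. ?u \<theta> * cos (real l * \<theta>))"
      by (subst integral_add) (auto intro!: integrable_continuous_real continuous_intros Uc continuous_on_compose2[OF contf])
    ultimately show ?thesis by (simp add: fcos_def)
  qed
  have U2: "integral {0..2*pi} (\<lambda>\<theta>. (U \<theta>)\<^sup>2) \<le> integral {0..2*pi} (\<lambda>\<theta>. 4 * a\<^sup>2 * M\<^sup>2)"
  proof (rule integral_le)
    fix \<theta> :: real
    have "a * cos \<theta> \<le> a" "- a \<le> a * cos \<theta>"
      using a mult_left_mono[of "cos \<theta>" 1 a] mult_left_mono[of "-1" "cos \<theta>" a] by auto
    then have "\<bar>f' (2 * a * cos \<theta> + b)\<bar> \<le> M" by (intro M) auto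
    then have "\<bar>U \<theta>\<bar> \<le> M * (2 * a * 1)"
      unfolding U_def abs_mult using a by (intro mult_mono) (auto simp: abs_mult)
    then have "(U \<theta>)\<^sup>2 \<le> (M * (2 * a * 1))\<^sup>2" by (rule power2_le_if_abs_le)
    then show "(U \<theta>)\<^sup>2 \<le> 4 * a\<^sup>2 * M\<^sup>2" by (simp add: power_mult_distrib mult_ac)
  qed (auto intro!: integrable_continuous_real continuous_intros Uc)
  have "(\<Sum>l<L. real l * (fcos a b f l)\<^sup>2) \<le> (\<Sum>l<L. (real l * fcos a b f l)\<^sup>2)"
  proof (rule sum_mono)
    fix l :: nat
    have "real l * 1 \<le> real l * real l" by (cases l) auto
    then have "real l * (fcos a b f l)\<^sup>2 \<le> (real l * real l) * (fcos a b f l)\<^sup>2" by (intro mult_right_mono) auto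
    then show "real l * (fcos a b f l)\<^sup>2 \<le> (real l * fcos a b f l)\<^sup>2" by (simp add: power2_eq_square mult_ac)
  qed
  also have "\<dots> = (\<Sum>l\<in>{1..<L}. (real l * fcos a b f l)\<^sup>2)"
    by (rule sum.mono_neutral_right) auto
  also have "\<dots> \<le> (\<Sum>l=1..L. (real l * fcos a b f l)\<^sup>2)"
    by (rule sum_mono2) auto
  also have "\<dots> = (\<Sum>l=1..L. (integral {0..2*pi} (\<lambda>\<theta>. U \<theta> * sin (real l * \<theta>)))\<^sup>2) / (4 * pi\<^sup>2)"
  proof -
    have "(real l * fcos a b f l)\<^sup>2 = (integral {0..2*pi} (\<lambda>\<theta>. U \<theta> * sin (real l * \<theta>)))\<^sup>2 / (4 * pi\<^sup>2)" for l
    proof -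
      have "real l * fcos a b f l = - integral {0..2*pi} (\<lambda>\<theta>. U \<theta> * sin (real l * \<theta>)) / (2 * pi)"
        unfolding parts[of l, symmetric] by simp
      then show ?thesis by (simp add: power_divide power_mult_distrib)
    qed
    then show ?thesis by (simp add: sum_divide_distrib)
  qed
  also have "\<dots> \<le> (pi * (2 * pi * (4 * a\<^sup>2 * M\<^sup>2))) / (4 * pi\<^sup>2)"
  proof (rule divide_right_mono)
    have "(\<Sum>l=1..L. (integral {0..2*pi} (\<lambda>\<theta>. U \<theta> * sin (real l * \<theta>)))\<^sup>2) \<le> pi * integral {0..2*pi} (\<lambda>\<theta>. (U \<theta>)\<^sup>2)"
      by (rule bessel_sin[OF Uc])
    also have "\<dots> \<le> pi * (2 * pi * (4 * a\<^sup>2 * M\<^sup>2))"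
    proof (rule mult_left_mono[OF order.trans[OF U2]])
      have "integral {0..2*pi} (\<lambda>\<theta>. C) = 2 * pi * C" for C :: real by simp
      then show "integral {0..2*pi} (\<lambda>\<theta>. 4 * a\<^sup>2 * M\<^sup>2) \<le> 2 * pi * (4 * a\<^sup>2 * M\<^sup>2)" by (simp only: order_refl)
    qed simp
    finally show "(\<Sum>l=1..L. (integral {0..2*pi} (\<lambda>\<theta>. U \<theta> * sin (real l * \<theta>)))\<^sup>2) \<le> pi * (2 * pi * (4 * a\<^sup>2 * M\<^sup>2))" .
  qed simp
  also have "\<dots> = 2 * a\<^sup>2 * M\<^sup>2"
    by (simp add: power2_eq_square)
  finally show ?thesis .
qed

definition limit_variance :: "real \<Rightarrow> real \<Rightarrow> (real \<Rightarrow> real) \<Rightarrow> real" where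
  "limit_variance a b f = (\<Sum>l. real l * (fcos a b f l)\<^sup>2)"

lemma
  assumes f: "\<And>y. (f has_real_derivative f' y) (at y)" and f': "continuous_on UNIV f'" and a: "a \<ge> 0"
  shows limit_variance_summable: "summable (\<lambda>l. real l * (fcos a b f l)\<^sup>2)"
    and limit_variance_le: "(\<And>y. b - 2 * a \<le> y \<Longrightarrow> y \<le> b + 2 * a \<Longrightarrow> \<bar>f' y\<bar> \<le> M) \<Longrightarrow> limit_variance a b f \<le> 2 * a\<^sup>2 * M\<^sup>2"
proof -
  have "compact (f' ` {b - 2 * a..b + 2 * a})"
    by (intro compact_continuous_image continuous_on_subset[OF f']) auto
  then obtain M0 where "\<forall>z\<in>f' ` {b - 2 * a..b + 2 * a}. norm z \<le> M0"
    using compact_imp_bounded bounded_iff by metis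
  then have M0: "\<bar>f' y\<bar> \<le> M0" if "b - 2 * a \<le> y" "y \<le> b + 2 * a" for y using that by auto
  show s: "summable (\<lambda>l. real l * (fcos a b f l)\<^sup>2)"
  proof (rule bounded_imp_summable[of _ "2 * a\<^sup>2 * M0\<^sup>2"])
    show "(\<Sum>k\<le>m. real k * (fcos a b f k)\<^sup>2) \<le> 2 * a\<^sup>2 * M0\<^sup>2" for m
      using fcos_bessel[OF f f' a M0, where L = "Suc m"] by (simp add: lessThan_Suc_atMost)
  qed simp
  show "limit_variance a b f \<le> 2 * a\<^sup>2 * M\<^sup>2" if "\<And>y. b - 2 * a \<le> y \<Longrightarrow> y \<le> b + 2 * a \<Longrightarrow> \<bar>f' y\<bar> \<le> M"
    unfolding limit_variance_def by (rule suminf_le_const[OF s fcos_bessel[OF f f' a that]])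
qed

lemma limit_variance_poly: "limit_variance a b (poly f) = poly_variance a b f"
proof -
  have "limit_variance a b (poly f) = (\<Sum>l\<in>{..degree f}. real l * (fc a b f (int l))\<^sup>2)"
    unfolding limit_variance_def fcos_poly by (rule suminf_finite) (auto simp: fc_eq_0)
  also have "\<dots> = (\<Sum>l<Suc (degree f). real l * (fc a b f (int l))\<^sup>2)"
    by (simp add: lessThan_Suc_atMost)
  also have "\<dots> = poly_variance a b f"
    unfolding sum.lessThan_Suc_shift poly_variance_def by simp
  finally show ?thesis .
qed

lemma limit_variance_nonneg:
  assumes "summable (\<lambda>l. real l * (fcos a b f l)\<^sup>2)"
  shows "limit_variance a b f \<ge> 0"
  unfolding limit_variance_def using assms by (intro suminf_nonneg) auto

lemma fcos_diff:
  assumes "continuous_on UNIV f" "continuous_on UNIV g"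
  shows "fcos a b (\<lambda>y. f y - g y) l = fcos a b f l - fcos a b g l"
proof -
  have "integral {0..2*pi} (\<lambda>\<theta>. (f (2 * a * cos \<theta> + b) - g (2 * a * cos \<theta> + b)) * cos (real l * \<theta>)) =
      integral {0..2*pi} (\<lambda>\<theta>. f (2 * a * cos \<theta> + b) * cos (real l * \<theta>)) -
      integral {0..2*pi} (\<lambda>\<theta>. g (2 * a * cos \<theta> + b) * cos (real l * \<theta>))"
    unfolding left_diff_distrib
    by (intro integral_diff integrable_continuous_real continuous_intros
          continuous_on_compose2[OF assms(1)] continuous_on_compose2[OF assms(2)]) auto
  then show ?thesis by (simp add: fcos_def right_diff_distrib)
qed

text \<open>
  The limiting variance is a quadratic form bounded by the sup norm of the derivative. The cross
  term is split by the inequality \<open>2 u v \<le> \<eta> u\<^sup>2 + v\<^sup>2 / \<eta>\<close>.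
\<close>

lemma limit_variance_perturb:
  assumes f: "\<And>y. (f has_real_derivative f' y) (at y)" and f': "continuous_on UNIV f'"
    and g: "\<And>y. (g has_real_derivative g' y) (at y)" and g': "continuous_on UNIV g'"
    and a: "a \<ge> 0" and \<eta>: "0 < \<eta>" "\<eta> \<le> 1"
    and close: "\<And>y. b - 2 * a \<le> y \<Longrightarrow> y \<le> b + 2 * a \<Longrightarrow> \<bar>f' y - g' y\<bar> \<le> \<eta>"
  shows "\<bar>limit_variance a b f - limit_variance a b g\<bar> \<le> \<eta> * (limit_variance a b f + 4 * a\<^sup>2)"
proof -
  have contf: "continuous_on UNIV f" and contg: "continuous_on UNIV g"
    using f g by (meson DERIV_isCont continuous_at_imp_continuous_on)+
  let ?h = "\<lambda>y. f y - g y"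
  have h: "(?h has_real_derivative f' y - g' y) (at y)" for y by (intro DERIV_diff f g)
  have h': "continuous_on UNIV (\<lambda>y. f' y - g' y)" by (intro continuous_intros f' g')
  have sf: "summable (\<lambda>l. real l * (fcos a b f l)\<^sup>2)" by (rule limit_variance_summable[OF f f' a])
  have sg: "summable (\<lambda>l. real l * (fcos a b g l)\<^sup>2)" by (rule limit_variance_summable[OF g g' a])
  have sh: "summable (\<lambda>l. real l * (fcos a b ?h l)\<^sup>2)" by (rule limit_variance_summable[OF h h' a])
  have hv: "limit_variance a b ?h \<le> 2 * a\<^sup>2 * \<eta>\<^sup>2" by (rule limit_variance_le[OF h h' a close])
  have key: "\<bar>u\<^sup>2 - v\<^sup>2\<bar> \<le> \<eta> * u\<^sup>2 + (1 / \<eta> + 1) * (u - v)\<^sup>2" for u v :: real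
  proof -
    have "u\<^sup>2 - v\<^sup>2 = 2 * u * (u - v) - (u - v)\<^sup>2" by (simp add: power2_eq_square algebra_simps)
    moreover have "\<bar>2 * u * (u - v)\<bar> \<le> \<eta> * u\<^sup>2 + (u - v)\<^sup>2 / \<eta>"
    proof -
      have s: "sqrt \<eta> > 0" "sqrt \<eta> * sqrt \<eta> = \<eta>" using \<eta> by auto
      have "\<bar>2 * u * (u - v)\<bar> = 2 * (sqrt \<eta> * \<bar>u\<bar>) * (\<bar>u - v\<bar> / sqrt \<eta>)"
        using s by (simp add: abs_mult)
      also have "\<dots> \<le> (sqrt \<eta> * \<bar>u\<bar>)\<^sup>2 + (\<bar>u - v\<bar> / sqrt \<eta>)\<^sup>2" by (rule sum_squares_bound)
      also have "\<dots> = \<eta> * u\<^sup>2 + (u - v)\<^sup>2 / \<eta>"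
        using \<eta> by (simp add: power_mult_distrib power_divide)
      finally show ?thesis .
    qed
    ultimately have "\<bar>u\<^sup>2 - v\<^sup>2\<bar> \<le> \<eta> * u\<^sup>2 + (u - v)\<^sup>2 / \<eta> + (u - v)\<^sup>2"
      using zero_le_power2[of "u - v"] by linarith
    then show ?thesis by (simp add: algebra_simps)
  qed
  have tb: "\<bar>real l * (fcos a b f l)\<^sup>2 - real l * (fcos a b g l)\<^sup>2\<bar> \<le>
      \<eta> * (real l * (fcos a b f l)\<^sup>2) + (1 / \<eta> + 1) * (real l * (fcos a b ?h l)\<^sup>2)" for l
  proof -
    have "real l * \<bar>(fcos a b f l)\<^sup>2 - (fcos a b g l)\<^sup>2\<bar> \<le>
       real l * (\<eta> * (fcos a b f l)\<^sup>2 + (1 / \<eta> + 1) * (fcos a b ?h l)\<^sup>2)"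
      using key[of "fcos a b f l" "fcos a b g l"] unfolding fcos_diff[OF contf contg] by (intro mult_left_mono) auto
    moreover have "\<bar>real l * (fcos a b f l)\<^sup>2 - real l * (fcos a b g l)\<^sup>2\<bar> = real l * \<bar>(fcos a b f l)\<^sup>2 - (fcos a b g l)\<^sup>2\<bar>"
      by (metis abs_mult abs_of_nat right_diff_distrib)
    ultimately show ?thesis by (simp add: distrib_left mult_ac)
  qed
  have sr: "summable (\<lambda>l. \<eta> * (real l * (fcos a b f l)\<^sup>2) + (1 / \<eta> + 1) * (real l * (fcos a b ?h l)\<^sup>2))"
    by (intro summable_add summable_mult sf sh)
  have "\<bar>limit_variance a b f - limit_variance a b g\<bar> = \<bar>\<Sum>l. real l * (fcos a b f l)\<^sup>2 - real l * (fcos a b g l)\<^sup>2\<bar>"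
    unfolding limit_variance_def by (simp add: suminf_diff sf sg)
  also have "\<dots> \<le> (\<Sum>l. \<bar>real l * (fcos a b f l)\<^sup>2 - real l * (fcos a b g l)\<^sup>2\<bar>)"
    by (rule summable_rabs, rule summable_comparison_test'[OF sr]) (use tb in auto)
  also have "\<dots> \<le> (\<Sum>l. \<eta> * (real l * (fcos a b f l)\<^sup>2) + (1 / \<eta> + 1) * (real l * (fcos a b ?h l)\<^sup>2))"
    by (rule suminf_le[OF tb _ sr], rule summable_comparison_test'[OF sr]) (use tb in auto)
  also have "\<dots> = \<eta> * limit_variance a b f + (1 / \<eta> + 1) * limit_variance a b ?h"
    unfolding limit_variance_def using sf sh by (simp add: suminf_add[symmetric] suminf_mult summable_mult del: distrib_right)
  also have "\<dots> \<le> \<eta> * limit_variance a b f + (1 / \<eta> + 1) * (2 * a\<^sup>2 * \<eta>\<^sup>2)"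
    using hv \<eta> by (intro add_left_mono mult_left_mono) auto
  also have "(1 / \<eta> + 1) * (2 * a\<^sup>2 * \<eta>\<^sup>2) = 2 * a\<^sup>2 * (\<eta> * (1 + \<eta>))"
    using \<eta> by (simp add: power2_eq_square field_simps)
  also have "2 * a\<^sup>2 * (\<eta> * (1 + \<eta>)) \<le> 2 * a\<^sup>2 * (\<eta> * 2)"
    using \<eta> by (intro mult_left_mono) auto
  finally show ?thesis by (simp add: algebra_simps)
qed

text \<open>
  The derivative is approximated by the Weierstrass theorem and the polynomial is integrated.
\<close>

lemma C1_poly_approx:
  assumes f': "continuous_on UNIV f'" and \<eta>: "\<eta> > 0"
  shows "\<exists>p :: real poly. \<forall>y\<in>{-K..K}. \<bar>f' y - poly (pderiv p) y\<bar> \<le> \<eta>"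
proof -
  obtain g where g: "real_polynomial_function g" "\<And>y. y \<in> {-K..K} \<Longrightarrow> \<bar>f' y - g y\<bar> < \<eta>"
    using Stone_Weierstrass_real_polynomial_function[OF compact_Icc continuous_on_subset[OF f'] \<eta>, of "-K" K] by auto
  then obtain c n where c: "g = (\<lambda>x. \<Sum>i\<le>n. c i * x ^ i)"
    by (auto simp: real_polynomial_function_iff_sum)
  define p where "p = (\<Sum>i\<le>n. monom (c i / real (Suc i)) (Suc i))"
  have "pderiv p = (\<Sum>i\<le>n. monom (c i) i)"
    unfolding p_def pderiv_sum by (intro sum.cong refl) (simp add: pderiv_monom del: of_nat_Suc)
  then have "poly (pderiv p) y = g y" for y
    by (simp add: c poly_sum poly_monom)
  then show ?thesis using g(2) by (intro exI[of _ p]) (auto simp: less_imp_le)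
qed

section \<open>The central limit theorem for continuously differentiable statistics\<close>

text \<open>
  A polynomial with nearly the same derivative has, uniformly in the system, nearly the same
  characteristic function, because the variance of the difference is at most the squared Lipschitz
  constant times \<open>(ra n)\<^sup>2\<close>; its limiting variance is close as well.
\<close>

theorem C1_clt:
  fixes N n :: "nat \<Rightarrow> nat" and x w :: "nat \<Rightarrow> nat \<Rightarrow> real"
  assumes nw: "\<And>\<nu>. node_weight (N \<nu>) (x \<nu>) (w \<nu>)"
    and x: "\<And>\<nu> m. m < N \<nu> \<Longrightarrow> \<bar>x \<nu> m\<bar> \<le> K"
    and near: "\<And>D \<epsilon>. \<epsilon> > 0 \<Longrightarrow> eventually (\<lambda>\<nu>. near_toeplitz a b (N \<nu>) (x \<nu>) (n \<nu>) D (w \<nu>) \<epsilon>) sequentially"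
    and a: "a \<ge> 0"
    and f: "\<And>y. (f has_real_derivative f' y) (at y)" and f': "continuous_on UNIV f'"
  shows "(\<lambda>\<nu>. node_weight.centered_char (N \<nu>) (x \<nu>) (w \<nu>) (n \<nu>) (\<lambda>m. f (x \<nu> m)) t) \<longlonglongrightarrow>
    of_real (exp (- limit_variance a b f * t\<^sup>2 / 2))"
proof (rule LIMSEQ_I, goal_cases)
  case (1 \<epsilon>)
  \<comment> \<open>The interval \<open>[-K0, K0]\<close> contains both the nodes and the range of \<open>2 a cos \<theta> + b\<close>.\<close>
  define K0 where "K0 = max (max K 0) (\<bar>b\<bar> + 2 * a)"
  have K0: "K0 \<ge> 0" "\<bar>b\<bar> + 2 * a \<le> K0" "K \<le> K0" by (auto simp: K0_def)
  have sf: "summable (\<lambda>l. real l * (fcos a b f l)\<^sup>2)" by (rule limit_variance_summable[OF f f' a])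
  \<comment> \<open>The total error is at most \<open>\<eta> * G\<close> plus the error of the polynomial limit.\<close>
  define G where "G = \<bar>t\<bar> * K0 + (limit_variance a b f + 4 * a\<^sup>2) * t\<^sup>2 / 2 + 1"
  have Gpos: "G > 0"
    unfolding G_def using K0 limit_variance_nonneg[OF sf] by (intro add_nonneg_pos add_nonneg_nonneg) auto
  define \<eta> where "\<eta> = min 1 (\<epsilon> / (2 * G))"
  have \<eta>: "0 < \<eta>" "\<eta> \<le> 1" "\<eta> \<le> \<epsilon> / (2 * G)" using 1 Gpos by (auto simp: \<eta>_def)
  have "\<eta> * G \<le> \<epsilon> / (2 * G) * G" using \<eta> Gpos by (intro mult_right_mono) auto
  also have "\<dots> = \<epsilon> / 2" using Gpos by simp
  finally have \<eta>G: "\<eta> * G \<le> \<epsilon> / 2" .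
  obtain p where p: "\<And>y. y \<in> {-K0..K0} \<Longrightarrow> \<bar>f' y - poly (pderiv p) y\<bar> \<le> \<eta>"
    using C1_poly_approx[OF f' \<eta>(1), of K0] by blast
  let ?centered_char = "\<lambda>\<nu> f. node_weight.centered_char (N \<nu>) (x \<nu>) (w \<nu>) (n \<nu>) (\<lambda>m. f (x \<nu> m)) t"
  have centered_char_close: "cmod (?centered_char \<nu> f - ?centered_char \<nu> (poly p)) \<le> \<eta> * (\<bar>t\<bar> * K0)"
    if near: "near_toeplitz a b (N \<nu>) (x \<nu>) (n \<nu>) 1 (w \<nu>) 1" for \<nu>
  proof -
    interpret node_weight "N \<nu>" "x \<nu>" "w \<nu>" by (rule nw)
    have n: "0 < n \<nu>" "n \<nu> < N \<nu>" using near by (auto simp: near_toeplitz_def)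
    let ?h = "\<lambda>m. f (x \<nu> m) - poly p (x \<nu> m)"
    have "\<bar>?h m - ?h m'\<bar> \<le> \<eta> * \<bar>x \<nu> m - x \<nu> m'\<bar>" if "m < N \<nu>" "m' < N \<nu>" for m m'
    proof -
      have "x \<nu> m \<in> {-K0..K0}" "x \<nu> m' \<in> {-K0..K0}"
        using x[OF that(1)] x[OF that(2)] K0 by (auto simp: abs_le_iff)
      moreover have "((\<lambda>y. f y - poly p y) has_field_derivative f' y - poly (pderiv p) y) (at y within {-K0..K0})" for y
        by (rule has_field_derivative_at_within, intro DERIV_diff f poly_DERIV)
      ultimately show ?thesis
        using field_differentiable_bound[of "{-K0..K0}" "\<lambda>y. f y - poly p y" "\<lambda>y. f' y - poly (pderiv p) y" \<eta> "x \<nu> m" "x \<nu> m'"] p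
        by auto
    qed
    then have "cov (n \<nu>) ?h ?h \<le> \<eta>\<^sup>2 * cov (n \<nu>) (x \<nu>) (x \<nu>)"
      using n by (intro cov_lipschitz) auto
    also have "cov (n \<nu>) (x \<nu>) (x \<nu>) = (ra (n \<nu>))\<^sup>2"
      using n me_x_offdiag[of "n \<nu> - 1"] by (simp add: cov_x_left power2_eq_square)
    also have "(ra (n \<nu>))\<^sup>2 \<le> K0\<^sup>2"
      using n K0 x ra_bound[of K0 "n \<nu>"] by (intro power2_le_if_abs_le) (auto intro: order.trans)
    finally have "cov (n \<nu>) ?h ?h \<le> (\<eta> * K0)\<^sup>2" by (simp add: power_mult_distrib mult_left_mono)
    then have "sqrt (cov (n \<nu>) ?h ?h) \<le> \<eta> * K0"
      using \<eta> K0 by (intro real_le_lsqrt) auto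
    then have "\<bar>t\<bar> * sqrt (cov (n \<nu>) ?h ?h) \<le> \<bar>t\<bar> * (\<eta> * K0)" by (intro mult_left_mono) auto
    then show ?thesis
      using centered_char_diff_le[of "n \<nu>" "\<lambda>m. f (x \<nu> m)" t "\<lambda>m. poly p (x \<nu> m)"] n by (simp add: mult_ac)
  qed
  have var_close: "\<bar>limit_variance a b f - limit_variance a b (poly p)\<bar> \<le> \<eta> * (limit_variance a b f + 4 * a\<^sup>2)"
  proof (rule limit_variance_perturb[OF f f' poly_DERIV _ a \<eta>(1,2)])
    show "continuous_on UNIV (poly (pderiv p))" by (intro continuous_intros)
    fix y assume "b - 2 * a \<le> y" "y \<le> b + 2 * a"
    then show "\<bar>f' y - poly (pderiv p) y\<bar> \<le> \<eta>" using K0 by (intro p) (auto simp: abs_le_iff)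
  qed
  have pv: "limit_variance a b (poly p) \<ge> 0"
    by (rule limit_variance_nonneg, rule limit_variance_summable[OF poly_DERIV _ a]) (intro continuous_intros)
  have exp_lip: "\<bar>exp (- u) - exp (- v)\<bar> \<le> \<bar>u - v\<bar>" if "u \<ge> 0" "v \<ge> 0" for u v :: real
  proof -
    have *: "exp (- u) - exp (- v) \<le> v - u" if "0 \<le> u" "u \<le> v" for u v :: real
    proof -
      have "1 + (u - v) \<le> exp (u - v)" by (rule exp_ge_add_one_self)
      then have "1 - exp (u - v) \<le> v - u" by linarith
      moreover have "exp (- u) * (1 - exp (u - v)) \<le> 1 * (1 - exp (u - v))"
        using that by (intro mult_right_mono) auto
      moreover have "exp (- u) * (1 - exp (u - v)) = exp (- u) - exp (- v)"
        by (simp add: right_diff_distrib flip: exp_add)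
      ultimately show ?thesis by (metis mult_1 order.trans)
    qed
    show ?thesis
      using *[of u v] *[of v u] that by (cases "u \<le> v") (auto simp: abs_if)
  qed
  have lim_close: "cmod (of_real (exp (- limit_variance a b (poly p) * t\<^sup>2 / 2)) - of_real (exp (- limit_variance a b f * t\<^sup>2 / 2)))
      \<le> \<eta> * ((limit_variance a b f + 4 * a\<^sup>2) * t\<^sup>2 / 2)"
  proof -
    have "\<bar>exp (- (limit_variance a b (poly p) * t\<^sup>2 / 2)) - exp (- (limit_variance a b f * t\<^sup>2 / 2))\<bar> \<le>
        \<bar>limit_variance a b (poly p) * t\<^sup>2 / 2 - limit_variance a b f * t\<^sup>2 / 2\<bar>"
      using pv limit_variance_nonneg[OF sf] by (intro exp_lip) auto
    also have "\<dots> = \<bar>limit_variance a b f - limit_variance a b (poly p)\<bar> * (t\<^sup>2 / 2)"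
      by (simp add: abs_minus_commute abs_mult flip: left_diff_distrib diff_divide_distrib)
    also have "\<dots> \<le> \<eta> * (limit_variance a b f + 4 * a\<^sup>2) * (t\<^sup>2 / 2)"
      by (intro mult_right_mono var_close) auto
    finally show ?thesis
      by (simp only: of_real_diff[symmetric] norm_of_real minus_mult_left minus_divide_left mult.assoc times_divide_eq_right)
  qed
  have "(\<lambda>\<nu>. ?centered_char \<nu> (poly p)) \<longlonglongrightarrow> of_real (exp (- limit_variance a b (poly p) * t\<^sup>2 / 2))"
    unfolding limit_variance_poly by (rule polynomial_clt[OF nw x near])
  have near1: "eventually (\<lambda>\<nu>. near_toeplitz a b (N \<nu>) (x \<nu>) (n \<nu>) 1 (w \<nu>) 1) sequentially"
    by (rule near) simp
  from \<open>(\<lambda>\<nu>. ?centered_char \<nu> (poly p)) \<longlonglongrightarrow> _\<close>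
  have "eventually (\<lambda>\<nu>. dist (?centered_char \<nu> (poly p)) (of_real (exp (- limit_variance a b (poly p) * t\<^sup>2 / 2))) < \<epsilon> / 2) sequentially"
    using 1 by (intro tendstoD) auto
  then have "eventually (\<lambda>\<nu>. norm (?centered_char \<nu> f - of_real (exp (- limit_variance a b f * t\<^sup>2 / 2))) < \<epsilon>) sequentially"
    using near1
  proof eventually_elim
    case (elim \<nu>)
    let ?A = "?centered_char \<nu> f - ?centered_char \<nu> (poly p)"
    let ?B = "?centered_char \<nu> (poly p) - of_real (exp (- limit_variance a b (poly p) * t\<^sup>2 / 2))"
    let ?C = "of_real (exp (- limit_variance a b (poly p) * t\<^sup>2 / 2)) - of_real (exp (- limit_variance a b f * t\<^sup>2 / 2)) :: complex"
    have "norm (?centered_char \<nu> f - of_real (exp (- limit_variance a b f * t\<^sup>2 / 2))) = norm (?A + ?B + ?C)" by simp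
    also have "\<dots> \<le> norm ?A + norm ?B + norm ?C"
      by (intro order.trans[OF norm_triangle_ineq] add_right_mono norm_triangle_ineq)
    also have "\<dots> < \<eta> * (\<bar>t\<bar> * K0) + \<epsilon> / 2 + \<eta> * ((limit_variance a b f + 4 * a\<^sup>2) * t\<^sup>2 / 2)"
      using centered_char_close[OF elim(2)] elim(1) lim_close unfolding dist_norm by linarith
    also have "\<dots> = \<eta> * G - \<eta> + \<epsilon> / 2" by (simp add: G_def algebra_simps)
    also have "\<dots> < \<epsilon>" using \<eta>G \<eta>(1) by linarith
    finally show ?case .
  qed
  then show ?case by (simp add: eventually_at_top_linorder)
qed

section \<open>Principal specialisation of Schur polynomials\<close>

text \<open>
  The diagrams obtained from \<open>\<nu>\<close>, with at most \<open>m + 1\<close> rows, by removing a horizontal strip and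
  having at most \<open>m\<close> rows.
\<close>

definition interlacing :: "nat \<Rightarrow> (nat \<Rightarrow> nat) \<Rightarrow> (nat \<Rightarrow> nat) set" where
  "interlacing m \<nu> = {\<mu>. (\<forall>i<m. \<nu> (Suc i) \<le> \<mu> i \<and> \<mu> i \<le> \<nu> i) \<and> (\<forall>i\<ge>m. \<mu> i = 0)}"

definition rows_le :: "nat \<Rightarrow> (nat \<Rightarrow> nat) set" where
  "rows_le m = {\<nu>. antimono \<nu> \<and> (\<forall>i\<ge>m. \<nu> i = 0)}"

lemma cells_Sigma: "\<nu> \<in> rows_le m \<Longrightarrow> cells \<nu> = Sigma {..<m} (\<lambda>i. {..<\<nu> i})"
  unfolding cells_def rows_le_def by auto (metis less_nat_zero_code not_le)

lemma finite_cells: "\<nu> \<in> rows_le m \<Longrightarrow> finite (cells \<nu>)"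
  by (simp add: cells_Sigma)

lemma finite_ssyt: "\<nu> \<in> rows_le m \<Longrightarrow> finite (ssyt k \<nu>)"
  unfolding ssyt_def by (rule finite_subset[of _ "cells \<nu> \<rightarrow>\<^sub>E {..<k}"]) (auto intro!: finite_PiE finite_cells)

lemma interlacing_rows_le:
  assumes \<nu>: "\<nu> \<in> rows_le (Suc m)" and \<mu>: "\<mu> \<in> interlacing m \<nu>"
  shows "\<mu> \<in> rows_le m" and "\<mu> i \<le> \<nu> i"
proof -
  have "\<mu> (Suc i) \<le> \<mu> i" for i
  proof (cases "Suc i < m")
    case True
    then have "\<mu> (Suc i) \<le> \<nu> (Suc i)" "\<nu> (Suc i) \<le> \<mu> i" using \<mu> by (auto simp: interlacing_def)
    then show ?thesis by simp
  next
    case False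
    then show ?thesis using \<mu> by (simp add: interlacing_def)
  qed
  then have "antimono \<mu>" by (simp add: decseq_Suc_iff)
  then show "\<mu> \<in> rows_le m" using \<mu> by (simp add: rows_le_def interlacing_def)
  show "\<mu> i \<le> \<nu> i" using \<mu> by (cases "i < m") (auto simp: interlacing_def)
qed

lemma finite_interlacing: "finite (interlacing m \<nu>)"
proof (rule finite_subset)
  show "interlacing m \<nu> \<subseteq> (\<lambda>f i. if i < m then f i else 0) ` ({..<m} \<rightarrow>\<^sub>E {..Max (insert 0 (\<nu> ` {..<m}))})"
  proof
    fix \<mu> assume \<mu>: "\<mu> \<in> interlacing m \<nu>"
    have "\<mu> i \<le> Max (insert 0 (\<nu> ` {..<m}))" if "i < m" for i
    proof -
      have "\<mu> i \<le> \<nu> i" using \<mu> that by (auto simp: interlacing_def)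
      also have "\<nu> i \<le> Max (insert 0 (\<nu> ` {..<m}))" using that by (intro Max_ge) auto
      finally show ?thesis .
    qed
    then have "restrict \<mu> {..<m} \<in> {..<m} \<rightarrow>\<^sub>E {..Max (insert 0 (\<nu> ` {..<m}))}" by auto
    moreover have "\<mu> = (\<lambda>i. if i < m then restrict \<mu> {..<m} i else 0)"
      using \<mu> by (auto simp: interlacing_def fun_eq_iff)
    ultimately show "\<mu> \<in> (\<lambda>f i. if i < m then f i else 0) ` ({..<m} \<rightarrow>\<^sub>E {..Max (insert 0 (\<nu> ` {..<m}))})" by blast
  qed
qed (intro finite_imageI finite_PiE, auto)

text \<open>
  A downward closed set of indices is the segment below its cardinality.
\<close>

lemma initial_segment_card:
  fixes P :: "nat \<Rightarrow> bool"
  assumes "\<And>j j'. j < j' \<Longrightarrow> j' < n \<Longrightarrow> P j' \<Longrightarrow> P j"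
  shows "j < card {j. j < n \<and> P j} \<longleftrightarrow> j < n \<and> P j"
proof -
  let ?A = "{j. j < n \<and> P j}"
  have fin: "finite ?A" by simp
  have down: "j \<in> ?A" if "j < j'" "j' \<in> ?A" for j j' using assms that by auto
  show ?thesis
  proof
    assume "j < n \<and> P j"
    then have "{..j} \<subseteq> ?A" using down by (auto simp: le_less)
    then have "card {..j} \<le> card ?A" using fin by (rule card_mono[rotated])
    then show "j < card ?A" by simp
  next
    assume j: "j < card ?A"
    show "j < n \<and> P j"
    proof (rule ccontr)
      assume "\<not> (j < n \<and> P j)"
      then have "?A \<subseteq> {..<j}" using down by (metis (no_types, lifting) lessThan_iff linorder_neqE_nat mem_Collect_eq subsetI)
      then have "card ?A \<le> card {..<j}" by (intro card_mono) auto
      then show False using j by simp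
    qed
  qed
qed

text \<open>
  The shape formed by the entries smaller than \<open>m\<close>. The function \<open>fill_top\<close> reverses its formation,
  which describes the branching of tableaux at the largest entry.
\<close>

definition top_removed :: "nat \<Rightarrow> (nat \<Rightarrow> nat) \<Rightarrow> (nat \<times> nat \<Rightarrow> nat) \<Rightarrow> nat \<Rightarrow> nat" where
  "top_removed m \<nu> T i = card {j. j < \<nu> i \<and> T (i, j) < m}"

lemma ssyt_cells_top_removed:
  assumes "T \<in> ssyt k \<nu>"
  shows "(i, j) \<in> cells (top_removed m \<nu> T) \<longleftrightarrow> (i, j) \<in> cells \<nu> \<and> T (i, j) < m"
proof -
  have "j < card {j. j < \<nu> i \<and> T (i, j) < m} \<longleftrightarrow> j < \<nu> i \<and> T (i, j) < m"
  proof (rule initial_segment_card)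
    fix j j' assume *: "j < j'" "j' < \<nu> i" "T (i, j') < m"
    then have "T (i, j) \<le> T (i, j')" using assms by (auto simp: ssyt_def cells_def)
    then show "T (i, j) < m" using * by simp
  qed
  then show ?thesis by (simp add: cells_def top_removed_def)
qed

text \<open>
  Columns increase strictly, so the largest entry \<open>m\<close> is the only one that can occur in row \<open>m\<close>.
\<close>

lemma ssyt_column_ge:
  assumes \<nu>: "antimono \<nu>" and T: "T \<in> ssyt k \<nu>"
  shows "(i, j) \<in> cells \<nu> \<Longrightarrow> i \<le> T (i, j)"
proof (induction i)
  case (Suc i)
  then have c: "(i, j) \<in> cells \<nu>"
    using antimonoD[OF \<nu>, of i "Suc i"] by (auto simp: cells_def)
  then have "T (i, j) < T (Suc i, j)" using T Suc.prems by (auto simp: ssyt_def)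
  then show ?case using Suc.IH[OF c] by simp
qed simp

lemma top_removed_interlacing:
  assumes \<nu>: "\<nu> \<in> rows_le (Suc m)" and T: "T \<in> ssyt (Suc m) \<nu>"
  shows "top_removed m \<nu> T \<in> interlacing m \<nu>"
proof -
  have an: "antimono \<nu>" using \<nu> by (simp add: rows_le_def)
  have "\<nu> (Suc i) \<le> top_removed m \<nu> T i" for i
  proof (rule ccontr)
    assume "\<not> ?thesis"
    then have j: "top_removed m \<nu> T i < \<nu> (Suc i)" (is "?j < _") by simp
    then have c: "(Suc i, ?j) \<in> cells \<nu>" "(i, ?j) \<in> cells \<nu>"
      using antimonoD[OF an, of i "Suc i"] by (auto simp: cells_def)
    then have "T (i, ?j) < T (Suc i, ?j)" "T (Suc i, ?j) < Suc m" using T by (auto simp: ssyt_def)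
    then have "T (i, ?j) < m" by simp
    then have "(i, ?j) \<in> cells (top_removed m \<nu> T)"
      using c ssyt_cells_top_removed[OF T] by blast
    then show False by (simp add: cells_def)
  qed
  moreover have "top_removed m \<nu> T i \<le> \<nu> i" for i
  proof -
    have "top_removed m \<nu> T i \<le> card {..<\<nu> i}"
      unfolding top_removed_def by (rule card_mono) auto
    then show ?thesis by simp
  qed
  moreover have "top_removed m \<nu> T i = 0" if "i \<ge> m" for i
  proof (rule ccontr)
    assume "top_removed m \<nu> T i \<noteq> 0"
    then have "(i, 0) \<in> cells (top_removed m \<nu> T)" by (simp add: cells_def)
    then have "(i, 0) \<in> cells \<nu>" "T (i, 0) < m" using ssyt_cells_top_removed[OF T] by auto
    then show False using ssyt_column_ge[OF an T] that by fastforce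
  qed
  ultimately show ?thesis by (simp add: interlacing_def)
qed

definition fill_top :: "nat \<Rightarrow> (nat \<Rightarrow> nat) \<Rightarrow> (nat \<Rightarrow> nat) \<Rightarrow> (nat \<times> nat \<Rightarrow> nat) \<Rightarrow> nat \<times> nat \<Rightarrow> nat" where
  "fill_top m \<nu> \<mu> T p = (if p \<in> cells \<mu> then T p else if p \<in> cells \<nu> then m else undefined)"

lemma fill_top_ssyt:
  assumes \<nu>: "\<nu> \<in> rows_le (Suc m)" and \<mu>: "\<mu> \<in> interlacing m \<nu>" and T: "T \<in> ssyt m \<mu>"
  shows "fill_top m \<nu> \<mu> T \<in> ssyt (Suc m) \<nu>"
proof -
  have sub: "p \<in> cells \<nu>" if "p \<in> cells \<mu>" for p
    using that interlacing_rows_le(2)[OF \<nu> \<mu>] by (auto simp: cells_def intro: less_le_trans)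
  have Tm: "T p < m" if "p \<in> cells \<mu>" for p using T that by (auto simp: ssyt_def)
  have an: "antimono \<mu>" "antimono \<nu>"
    using interlacing_rows_le(1)[OF \<nu> \<mu>] \<nu> by (auto simp: rows_le_def)
  show ?thesis
    unfolding ssyt_def
  proof (intro CollectI conjI allI impI)
    show "fill_top m \<nu> \<mu> T \<in> cells \<nu> \<rightarrow>\<^sub>E {..<Suc m}"
      using sub Tm by (auto simp: fill_top_def PiE_iff extensional_def less_Suc_eq)
  next
    fix i j j' assume *: "j < j' \<and> (i, j') \<in> cells \<nu>"
    then have "(i, j) \<in> cells \<nu>" by (auto simp: cells_def)
    moreover have "(i, j) \<in> cells \<mu> \<and> T (i, j) \<le> T (i, j')" if "(i, j') \<in> cells \<mu>"
      using that * T by (auto simp: ssyt_def cells_def)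
    ultimately show "fill_top m \<nu> \<mu> T (i, j) \<le> fill_top m \<nu> \<mu> T (i, j')"
      using * Tm by (auto simp: fill_top_def less_imp_le)
  next
    fix i i' j assume *: "i < i' \<and> (i', j) \<in> cells \<nu>"
    then have j: "j < \<nu> i'" by (simp add: cells_def)
    have "\<nu> i' = 0" if "Suc m \<le> i'" using \<nu> that by (simp add: rows_le_def)
    then have "i < m" using * j by (cases "Suc m \<le> i'") auto
    then have "\<nu> (Suc i) \<le> \<mu> i" using \<mu> by (simp add: interlacing_def)
    moreover have "\<nu> i' \<le> \<nu> (Suc i)" using * by (intro antimonoD[OF an(2)]) auto
    ultimately have c: "(i, j) \<in> cells \<mu>" using j by (simp add: cells_def)
    show "fill_top m \<nu> \<mu> T (i, j) < fill_top m \<nu> \<mu> T (i', j)"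
    proof (cases "(i', j) \<in> cells \<mu>")
      case True
      then show ?thesis using c T * by (auto simp: fill_top_def ssyt_def)
    next
      case False
      then show ?thesis using c Tm * by (auto simp: fill_top_def)
    qed
  qed
qed

text \<open>
  The entries equal to the largest value form a horizontal strip, and the others form an arbitrary
  tableau of the interlacing shape.
\<close>

lemma schur_branching:
  assumes \<nu>: "\<nu> \<in> rows_le (Suc m)"
  shows "schur (Suc m) x \<nu> = (\<Sum>\<mu>\<in>interlacing m \<nu>. x m ^ (\<Sum>i\<le>m. \<nu> i - \<mu> i) * schur m x \<mu>)"
proof -
  have fin: "finite (ssyt m \<mu>)" if "\<mu> \<in> interlacing m \<nu>" for \<mu>
    using interlacing_rows_le[OF \<nu> that] finite_ssyt by blast
  have "(\<Sum>\<mu>\<in>interlacing m \<nu>. x m ^ (\<Sum>i\<le>m. \<nu> i - \<mu> i) * schur m x \<mu>) =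
      (\<Sum>(\<mu>, T)\<in>Sigma (interlacing m \<nu>) (ssyt m). x m ^ (\<Sum>i\<le>m. \<nu> i - \<mu> i) * (\<Prod>p\<in>cells \<mu>. x (T p)))"
    unfolding schur_def sum_distrib_left by (rule sum.Sigma) (use fin finite_interlacing in auto)
  also have "\<dots> = (\<Sum>T\<in>ssyt (Suc m) \<nu>. \<Prod>p\<in>cells \<nu>. x (T p))"
  proof (rule sum.reindex_bij_witness[where
        i = "\<lambda>T. (top_removed m \<nu> T, restrict T (cells (top_removed m \<nu> T)))"
        and j = "\<lambda>(\<mu>, T). fill_top m \<nu> \<mu> T"], goal_cases)
    case (1 p)
    then obtain \<mu> T where p: "p = (\<mu>, T)" "\<mu> \<in> interlacing m \<nu>" "T \<in> ssyt m \<mu>" by auto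
    let ?F = "fill_top m \<nu> \<mu> T"
    have F: "?F \<in> ssyt (Suc m) \<nu>" using fill_top_ssyt[OF \<nu>] p by auto
    have sub: "c \<in> cells \<nu>" if "c \<in> cells \<mu>" for c
      using that interlacing_rows_le(2)[OF \<nu> p(2)] by (auto simp: cells_def intro: less_le_trans)
    have Tm: "T c < m" if "c \<in> cells \<mu>" for c using p that by (auto simp: ssyt_def)
    have cells: "cells (top_removed m \<nu> ?F) = cells \<mu>"
    proof (rule Set.set_eqI)
      fix c :: "nat \<times> nat"
      obtain i j where c: "c = (i, j)" by (cases c)
      show "c \<in> cells (top_removed m \<nu> ?F) \<longleftrightarrow> c \<in> cells \<mu>"
        unfolding c ssyt_cells_top_removed[OF F] using sub Tm by (auto simp: fill_top_def)
    qed
    then have jl: "j < top_removed m \<nu> ?F i \<longleftrightarrow> j < \<mu> i" for i j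
      unfolding cells_def by (auto simp: set_eq_iff)
    have "top_removed m \<nu> ?F i = \<mu> i" for i
      using jl[of "\<mu> i" i] jl[of "top_removed m \<nu> ?F i" i] by simp
    then have "top_removed m \<nu> ?F = \<mu>" by (rule ext)
    moreover have "restrict ?F (cells \<mu>) = T"
      using p(3) by (auto simp: ssyt_def fill_top_def fun_eq_iff PiE_iff extensional_def)
    ultimately show ?case using p by simp
  next
    case (2 p)
    then show ?case using fill_top_ssyt[OF \<nu>] by auto
  next
    case (3 T)
    let ?\<mu> = "top_removed m \<nu> T"
    have "fill_top m \<nu> ?\<mu> (restrict T (cells ?\<mu>)) c = T c" for c
    proof -
      obtain i j where c: "c = (i, j)" by (cases c)
      have "T c = m" if "c \<in> cells \<nu>" "c \<notin> cells ?\<mu>"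
      proof -
        have "T c < Suc m" using 3 that by (auto simp: ssyt_def)
        moreover have "\<not> T c < m" using ssyt_cells_top_removed[OF 3, of i j m] that c by auto
        ultimately show ?thesis by simp
      qed
      moreover have "T c = undefined" if "c \<notin> cells \<nu>" using 3 that c by (auto simp: ssyt_def PiE_iff extensional_def)
      ultimately show ?thesis by (auto simp: fill_top_def)
    qed
    then show ?case by auto
  next
    case (4 T)
    let ?\<mu> = "top_removed m \<nu> T"
    have \<mu>: "?\<mu> \<in> interlacing m \<nu>" by (rule top_removed_interlacing[OF \<nu> 4])
    have an: "antimono ?\<mu>" using interlacing_rows_le[OF \<nu> \<mu>] by (simp add: rows_le_def)
    have c: "(i, j) \<in> cells ?\<mu> \<longleftrightarrow> (i, j) \<in> cells \<nu> \<and> T (i, j) < m" for i j by (rule ssyt_cells_top_removed[OF 4])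
    have "restrict T (cells ?\<mu>) \<in> ssyt m ?\<mu>"
      unfolding ssyt_def
    proof (intro CollectI conjI allI impI)
      show "restrict T (cells ?\<mu>) \<in> cells ?\<mu> \<rightarrow>\<^sub>E {..<m}" using c by auto
    next
      fix i j j' assume *: "j < j' \<and> (i, j') \<in> cells ?\<mu>"
      then have "(i, j) \<in> cells ?\<mu>" by (auto simp: cells_def)
      then show "restrict T (cells ?\<mu>) (i, j) \<le> restrict T (cells ?\<mu>) (i, j')"
        using * c 4 by (auto simp: ssyt_def)
    next
      fix i i' j assume *: "i < i' \<and> (i', j) \<in> cells ?\<mu>"
      then have "(i, j) \<in> cells ?\<mu>" using antimonoD[OF an, of i i'] by (auto simp: cells_def)
      then show "restrict T (cells ?\<mu>) (i, j) < restrict T (cells ?\<mu>) (i', j)"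
        using * c 4 by (auto simp: ssyt_def)
    qed
    then show ?case using \<mu> by auto
  next
    case (5 p)
    then obtain \<mu> T where p: "p = (\<mu>, T)" "\<mu> \<in> interlacing m \<nu>" "T \<in> ssyt m \<mu>" by auto
    have le: "\<mu> i \<le> \<nu> i" for i using interlacing_rows_le(2)[OF \<nu> p(2)] .
    have sub: "cells \<mu> \<subseteq> cells \<nu>" using le by (auto simp: cells_def intro: less_le_trans)
    have diff: "cells \<nu> - cells \<mu> = Sigma {..m} (\<lambda>i. {\<mu> i..<\<nu> i})"
      unfolding cells_Sigma[OF \<nu>] by (auto simp: cells_def)
    have "(\<Prod>c\<in>cells \<nu>. x (fill_top m \<nu> \<mu> T c)) =
        (\<Prod>c\<in>cells \<nu> - cells \<mu>. x (fill_top m \<nu> \<mu> T c)) * (\<Prod>c\<in>cells \<mu>. x (fill_top m \<nu> \<mu> T c))"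
      by (rule prod.subset_diff[OF sub finite_cells[OF \<nu>]])
    also have "(\<Prod>c\<in>cells \<mu>. x (fill_top m \<nu> \<mu> T c)) = (\<Prod>c\<in>cells \<mu>. x (T c))"
      by (intro prod.cong) (auto simp: fill_top_def)
    also have "(\<Prod>c\<in>cells \<nu> - cells \<mu>. x (fill_top m \<nu> \<mu> T c)) = (\<Prod>c\<in>cells \<nu> - cells \<mu>. x m)"
      by (intro prod.cong) (auto simp: fill_top_def)
    also have "\<dots> = x m ^ (\<Sum>i\<le>m. \<nu> i - \<mu> i)"
      unfolding diff by simp
    finally show ?case using p by simp
  qed
  finally show ?thesis by (simp add: schur_def)
qed

text \<open>
  The determinant is linear in each row.
\<close>

lemma det_sum_rows:
  fixes g :: "nat \<Rightarrow> 'b \<Rightarrow> real"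
  assumes "\<And>i. i < m \<Longrightarrow> finite (I i)"
  shows "(\<Sum>v\<in>PiE {..<m} I. Determinant.det (mat m m (\<lambda>(i, j). g j (v i)))) =
    Determinant.det (mat m m (\<lambda>(i, j). \<Sum>u\<in>I i. g j u))"
proof -
  have D: "Determinant.det (mat m m (\<lambda>(i, j). h i j)) = (\<Sum>p | p permutes {0..<m}. signof p * (\<Prod>i<m. h i (p i)))"
    for h :: "nat \<Rightarrow> nat \<Rightarrow> real"
    by (subst det_def'[where n = m], simp, intro sum.cong refl arg_cong2[where f = "(*)"] prod.cong)
       (auto simp: permutes_less)
  have "(\<Sum>v\<in>PiE {..<m} I. Determinant.det (mat m m (\<lambda>(i, j). g j (v i)))) =
    (\<Sum>p | p permutes {0..<m}. \<Sum>v\<in>PiE {..<m} I. signof p * (\<Prod>i<m. g (p i) (v i)))"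
    unfolding D by (rule sum.swap)
  also have "\<dots> = (\<Sum>p | p permutes {0..<m}. signof p * (\<Prod>i<m. \<Sum>u\<in>I i. g (p i) u))"
  proof (rule sum.cong[OF refl])
    fix p
    have "(\<Prod>i<m. \<Sum>u\<in>I i. g (p i) u) = (\<Sum>v\<in>PiE {..<m} I. \<Prod>i<m. g (p i) (v i))"
      using assms by (intro prod_sum_PiE) auto
    then show "(\<Sum>v\<in>PiE {..<m} I. signof p * (\<Prod>i<m. g (p i) (v i))) = signof p * (\<Prod>i<m. \<Sum>u\<in>I i. g (p i) u)"
      by (simp add: sum_distrib_left)
  qed
  finally show ?thesis unfolding D .
qed

text \<open>
  Subtracting from each row the next one clears the last column up to its final entry.
\<close>

lemma det_last_column_ones:
  fixes A :: "nat \<Rightarrow> nat \<Rightarrow> real"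
  assumes ones: "\<And>i. i \<le> m \<Longrightarrow> A i m = 1"
  shows "Determinant.det (mat (Suc m) (Suc m) (\<lambda>(i, j). A i j)) =
    Determinant.det (mat m m (\<lambda>(i, j). A i j - A (Suc i) j))"
proof -
  let ?M = "mat (Suc m) (Suc m) (\<lambda>(i, j). A i j)"
  let ?L = "mat (Suc m) (Suc m) (\<lambda>(i, j). if j = i then 1 else if j = Suc i then -1 else 0 :: real)"
  let ?B = "mat (Suc m) (Suc m) (\<lambda>(i, j). if i = m then A i j else A i j - A (Suc i) j)"
  have "?L * ?M = ?B"
  proof (rule eq_matI)
    fix i j assume "i < dim_row ?B" "j < dim_col ?B"
    then have ij: "i < Suc m" "j < Suc m" by auto
    have "(?L * ?M) $$ (i, j) = (\<Sum>l<Suc m. (if l = i then 1 else if l = Suc i then -1 else 0) * A l j)"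
      using ij by (simp add: scalar_prod_def lessThan_atLeast0 del: sum.op_ivl_Suc)
    also have "\<dots> = (\<Sum>l<Suc m. (if l = i then A l j else 0) + (if l = Suc i then - A l j else 0))"
      by (intro sum.cong) auto
    also have "\<dots> = (if i = m then A i j else A i j - A (Suc i) j)"
      using ij by (simp add: sum.distrib del: sum.lessThan_Suc)
    finally show "(?L * ?M) $$ (i, j) = ?B $$ (i, j)" using ij by simp
  qed auto
  moreover have "Determinant.det ?L = 1"
    by (subst det_upper_triangular[where n = "Suc m"]) (auto simp: prod_list_diag_mat upper_triangular_def)
  ultimately have "Determinant.det ?M = Determinant.det ?B"
    using det_mult[of ?L "Suc m" ?M] by simp
  also have "\<dots> = (\<Sum>i<Suc m. ?B $$ (i, m) * cofactor ?B i m)"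
    by (rule laplace_expansion_column) auto
  also have "\<dots> = (\<Sum>i\<in>{m}. ?B $$ (i, m) * cofactor ?B i m)"
    by (rule sum.mono_neutral_right) (auto simp: ones)
  also have "\<dots> = Determinant.det (mat_delete ?B m m)"
    by (simp add: ones cofactor_def)
  also have "mat_delete ?B m m = mat m m (\<lambda>(i, j). A i j - A (Suc i) j)"
    by (rule eq_matI) (auto simp: mat_delete_def)
  finally show ?thesis .
qed

definition vander :: "nat \<Rightarrow> (nat \<Rightarrow> real) \<Rightarrow> real" where
  "vander m z = (\<Prod>j<m. \<Prod>l<j. z j - z l)"

lemma vander_det: "vander m z = Determinant.det (mat m m (\<lambda>(j, i). z j ^ i))"
proof -
  have "vander m z = Determinant.det (mat m m (\<lambda>(j, i). poly (monom 1 i) (z j)))"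
    unfolding vander_def by (rule det_monic[symmetric]) (auto simp: degree_monom_eq)
  then show ?thesis by (simp add: poly_monom)
qed

lemma power_ratio_neq_1:
  fixes q :: real
  assumes "q > 0" "q \<noteq> 1" "j < m"
  shows "q ^ j / q ^ m \<noteq> 1"
  using assms power_inject_exp'[of q j m] by auto

text \<open>
  After division by \<open>\<Prod>i. q ^ (m * v i)\<close> the Vandermonde determinant has the entries \<open>r j ^ v i\<close> with
  \<open>r j = q ^ j / q ^ m\<close>. Summing each row over its interval gives differences of powers, and these
  form a determinant with one row and one column more, whose last column is constant because
  \<open>r m = 1\<close>.
\<close>

lemma vander_interlacing_sum:
  fixes q :: real and l :: "nat \<Rightarrow> nat"
  assumes q: "q > 0" "q \<noteq> 1" and l: "\<And>i. i < m \<Longrightarrow> l (Suc i) \<le> l i"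
  shows "(\<Sum>v\<in>PiE {..<m} (\<lambda>i. {l (Suc i)..<l i}). vander m (\<lambda>i. q ^ v i) / (\<Prod>i<m. q ^ (m * v i))) =
    vander (Suc m) (\<lambda>i. q ^ l i) / (\<Prod>i<Suc m. q ^ (m * l i)) * (\<Prod>j<m. 1 / (q ^ j / q ^ m - 1))"
proof -
  define r where "r = (\<lambda>j. q ^ j / q ^ m)"
  have rm: "r m = 1" using q by (simp add: r_def)
  have rj: "r j \<noteq> 1" if "j < m" for j
    unfolding r_def by (rule power_ratio_neq_1[OF q that])
  have row: "vander k (\<lambda>i. q ^ v i) / (\<Prod>i<k. q ^ (m * v i)) = Determinant.det (mat k k (\<lambda>(i, j). r j ^ v i))" for k v
  proof -
    have "Determinant.det (mat k k (\<lambda>(i, j). r j ^ v i)) =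
        Determinant.det (mat k k (\<lambda>(i, j). (1 / q ^ (m * v i)) * 1 * (q ^ v i) ^ j))"
      by (rule arg_cong[where f = Determinant.det], rule cong_mat)
         (auto simp: r_def power_divide mult.commute simp flip: power_mult)
    also have "\<dots> = (\<Prod>i<k. 1 / q ^ (m * v i)) * Determinant.det (mat k k (\<lambda>(i, j). (q ^ v i) ^ j))"
      by (subst det_scale) simp
    finally show ?thesis by (simp add: vander_det prod_dividef)
  qed
  have geo: "(\<Sum>u\<in>{l (Suc i)..<l i}. r j ^ u) = 1 * (1 / (r j - 1)) * (r j ^ l i - r j ^ l (Suc i))" if "i < m" "j < m" for i j
  proof -
    have "(r j - 1) * (\<Sum>u\<in>{l (Suc i)..<l i}. r j ^ u) = (\<Sum>u\<in>{l (Suc i)..<l i}. r j ^ Suc u - r j ^ u)"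
      by (simp add: sum_distrib_left algebra_simps)
    also have "\<dots> = r j ^ l i - r j ^ l (Suc i)"
      using l[OF that(1)] by (rule sum_Suc_diff')
    finally show ?thesis using rj[OF that(2)] by (simp add: field_simps)
  qed
  have "(\<Sum>v\<in>PiE {..<m} (\<lambda>i. {l (Suc i)..<l i}). vander m (\<lambda>i. q ^ v i) / (\<Prod>i<m. q ^ (m * v i))) =
      Determinant.det (mat m m (\<lambda>(i, j). \<Sum>u\<in>{l (Suc i)..<l i}. r j ^ u))"
    unfolding row by (rule det_sum_rows[where g = "\<lambda>j u. r j ^ u"]) auto
  also have "\<dots> = Determinant.det (mat m m (\<lambda>(i, j). 1 * (1 / (r j - 1)) * (r j ^ l i - r j ^ l (Suc i))))"
    by (rule arg_cong[where f = Determinant.det], rule cong_mat) (auto simp: geo)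
  also have "\<dots> = (\<Prod>j<m. 1 / (r j - 1)) * Determinant.det (mat m m (\<lambda>(i, j). r j ^ l i - r j ^ l (Suc i)))"
    by (subst det_scale) simp
  also have "Determinant.det (mat m m (\<lambda>(i, j). r j ^ l i - r j ^ l (Suc i))) =
      Determinant.det (mat (Suc m) (Suc m) (\<lambda>(i, j). r j ^ l i))"
    by (rule det_last_column_ones[symmetric]) (simp add: rm)
  also have "\<dots> = vander (Suc m) (\<lambda>i. q ^ l i) / (\<Prod>i<Suc m. q ^ (m * l i))"
    by (rule row[symmetric])
  finally show ?thesis by (simp add: r_def mult_ac)
qed

text \<open>
  Induction by the branching rule. In terms of the shifted parts \<open>\<nu> i + m - 1 - i\<close>, interlacing
  means that each new part ranges over an interval independently of the others, so that the
  preceding sum applies. A probability measure is known once it is known up to a constant, hence no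
  value of the constant is recorded.
\<close>

lemma schur_principal:
  fixes q :: real
  assumes q: "q > 0" "q \<noteq> 1"
  shows "\<exists>c. c \<noteq> 0 \<and> (\<forall>\<nu>\<in>rows_le m. schur m (\<lambda>i. q ^ i) \<nu> = c * vander m (\<lambda>i. q ^ (\<nu> i + m - Suc i)))"
proof (induction m)
  case 0
  have "schur 0 (\<lambda>i. q ^ i) \<nu> = 1" if "\<nu> \<in> rows_le 0" for \<nu>
  proof -
    have "cells \<nu> = {}" using that by (auto simp: cells_def rows_le_def)
    then show ?thesis by (simp add: schur_def ssyt_def)
  qed
  then show ?case by (intro exI[of _ 1]) (auto simp: vander_def)
next
  case (Suc m)
  then obtain c where c: "c \<noteq> 0" and IH: "\<And>\<nu>. \<nu> \<in> rows_le m \<Longrightarrow> schur m (\<lambda>i. q ^ i) \<nu> = c * vander m (\<lambda>i. q ^ (\<nu> i + m - Suc i))"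
    by auto
  \<comment> \<open>Total shifts of the parts in \<open>m\<close> and \<open>m + 1\<close> rows; they only enter the constant.\<close>
  define e where "e = (\<Sum>i<m. m - Suc i)"
  define e' where "e' = (\<Sum>i<Suc m. m - i)"
  define P where "P = (\<Prod>j<m. 1 / (q ^ j / q ^ m - 1))"
  have P: "P \<noteq> 0"
  proof -
    have "1 / (q ^ j / q ^ m - 1) \<noteq> 0" if "j < m" for j
      using power_ratio_neq_1[OF q that] by simp
    then show ?thesis unfolding P_def prod_zero_iff[OF finite_lessThan] by blast
  qed
  show ?case
  proof (intro exI[of _ "c * q ^ (m * e) / q ^ (m * e') * P"] conjI ballI)
    show "c * q ^ (m * e) / q ^ (m * e') * P \<noteq> 0" using c P q by simp
    fix \<nu> assume \<nu>: "\<nu> \<in> rows_le (Suc m)"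
    define l where "l = (\<lambda>i. \<nu> i + m - i)"
    have an: "\<nu> (Suc i) \<le> \<nu> i" for i using \<nu> by (auto simp: rows_le_def intro: antimonoD)
    have l: "l (Suc i) \<le> l i" if "i < m" for i using an[of i] that by (simp add: l_def)
    have "schur (Suc m) (\<lambda>i. q ^ i) \<nu> = (\<Sum>\<mu>\<in>interlacing m \<nu>. (q ^ m) ^ (\<Sum>i\<le>m. \<nu> i - \<mu> i) * schur m (\<lambda>i. q ^ i) \<mu>)"
      by (rule schur_branching[OF \<nu>])
    also have "\<dots> = (\<Sum>v\<in>PiE {..<m} (\<lambda>i. {l (Suc i)..<l i}).
        c * q ^ (m * e) * q ^ (m * (\<Sum>i\<le>m. \<nu> i)) * (vander m (\<lambda>i. q ^ v i) / (\<Prod>i<m. q ^ (m * v i))))"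
    proof (rule sum.reindex_bij_witness[where
          j = "\<lambda>\<mu>. restrict (\<lambda>i. \<mu> i + m - Suc i) {..<m}" and
          i = "\<lambda>v i. if i < m then v i - (m - Suc i) else 0"], goal_cases)
      case (1 \<mu>)
      then show ?case by (auto simp: fun_eq_iff interlacing_def)
    next
      case (2 \<mu>)
      have "\<mu> i + m - Suc i \<in> {l (Suc i)..<l i}" if "i < m" for i
      proof -
        have "\<nu> (Suc i) \<le> \<mu> i" "\<mu> i \<le> \<nu> i" using 2 that by (auto simp: interlacing_def)
        then show ?thesis using that by (auto simp: l_def)
      qed
      then show ?case by (auto simp: PiE_iff)
    next
      case (3 v)
      have "v i - (m - Suc i) + m - Suc i = v i" if "i < m" for i
      proof -
        have "l (Suc i) \<le> v i" using 3 that by (auto simp: PiE_iff)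
        then have "m - Suc i \<le> v i" by (simp add: l_def)
        then show ?thesis using that by simp
      qed
      then show ?case using 3 by (auto simp: fun_eq_iff PiE_iff extensional_def)
    next
      case (4 v)
      have "\<nu> (Suc i) \<le> v i - (m - Suc i) \<and> v i - (m - Suc i) \<le> \<nu> i" if "i < m" for i
      proof -
        have "l (Suc i) \<le> v i" "v i < l i" using 4 that by (auto simp: PiE_iff)
        then show ?thesis using that by (auto simp: l_def)
      qed
      then show ?case by (auto simp: interlacing_def)
    next
      case (5 \<mu>)
      have \<mu>: "\<mu> \<in> rows_le m" and le: "\<mu> i \<le> \<nu> i" for i
        using interlacing_rows_le[OF \<nu> 5] by auto
      let ?v = "restrict (\<lambda>i. \<mu> i + m - Suc i) {..<m}"
      have "(\<Sum>i<m. ?v i) = (\<Sum>i<m. \<mu> i + (m - Suc i))" by (intro sum.cong) auto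
      then have sv: "(\<Sum>i<m. ?v i) = (\<Sum>i<m. \<mu> i) + e" unfolding e_def by (simp only: sum.distrib)
      have "(\<Sum>i\<le>m. \<nu> i - \<mu> i) = (\<Sum>i\<le>m. \<nu> i) - (\<Sum>i\<le>m. \<mu> i)"
        using le by (intro sum_subtractf_nat) auto
      moreover have "(\<Sum>i\<le>m. \<mu> i) = (\<Sum>i<m. \<mu> i)"
        using \<mu> by (simp add: rows_le_def lessThan_Suc_atMost[symmetric])
      moreover have "(\<Sum>i\<le>m. \<mu> i) \<le> (\<Sum>i\<le>m. \<nu> i)" using le by (intro sum_mono) auto
      ultimately have "(\<Sum>i\<le>m. \<nu> i - \<mu> i) + (\<Sum>i<m. ?v i) = (\<Sum>i\<le>m. \<nu> i) + e" using sv by simp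
      then have "(q ^ m) ^ (\<Sum>i\<le>m. \<nu> i - \<mu> i) * (q ^ m) ^ (\<Sum>i<m. ?v i) = (q ^ m) ^ (\<Sum>i\<le>m. \<nu> i) * (q ^ m) ^ e"
        by (simp flip: power_add)
      then have "(q ^ m) ^ (\<Sum>i\<le>m. \<nu> i - \<mu> i) = q ^ (m * e) * q ^ (m * (\<Sum>i\<le>m. \<nu> i)) / (q ^ m) ^ (\<Sum>i<m. ?v i)"
        using q by (simp add: field_simps flip: power_mult)
      also have "(q ^ m) ^ (\<Sum>i<m. ?v i) = (\<Prod>i<m. q ^ (m * ?v i))"
        by (simp add: power_sum power_mult)
      finally have pw: "(q ^ m) ^ (\<Sum>i\<le>m. \<nu> i - \<mu> i) = q ^ (m * e) * q ^ (m * (\<Sum>i\<le>m. \<nu> i)) / (\<Prod>i<m. q ^ (m * ?v i))" .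
      have vd: "vander m (\<lambda>i. q ^ (\<mu> i + m - Suc i)) = vander m (\<lambda>i. q ^ ?v i)"
        unfolding vander_def by (intro prod.cong refl) auto
      show ?case unfolding IH[OF \<mu>] pw vd by (simp add: mult_ac)
    qed
    also have "\<dots> = c * q ^ (m * e) * q ^ (m * (\<Sum>i\<le>m. \<nu> i)) *
        (vander (Suc m) (\<lambda>i. q ^ l i) / (\<Prod>i<Suc m. q ^ (m * l i)) * P)"
      unfolding sum_distrib_left[symmetric] P_def using vander_interlacing_sum[OF q, of m l] l by simp
    also have "(\<Prod>i<Suc m. q ^ (m * l i)) = q ^ (m * (\<Sum>i\<le>m. \<nu> i)) * q ^ (m * e')"
    proof -
      have "(\<Sum>i<Suc m. l i) = (\<Sum>i<Suc m. \<nu> i + (m - i))" by (intro sum.cong) (auto simp: l_def)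
      then have "(\<Sum>i<Suc m. l i) = (\<Sum>i\<le>m. \<nu> i) + e'" by (simp only: sum.distrib e'_def lessThan_Suc_atMost)
      moreover have "(\<Prod>i<Suc m. q ^ (m * l i)) = (q ^ m) ^ (\<Sum>i<Suc m. l i)"
        by (simp only: power_sum power_mult)
      ultimately show ?thesis by (simp add: power_add power_mult)
    qed
    also have "c * q ^ (m * e) * q ^ (m * (\<Sum>i\<le>m. \<nu> i)) *
        (vander (Suc m) (\<lambda>i. q ^ l i) / (q ^ (m * (\<Sum>i\<le>m. \<nu> i)) * q ^ (m * e')) * P) =
        c * q ^ (m * e) / q ^ (m * e') * P * vander (Suc m) (\<lambda>i. q ^ l i)"
      using q by simp
    finally show "schur (Suc m) (\<lambda>i. q ^ i) \<nu> = c * q ^ (m * e) / q ^ (m * e') * P * vander (Suc m) (\<lambda>i. q ^ (\<nu> i + Suc m - Suc i))"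
      by (simp add: l_def)
  qed
qed

lemma schur_nonneg: "(\<And>i. x i \<ge> 0) \<Longrightarrow> schur m x \<nu> \<ge> 0"
  unfolding schur_def by (intro sum_nonneg prod_nonneg) auto

lemma schur_principal_abs:
  fixes q :: real
  assumes q: "q > 0" "q \<noteq> 1"
  shows "\<exists>c>0. \<forall>\<nu>\<in>rows_le m. schur m (\<lambda>i. q ^ i) \<nu> = c * \<bar>vander m (\<lambda>i. q ^ (\<nu> i + m - Suc i))\<bar>"
proof -
  obtain c where c: "c \<noteq> 0" "\<And>\<nu>. \<nu> \<in> rows_le m \<Longrightarrow> schur m (\<lambda>i. q ^ i) \<nu> = c * vander m (\<lambda>i. q ^ (\<nu> i + m - Suc i))"
    using schur_principal[OF q, of m] by auto
  have "schur m (\<lambda>i. q ^ i) \<nu> = \<bar>c\<bar> * \<bar>vander m (\<lambda>i. q ^ (\<nu> i + m - Suc i))\<bar>" if "\<nu> \<in> rows_le m" for \<nu>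
    using c(2)[OF that] schur_nonneg[of "\<lambda>i. q ^ i" m \<nu>] q by (simp flip: abs_mult)
  then show ?thesis using c(1) by (intro exI[of _ "\<bar>c\<bar>"]) auto
qed

section \<open>Diagrams as point configurations\<close>

definition particles :: "nat \<Rightarrow> (nat \<Rightarrow> nat) \<Rightarrow> nat set" where
  "particles n \<nu> = (\<lambda>i. \<nu> i + n - Suc i) ` {..<n}"

lemma rows_le_strict:
  assumes "antimono \<nu>" "i < i'" "i' < n"
  shows "\<nu> i' + n - Suc i' < \<nu> i + n - Suc i"
proof -
  have "\<nu> i' \<le> \<nu> i" using assms by (intro antimonoD[OF assms(1)]) auto
  then show ?thesis using assms by linarith
qed

lemma particle_inj: "antimono \<nu> \<Longrightarrow> inj_on (\<lambda>i. \<nu> i + n - Suc i) {..<n}"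
proof (rule inj_onI, rule ccontr)
  fix i i' assume a: "antimono \<nu>" "i \<in> {..<n}" "i' \<in> {..<n}" "\<nu> i + n - Suc i = \<nu> i' + n - Suc i'" "i \<noteq> i'"
  then show False using rows_le_strict[OF a(1), of i i' n] rows_le_strict[OF a(1), of i' i n] by (cases "i < i'") auto
qed

lemma particles_ens:
  assumes "\<nu> \<in> young_box n k"
  shows "particles n \<nu> \<subseteq> {..<n + k}" "card (particles n \<nu>) = n"
proof -
  show "particles n \<nu> \<subseteq> {..<n + k}"
  proof
    fix m assume "m \<in> particles n \<nu>"
    then obtain i where i: "i < n" "m = \<nu> i + n - Suc i" by (auto simp: particles_def)
    moreover have "\<nu> i \<le> k" using assms by (simp add: young_box_def)
    ultimately show "m \<in> {..<n + k}" by auto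
  qed
  show "card (particles n \<nu>) = n"
    unfolding particles_def using assms by (subst card_image) (auto simp: young_box_def intro!: particle_inj)
qed

text \<open>
  The sorted enumeration of the particles determines them from the bottom row upwards; it is used to
  show that distinct diagrams have distinct particle sets.
\<close>

lemma particles_list:
  assumes "antimono \<nu>"
  shows "sorted_wrt (<) (map (\<lambda>j. \<nu> (n - Suc j) + j) [0..<n])"
    and "set (map (\<lambda>j. \<nu> (n - Suc j) + j) [0..<n]) = particles n \<nu>"
proof -
  show "sorted_wrt (<) (map (\<lambda>j. \<nu> (n - Suc j) + j) [0..<n])"
    unfolding sorted_wrt_iff_nth_less
  proof (intro allI impI)
    fix i j assume "i < j" "j < length (map (\<lambda>j. \<nu> (n - Suc j) + j) [0..<n])"
    moreover from this have "\<nu> (n - Suc i) \<le> \<nu> (n - Suc j)" by (intro antimonoD[OF assms]) auto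
    ultimately show "map (\<lambda>j. \<nu> (n - Suc j) + j) [0..<n] ! i < map (\<lambda>j. \<nu> (n - Suc j) + j) [0..<n] ! j"
      by simp
  qed
  show "set (map (\<lambda>j. \<nu> (n - Suc j) + j) [0..<n]) = particles n \<nu>"
  proof -
    have "(\<lambda>j. \<nu> (n - Suc j) + j) ` {..<n} = (\<lambda>i. \<nu> i + n - Suc i) ` {..<n}"
    proof (intro equalityI subsetI)
      fix m assume "m \<in> (\<lambda>j. \<nu> (n - Suc j) + j) ` {..<n}"
      then obtain j where "j < n" "m = \<nu> (n - Suc j) + j" by auto
      then show "m \<in> (\<lambda>i. \<nu> i + n - Suc i) ` {..<n}" by (intro image_eqI[of _ _ "n - Suc j"]) auto
    next
      fix m assume "m \<in> (\<lambda>i. \<nu> i + n - Suc i) ` {..<n}"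
      then obtain i where "i < n" "m = \<nu> i + n - Suc i" by auto
      then show "m \<in> (\<lambda>j. \<nu> (n - Suc j) + j) ` {..<n}" by (intro image_eqI[of _ _ "n - Suc i"]) auto
    qed
    then show ?thesis by (simp add: particles_def lessThan_atLeast0)
  qed
qed

lemma particles_bij: "bij_betw (particles n) (young_box n k) {S. S \<subseteq> {..<n + k} \<and> card S = n}"
proof (rule bij_betw_imageI)
  show "inj_on (particles n) (young_box n k)"
  proof (rule inj_onI)
    fix \<nu> \<nu>' assume \<nu>: "\<nu> \<in> young_box n k" "\<nu>' \<in> young_box n k" "particles n \<nu> = particles n \<nu>'"
    then have an: "antimono \<nu>" "antimono \<nu>'" by (auto simp: young_box_def)
    have "map (\<lambda>j. \<nu> (n - Suc j) + j) [0..<n] = map (\<lambda>j. \<nu>' (n - Suc j) + j) [0..<n]"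
      by (rule strict_sorted_equal[OF particles_list(1)[OF an(2)] particles_list(1)[OF an(1)]])
         (use \<nu>(3) particles_list(2)[OF an(1)] particles_list(2)[OF an(2)] in simp)
    then have eq: "\<nu> (n - Suc j) = \<nu>' (n - Suc j)" if "j < n" for j using that by (auto simp: map_eq_conv)
    have "\<nu> i = \<nu>' i" for i
    proof (cases "i < n")
      case True
      then show ?thesis using eq[of "n - Suc i"] by simp
    next
      case False
      then show ?thesis using \<nu> by (simp add: young_box_def)
    qed
    then show "\<nu> = \<nu>'" by (rule ext)
  qed
  show "particles n ` young_box n k = {S. S \<subseteq> {..<n + k} \<and> card S = n}"
  proof (intro equalityI subsetI)
    fix S assume "S \<in> {S. S \<subseteq> {..<n + k} \<and> card S = n}"
    then have S: "S \<subseteq> {..<n + k}" "card S = n" and fin: "finite S" by (auto intro: finite_subset)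
    define xs where "xs = sorted_list_of_set S"
    have xs: "sorted_wrt (<) xs" "set xs = S" "length xs = n"
      using fin S by (auto simp: xs_def strict_sorted_list_of_set)
    \<comment> \<open>The row length of the \<open>j\<close>-th particle from below; integers, because nonnegativity is proved later.\<close>
    define h where "h = (\<lambda>j. int (xs ! j) - int j)"
    have h_mono: "h i \<le> h j" if "i \<le> j" "j < n" for i j
      using that
    proof (induction j)
      case (Suc j)
      show ?case
      proof (cases "i = Suc j")
        case False
        have "xs ! j < xs ! Suc j" using xs Suc.prems by (auto simp: sorted_wrt_iff_nth_less)
        then have "h j \<le> h (Suc j)" by (simp add: h_def)
        then show ?thesis using Suc False by auto
      qed simp
    qed simp
    have h0: "0 \<le> h j" if "j < n" for j
      using h_mono[of 0 j] that by (simp add: h_def)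
    have hk: "h j \<le> int k" if "j < n" for j
    proof -
      have "xs ! (n - 1) \<in> S" using xs(3) that nth_mem[of "n - 1" xs] unfolding xs(2) by simp
      then have "xs ! (n - 1) < n + k" using S by auto
      then have "h (n - 1) \<le> int k" using that by (simp add: h_def of_nat_diff)
      moreover have "h j \<le> h (n - 1)" using that by (intro h_mono) auto
      ultimately show ?thesis by simp
    qed
    define \<nu> where "\<nu> = (\<lambda>i. if i < n then nat (h (n - Suc i)) else 0)"
    have "antimono \<nu>"
      unfolding decseq_Suc_iff
    proof
      fix i show "\<nu> (Suc i) \<le> \<nu> i"
        using h_mono[of "n - Suc (Suc i)" "n - Suc i"] by (auto simp: \<nu>_def intro!: nat_mono)
    qed
    moreover have "\<nu> i \<le> k" for i
      using hk[of "n - Suc i"] by (auto simp: \<nu>_def)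
    ultimately have \<nu>: "\<nu> \<in> young_box n k" by (simp add: young_box_def \<nu>_def)
    have "map (\<lambda>j. \<nu> (n - Suc j) + j) [0..<n] = xs"
    proof (rule nth_equalityI)
      fix j assume "j < length (map (\<lambda>j. \<nu> (n - Suc j) + j) [0..<n])"
      then have j: "j < n" by simp
      then have "\<nu> (n - Suc j) = nat (h j)" by (simp add: \<nu>_def)
      moreover have "int (nat (h j)) = h j" using h0[OF j] by simp
      ultimately have "int (\<nu> (n - Suc j) + j) = int (xs ! j)" by (simp add: h_def)
      then have "\<nu> (n - Suc j) + j = xs ! j" by (simp only: of_nat_eq_iff)
      then show "map (\<lambda>j. \<nu> (n - Suc j) + j) [0..<n] ! j = xs ! j" using j by simp
    qed (simp add: xs)
    then have "particles n \<nu> = S"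
      using particles_list(2)[OF \<open>antimono \<nu>\<close>, of n] xs(2) by simp
    then show "S \<in> particles n ` young_box n k" using \<nu> by blast
  qed (use particles_ens in blast)
qed

lemma finite_young_box: "finite (young_box n k)"
proof -
  have "finite {S. S \<subseteq> {..<n + k} \<and> card S = n}" by (rule finite_subset[of _ "Pow {..<n + k}"]) auto
  then show ?thesis using bij_betw_finite[OF particles_bij] by blast
qed

lemma young_box_rows_le: "\<nu> \<in> young_box n k \<Longrightarrow> \<nu> \<in> rows_le n"
  by (simp add: young_box_def rows_le_def)

lemma conjugate_complement:
  "Defs.conjugate (box_complement n k \<nu>) j = card {i. i < n \<and> \<nu> i + j < k}"
proof -
  have "bij_betw (\<lambda>i. n - Suc i) {i. j < box_complement n k \<nu> i} {i. i < n \<and> \<nu> i + j < k}"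
    by (rule bij_betwI[where g = "\<lambda>i. n - Suc i"]) (auto simp: box_complement_def split: if_splits)
  then show ?thesis unfolding Defs.conjugate_def by (rule bij_betw_same_card)
qed

lemma conjugate_complement_rows_le: "Defs.conjugate (box_complement n k \<nu>) \<in> rows_le k"
  unfolding rows_le_def conjugate_complement
  by (auto intro!: antimonoI card_mono)

text \<open>
  Particle-hole duality. Whether the cell \<open>(i, k - 1 - j)\<close> belongs to the diagram decides which of
  the particle of row \<open>i\<close> and the hole of column \<open>j\<close> is larger, so they never coincide; and the
  cardinalities add up to \<open>n + k\<close>.
\<close>

lemma holes:
  assumes \<nu>: "\<nu> \<in> young_box n k"
  shows "particles k (Defs.conjugate (box_complement n k \<nu>)) = {..<n + k} - particles n \<nu>"
proof -
  let ?c = "Defs.conjugate (box_complement n k \<nu>)"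
  have an: "antimono \<nu>" using \<nu> by (simp add: young_box_def)
  have anc: "antimono ?c" using conjugate_complement_rows_le by (simp add: rows_le_def)
  have cn: "?c j \<le> n" for j
  proof -
    have "?c j \<le> card {..<n}" unfolding conjugate_complement by (rule card_mono) auto
    then show ?thesis by simp
  qed
  have "?c \<in> young_box k n"
    using conjugate_complement_rows_le[of n k \<nu>] cn by (simp add: young_box_def rows_le_def)
  note c = particles_ens[OF this]
  have key: "i < n - ?c j \<longleftrightarrow> k \<le> \<nu> i + j" if "i < n" for i j
  proof -
    have "i < card {i. i < n \<and> k \<le> \<nu> i + j} \<longleftrightarrow> i < n \<and> k \<le> \<nu> i + j"
    proof (rule initial_segment_card)
      fix i i' assume "i < i'" "k \<le> \<nu> i' + j"
      then show "k \<le> \<nu> i + j" using antimonoD[OF an, of i i'] by simp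
    qed
    moreover have "card {i. i < n \<and> k \<le> \<nu> i + j} = n - ?c j"
    proof -
      have "{i. i < n \<and> k \<le> \<nu> i + j} = {..<n} - {i. i < n \<and> \<nu> i + j < k}" by auto
      moreover have "card ({..<n} - {i. i < n \<and> \<nu> i + j < k}) = card {..<n} - card {i. i < n \<and> \<nu> i + j < k}"
        by (rule card_Diff_subset) auto
      ultimately show ?thesis unfolding conjugate_complement by simp
    qed
    ultimately show ?thesis using that by simp
  qed
  have "particles k ?c \<inter> particles n \<nu> = {}"
  proof (rule ccontr)
    assume "particles k ?c \<inter> particles n \<nu> \<noteq> {}"
    then obtain i j where ij: "i < n" "j < k" "?c j + k - Suc j = \<nu> i + n - Suc i"
      by (auto simp: particles_def)
    show False
    proof (cases "k \<le> \<nu> i + j")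
      case True
      then have "i < n - ?c j" using key ij by simp
      then show False using ij True by linarith
    next
      case False
      then have "n - ?c j \<le> i" using key[of i j] ij by simp
      then show False using ij False cn[of j] by linarith
    qed
  qed
  then have sub: "particles k ?c \<subseteq> {..<n + k} - particles n \<nu>" using c by (auto simp: add.commute)
  have "card ({..<n + k} - particles n \<nu>) = k"
    using particles_ens[OF \<nu>] by (subst card_Diff_subset) (auto intro: finite_subset)
  then show ?thesis using sub c by (intro card_subset_eq) auto
qed

text \<open>
  The squared Vandermonde product, independent of an enumeration.
\<close>

definition gaps :: "(nat \<Rightarrow> real) \<Rightarrow> nat set \<Rightarrow> real" where
  "gaps z S = (\<Prod>m\<in>S. \<Prod>m'\<in>S - {m}. \<bar>z m - z m'\<bar>)"

lemma gaps_nonneg: "gaps z S \<ge> 0"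
  unfolding gaps_def by (intro prod_nonneg) auto

lemma vander_gaps:
  assumes "inj_on y {..<n}"
  shows "\<bar>vander n (\<lambda>i. z (y i))\<bar> = sqrt (gaps z (y ` {..<n}))"
proof -
  have "gaps z (y ` {..<n}) = (\<Prod>j<n. \<Prod>l\<in>{..<n} - {j}. \<bar>z (y j) - z (y l)\<bar>)"
  proof -
    have "(\<Prod>m\<in>y ` {..<n} - {y j}. \<bar>z (y j) - z m\<bar>) = (\<Prod>l\<in>{..<n} - {j}. \<bar>z (y j) - z (y l)\<bar>)"
      if "j < n" for j
    proof -
      have "y ` {..<n} - {y j} = y ` ({..<n} - {j})"
        using assms that by (auto simp: inj_on_def)
      then show ?thesis using assms by (simp add: prod.reindex inj_on_diff)
    qed
    then show ?thesis unfolding gaps_def using assms by (simp add: prod.reindex)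
  qed
  also have "\<dots> = (\<Prod>j<n. \<Prod>l<j. \<bar>z (y j) - z (y l)\<bar>)\<^sup>2"
    by (rule prod_offdiag_square) (simp add: abs_minus_commute)
  also have "(\<Prod>j<n. \<Prod>l<j. \<bar>z (y j) - z (y l)\<bar>) = \<bar>vander n (\<lambda>i. z (y i))\<bar>"
    by (simp add: vander_def abs_prod)
  finally show ?thesis by simp
qed

lemma gaps_inverse:
  assumes fin: "finite S" and z: "\<And>m. m \<in> S \<Longrightarrow> z m > 0"
  shows "gaps (\<lambda>m. inverse (z m)) S = gaps z S / (\<Prod>m\<in>S. z m ^ (card S - 1))\<^sup>2"
proof -
  have "(\<Prod>m'\<in>S - {m}. \<bar>inverse (z m) - inverse (z m')\<bar>) =
      (\<Prod>m'\<in>S - {m}. \<bar>z m - z m'\<bar>) / (z m ^ (card S - 1) * (\<Prod>m'\<in>S - {m}. z m'))" if m: "m \<in> S" for m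
  proof -
    have "(\<Prod>m'\<in>S - {m}. \<bar>inverse (z m) - inverse (z m')\<bar>) = (\<Prod>m'\<in>S - {m}. \<bar>z m - z m'\<bar> / (z m * z m'))"
    proof (rule prod.cong[OF refl])
      fix m' assume m': "m' \<in> S - {m}"
      have p: "z m > 0" "z m' > 0" using z m m' by auto
      then have "inverse (z m) - inverse (z m') = (z m' - z m) / (z m * z m')" by (simp add: field_simps)
      then show "\<bar>inverse (z m) - inverse (z m')\<bar> = \<bar>z m - z m'\<bar> / (z m * z m')"
        using p by (simp add: abs_mult abs_minus_commute)
    qed
    also have "\<dots> = (\<Prod>m'\<in>S - {m}. \<bar>z m - z m'\<bar>) / (z m ^ (card S - 1) * (\<Prod>m'\<in>S - {m}. z m'))"
      using m fin by (simp add: prod_dividef prod.distrib)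
    finally show ?thesis .
  qed
  then have "gaps (\<lambda>m. inverse (z m)) S = gaps z S / ((\<Prod>m\<in>S. z m ^ (card S - 1)) * (\<Prod>m\<in>S. \<Prod>m'\<in>S - {m}. z m'))"
    unfolding gaps_def by (simp add: prod_dividef prod.distrib cong: prod.cong)
  also have "(\<Prod>m\<in>S. \<Prod>m'\<in>S - {m}. z m') = (\<Prod>m\<in>S. z m ^ (card S - 1))"
  proof -
    have "(\<Prod>m\<in>S. \<Prod>m'\<in>S - {m}. z m') = (\<Prod>m\<in>S. \<Prod>m'\<in>{m'\<in>S. m' \<noteq> m}. z m')"
      by (intro prod.cong) auto
    also have "\<dots> = (\<Prod>m'\<in>S. \<Prod>m\<in>{m\<in>S. m' \<noteq> m}. z m')"
      by (rule prod.swap_restrict[OF fin fin])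
    also have "\<dots> = (\<Prod>m'\<in>S. z m' ^ (card S - 1))"
    proof (rule prod.cong[OF refl])
      fix m' assume "m' \<in> S"
      moreover have "{m\<in>S. m' \<noteq> m} = S - {m'}" by auto
      ultimately show "(\<Prod>m\<in>{m\<in>S. m' \<noteq> m}. z m') = z m' ^ (card S - 1)" using fin by simp
    qed
    finally show ?thesis .
  qed
  finally show ?thesis by (simp add: power2_eq_square)
qed

text \<open>
  Splitting the product over all pairs of \<open>X\<close> into pairs within \<open>A\<close>, pairs within the complement and
  mixed pairs expresses the product over the complement by data of \<open>A\<close> alone.
\<close>

lemma gaps_complement:
  assumes fin: "finite X" and A: "A \<subseteq> X" and inj: "inj_on z X"
  shows "gaps z A * gaps z (X - A) = gaps z X * (gaps z A / (\<Prod>m\<in>A. \<Prod>m'\<in>X - {m}. \<bar>z m - z m'\<bar>))\<^sup>2"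
proof -
  let ?B = "X - A"
  have finAB: "finite A" "finite ?B" using fin A by (auto intro: finite_subset)
  let ?C = "\<Prod>m\<in>A. \<Prod>m'\<in>?B. \<bar>z m - z m'\<bar>"
  have split: "(\<Prod>m'\<in>X - {m}. \<bar>z m - z m'\<bar>) = (\<Prod>m'\<in>A - {m}. \<bar>z m - z m'\<bar>) * (\<Prod>m'\<in>?B - {m}. \<bar>z m - z m'\<bar>)" for m
  proof -
    have "X - {m} = (A - {m}) \<union> (?B - {m})" using A by auto
    then show ?thesis using finAB by (simp only:) (rule prod.union_disjoint, auto)
  qed
  have W: "(\<Prod>m\<in>A. \<Prod>m'\<in>X - {m}. \<bar>z m - z m'\<bar>) = gaps z A * ?C"
  proof -
    have "(\<Prod>m'\<in>?B - {m}. \<bar>z m - z m'\<bar>) = (\<Prod>m'\<in>?B. \<bar>z m - z m'\<bar>)" if "m \<in> A" for m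
      using that by (intro prod.cong) auto
    then show ?thesis unfolding split gaps_def by (simp add: prod.distrib)
  qed
  have WB: "(\<Prod>m\<in>?B. \<Prod>m'\<in>X - {m}. \<bar>z m - z m'\<bar>) = gaps z ?B * ?C"
  proof -
    have "(\<Prod>m'\<in>A - {m}. \<bar>z m - z m'\<bar>) = (\<Prod>m'\<in>A. \<bar>z m - z m'\<bar>)" if "m \<in> ?B" for m
      using that by (intro prod.cong) auto
    then have "(\<Prod>m\<in>?B. \<Prod>m'\<in>X - {m}. \<bar>z m - z m'\<bar>) = (\<Prod>m\<in>?B. \<Prod>m'\<in>A. \<bar>z m - z m'\<bar>) * gaps z ?B"
      unfolding split gaps_def by (simp add: prod.distrib)
    also have "(\<Prod>m\<in>?B. \<Prod>m'\<in>A. \<bar>z m - z m'\<bar>) = ?C"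
      by (subst prod.swap) (simp add: abs_minus_commute)
    finally show ?thesis by (simp add: mult.commute)
  qed
  have "gaps z X = (\<Prod>m\<in>A. \<Prod>m'\<in>X - {m}. \<bar>z m - z m'\<bar>) * (\<Prod>m\<in>?B. \<Prod>m'\<in>X - {m}. \<bar>z m - z m'\<bar>)"
    unfolding gaps_def using prod.subset_diff[OF A fin] by (simp add: mult.commute)
  then have T: "gaps z X = gaps z A * gaps z ?B * ?C\<^sup>2" unfolding W WB by (simp add: power2_eq_square)
  have "?C \<noteq> 0" "gaps z A \<noteq> 0"
    using inj A finAB unfolding gaps_def by (auto simp: inj_on_def)
  then show ?thesis unfolding W T by (simp add: power2_eq_square field_simps)
qed

text \<open>
  The one-particle weight of both measures: \<open>e = k - 1\<close> for the specialisation in \<open>q\<close> and \<open>q\<close>,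
  \<open>e = 0\<close> for the one in \<open>q\<close> and \<open>1 / q\<close>. The denominator comes from the inversion of the nodes and
  from the complementary product.
\<close>

definition schur_weight :: "nat \<Rightarrow> nat \<Rightarrow> real \<Rightarrow> nat \<Rightarrow> nat \<Rightarrow> real" where
  "schur_weight N n Q e m = (Q ^ m) ^ e / ((Q ^ m) ^ (n - 1) * (\<Prod>m'\<in>{..<N} - {m}. \<bar>Q ^ m - Q ^ m'\<bar>))"

lemma power_inj_real: "(Q :: real) > 0 \<Longrightarrow> Q \<noteq> 1 \<Longrightarrow> inj_on (\<lambda>m. Q ^ m) X"
  using power_inject_exp' by (auto simp: inj_on_def)

lemma node_weight_q:
  assumes Q: "Q > 0" "Q \<noteq> 1"
  shows "node_weight N (\<lambda>m. Q ^ m) (schur_weight N n Q e)"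
proof
  show "inj_on (\<lambda>m. Q ^ m) {..<N}" by (rule power_inj_real[OF Q])
  fix m assume "m < N"
  have "(\<Prod>m'\<in>{..<N} - {m}. \<bar>Q ^ m - Q ^ m'\<bar>) > 0"
    using power_inj_real[OF Q, of UNIV] by (intro prod_pos) (auto simp: inj_on_def)
  then show "schur_weight N n Q e m > 0" unfolding schur_weight_def using Q by simp
qed

text \<open>
  Both Schur polynomials are square roots of squared Vandermonde products, over the particles and
  over the holes. Rewriting the latter one over the particles makes the first one a full square.
\<close>

lemma schur_prob_weight:
  assumes Q: "Q > 0" "Q \<noteq> 1" and n: "n > 0" and k: "k > 0"
    and p: "p = inverse Q \<and> e = k - 1 \<or> p = Q \<and> e = 0"
  shows "\<exists>C>0. \<forall>\<nu>\<in>young_box n k. schur_prob n k (inverse Q) p \<nu> =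
    C * node_weight.sw (\<lambda>m. Q ^ m) (schur_weight (n + k) n Q e) (particles n \<nu>)"
proof -
  let ?N = "n + k" and ?q = "inverse Q" and ?x = "\<lambda>m. Q ^ m"
  let ?X = "{..<?N}"
  have q: "?q > 0" "?q \<noteq> 1" using Q by auto
  have pp: "p > 0" "p \<noteq> 1" using p Q by auto
  obtain c1 where c1: "c1 > 0" "\<And>\<nu>. \<nu> \<in> rows_le n \<Longrightarrow> schur n (\<lambda>i. ?q ^ i) \<nu> = c1 * \<bar>vander n (\<lambda>i. ?q ^ (\<nu> i + n - Suc i))\<bar>"
    using schur_principal_abs[OF q, of n] by blast
  obtain c2 where c2: "c2 > 0" "\<And>\<nu>. \<nu> \<in> rows_le k \<Longrightarrow> schur k (\<lambda>i. p ^ i) \<nu> = c2 * \<bar>vander k (\<lambda>i. p ^ (\<nu> i + k - Suc i))\<bar>"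
    using schur_principal_abs[OF pp, of k] by blast
  define Zp where "Zp = (\<Prod>i<n. \<Prod>j<k. ?q ^ i + p ^ j)"
  have Zp: "Zp > 0" unfolding Zp_def using q pp by (intro prod_pos ballI add_pos_pos) auto
  define E where "E = (\<Prod>m\<in>?X. ?x m ^ e)"
  have E: "E > 0" unfolding E_def using Q by (intro prod_pos) auto
  define G where "G = sqrt (gaps ?x ?X)"
  have G: "G > 0"
    unfolding G_def gaps_def using power_inj_real[OF Q, of UNIV]
    by (auto intro!: prod_pos simp: inj_on_def)
  define W where "W = (\<lambda>m. \<Prod>m'\<in>?X - {m}. \<bar>?x m - ?x m'\<bar>)"
  show ?thesis
  proof (intro exI[of _ "c1 * c2 * G / (Zp * E)"] conjI ballI)
    show "c1 * c2 * G / (Zp * E) > 0" using c1 c2 G Zp E by simp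
    fix \<nu> assume \<nu>: "\<nu> \<in> young_box n k"
    let ?A = "particles n \<nu>" and ?B = "?X - particles n \<nu>"
    have A: "?A \<subseteq> ?X" "card ?A = n" using particles_ens[OF \<nu>] .
    have finA: "finite ?A" using A by (auto intro: finite_subset)
    have cardB: "card ?B = k" using A finA by (subst card_Diff_subset) auto
    have an: "antimono \<nu>" using \<nu> by (simp add: young_box_def)
    let ?c = "Defs.conjugate (box_complement n k \<nu>)"
    have anc: "antimono ?c" using conjugate_complement_rows_le by (simp add: rows_le_def)
    have s1: "schur n (\<lambda>i. ?q ^ i) \<nu> = c1 * sqrt (gaps (\<lambda>m. ?q ^ m) ?A)"
      unfolding c1(2)[OF young_box_rows_le[OF \<nu>]] particles_def
      by (subst vander_gaps[OF particle_inj[OF an], where z = "\<lambda>m. ?q ^ m"]) (rule refl)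
    have s2: "schur k (\<lambda>i. p ^ i) ?c = c2 * sqrt (gaps (\<lambda>m. p ^ m) ?B)"
      unfolding c2(2)[OF conjugate_complement_rows_le] holes[OF \<nu>, symmetric]
      by (subst vander_gaps[OF particle_inj[OF anc], where z = "\<lambda>m. p ^ m"]) (simp add: particles_def[of k])
    have gA: "sqrt (gaps (\<lambda>m. ?q ^ m) ?A) = sqrt (gaps ?x ?A) / (\<Prod>m\<in>?A. ?x m ^ (n - 1))"
    proof -
      have "gaps (\<lambda>m. ?q ^ m) ?A = gaps ?x ?A / (\<Prod>m\<in>?A. ?x m ^ (n - 1))\<^sup>2"
        using gaps_inverse[OF finA, of ?x] Q A by (simp add: power_inverse)
      moreover have "(\<Prod>m\<in>?A. ?x m ^ (n - 1)) \<ge> 0" using Q by (intro prod_nonneg) auto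
      ultimately show ?thesis by (simp add: real_sqrt_divide)
    qed
    have gB: "sqrt (gaps (\<lambda>m. p ^ m) ?B) = sqrt (gaps ?x ?B) / (\<Prod>m\<in>?B. ?x m ^ e)"
      using p
    proof
      assume "p = inverse Q \<and> e = k - 1"
      then have "gaps (\<lambda>m. p ^ m) ?B = gaps ?x ?B / (\<Prod>m\<in>?B. ?x m ^ e)\<^sup>2"
        using gaps_inverse[of ?B ?x] Q cardB by (simp add: power_inverse)
      moreover have "(\<Prod>m\<in>?B. ?x m ^ e) \<ge> 0" using Q by (intro prod_nonneg) auto
      ultimately show ?thesis by (simp add: real_sqrt_divide)
    qed simp
    have EB: "(\<Prod>m\<in>?B. ?x m ^ e) = E / (\<Prod>m\<in>?A. ?x m ^ e)"
    proof -
      have "E = (\<Prod>m\<in>?B. ?x m ^ e) * (\<Prod>m\<in>?A. ?x m ^ e)"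
        unfolding E_def by (rule prod.subset_diff[OF A(1)]) simp
      moreover have "(\<Prod>m\<in>?A. ?x m ^ e) > 0" using Q by (intro prod_pos) auto
      ultimately show ?thesis by simp
    qed
    have gAB: "sqrt (gaps ?x ?A) * sqrt (gaps ?x ?B) = G * (gaps ?x ?A / (\<Prod>m\<in>?A. W m))"
    proof -
      have "sqrt (gaps ?x ?A * gaps ?x ?B) = sqrt (gaps ?x ?X * (gaps ?x ?A / (\<Prod>m\<in>?A. W m))\<^sup>2)"
        unfolding W_def by (subst gaps_complement[OF _ A(1) power_inj_real[OF Q]]) auto
      moreover have "gaps ?x ?A / (\<Prod>m\<in>?A. W m) \<ge> 0"
        unfolding W_def by (intro divide_nonneg_nonneg gaps_nonneg prod_nonneg) auto
      ultimately show ?thesis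
        unfolding G_def by (simp only: real_sqrt_mult real_sqrt_abs abs_of_nonneg)
    qed
    have "schur_prob n k ?q p \<nu> = c1 * sqrt (gaps (\<lambda>m. ?q ^ m) ?A) * (c2 * sqrt (gaps (\<lambda>m. p ^ m) ?B)) / Zp"
      unfolding schur_prob_def s1 s2 Zp_def ..
    also have "\<dots> = c1 * c2 / Zp * (sqrt (gaps ?x ?A) * sqrt (gaps ?x ?B)) / (\<Prod>m\<in>?A. ?x m ^ (n - 1)) * ((\<Prod>m\<in>?A. ?x m ^ e) / E)"
      unfolding gA gB EB by (simp add: mult_ac)
    also have "\<dots> = c1 * c2 * G / (Zp * E) * ((\<Prod>m\<in>?A. ?x m ^ e) / ((\<Prod>m\<in>?A. ?x m ^ (n - 1)) * (\<Prod>m\<in>?A. W m)) * gaps ?x ?A)"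
      unfolding gAB by (simp add: mult_ac)
    also have "(\<Prod>m\<in>?A. ?x m ^ e) / ((\<Prod>m\<in>?A. ?x m ^ (n - 1)) * (\<Prod>m\<in>?A. W m)) * gaps ?x ?A =
        node_weight.sw ?x (schur_weight ?N n Q e) ?A"
      unfolding node_weight.sw_def[OF node_weight_q[OF Q]] schur_weight_def gaps_def W_def
      by (simp add: prod_dividef prod.distrib)
    finally show "schur_prob n k ?q p \<nu> = c1 * c2 * G / (Zp * E) * node_weight.sw ?x (schur_weight ?N n Q e) ?A" .
  qed
qed

section \<open>The law of the random diagram\<close>

text \<open>
  The law is discrete, so every function of the diagram is integrated by a finite sum, whatever the
  underlying probability space.
\<close>

lemma integral_random_diagram:
  fixes F :: "(nat \<Rightarrow> nat) \<Rightarrow> 'b :: {banach, second_countable_topology}"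
  assumes rd: "random_diagram M \<Lambda> n k q p"
  shows "integral\<^sup>L M (\<lambda>\<omega>. F (\<Lambda> \<omega>)) = (\<Sum>\<nu>\<in>young_box n k. schur_prob n k q p \<nu> *\<^sub>R F \<nu>)"
proof -
  interpret prob_space M using rd by (simp add: random_diagram_def)
  have L: "\<Lambda> \<in> measurable M (count_space (young_box n k))" using rd by (simp add: random_diagram_def)
  define A where "A = (\<lambda>\<nu>. {\<omega> \<in> space M. \<Lambda> \<omega> = \<nu>})"
  have A: "A \<nu> \<in> sets M" if "\<nu> \<in> young_box n k" for \<nu>
  proof -
    have "A \<nu> = \<Lambda> -` {\<nu>} \<inter> space M" by (auto simp: A_def)
    then show ?thesis using measurable_sets[OF L, of "{\<nu>}"] that by simp
  qed
  have "integral\<^sup>L M (\<lambda>\<omega>. F (\<Lambda> \<omega>)) = integral\<^sup>L M (\<lambda>\<omega>. \<Sum>\<nu>\<in>young_box n k. indicator (A \<nu>) \<omega> *\<^sub>R F \<nu>)"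
  proof (rule Bochner_Integration.integral_cong[OF refl])
    fix \<omega> assume w: "\<omega> \<in> space M"
    then have in_box: "\<Lambda> \<omega> \<in> young_box n k" using measurable_space[OF L w] by simp
    have "(\<Sum>\<nu>\<in>young_box n k. indicator (A \<nu>) \<omega> *\<^sub>R F \<nu>) = (\<Sum>\<nu>\<in>{\<Lambda> \<omega>}. indicator (A \<nu>) \<omega> *\<^sub>R F \<nu>)"
      using in_box finite_young_box by (intro sum.mono_neutral_right) (auto simp: A_def)
    then show "F (\<Lambda> \<omega>) = (\<Sum>\<nu>\<in>young_box n k. indicator (A \<nu>) \<omega> *\<^sub>R F \<nu>)"
      using w by (simp add: A_def)
  qed
  also have "\<dots> = (\<Sum>\<nu>\<in>young_box n k. integral\<^sup>L M (\<lambda>\<omega>. indicator (A \<nu>) \<omega> *\<^sub>R F \<nu>))"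
    using A by (intro Bochner_Integration.integral_sum integrable_scaleR_left integrable_real_indicator)
      (auto simp: emeasure_finite less_top[symmetric])
  also have "\<dots> = (\<Sum>\<nu>\<in>young_box n k. schur_prob n k q p \<nu> *\<^sub>R F \<nu>)"
  proof (rule sum.cong[OF refl])
    fix \<nu> assume \<nu>: "\<nu> \<in> young_box n k"
    have "integral\<^sup>L M (\<lambda>\<omega>. indicator (A \<nu>) \<omega> *\<^sub>R F \<nu>) = measure M (A \<nu>) *\<^sub>R F \<nu>"
      using A[OF \<nu>] by (subst integral_scaleR_left)
        (auto simp: emeasure_finite less_top[symmetric] intro!: integrable_real_indicator)
    also have "measure M (A \<nu>) = schur_prob n k q p \<nu>" using rd \<nu> by (simp add: random_diagram_def A_def)
    finally show "integral\<^sup>L M (\<lambda>\<omega>. indicator (A \<nu>) \<omega> *\<^sub>R F \<nu>) = schur_prob n k q p \<nu> *\<^sub>R F \<nu>" .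
  qed
  finally show ?thesis .
qed

lemma integral_ensemble:
  fixes F :: "nat set \<Rightarrow> 'b :: {banach, second_countable_topology}"
  assumes rd: "random_diagram M \<Lambda> n k (inverse Q) p"
    and Q: "Q > 0" "Q \<noteq> 1" and n: "n > 0" and k: "k > 0"
    and p: "p = inverse Q \<and> e = k - 1 \<or> p = Q \<and> e = 0"
  shows "integral\<^sup>L M (\<lambda>\<omega>. F (particles n (\<Lambda> \<omega>))) =
    (\<Sum>S\<in>node_weight.ens (n + k) n. (node_weight.sw (\<lambda>m. Q ^ m) (schur_weight (n + k) n Q e) S /
       node_weight.Zn (n + k) (\<lambda>m. Q ^ m) (schur_weight (n + k) n Q e) n) *\<^sub>R F S)"
proof -
  interpret W: node_weight "n + k" "\<lambda>m. Q ^ m" "schur_weight (n + k) n Q e" by (rule node_weight_q[OF Q])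
  interpret prob_space M using rd by (simp add: random_diagram_def)
  obtain C where C: "C > 0" "\<And>\<nu>. \<nu> \<in> young_box n k \<Longrightarrow> schur_prob n k (inverse Q) p \<nu> = C * W.sw (particles n \<nu>)"
    using schur_prob_weight[OF Q n k p] by blast
  have bij: "bij_betw (particles n) (young_box n k) (W.ens n)"
    unfolding W.ens_def by (rule particles_bij)
  have *: "integral\<^sup>L M (\<lambda>\<omega>. G (particles n (\<Lambda> \<omega>))) = (\<Sum>S\<in>W.ens n. (C * W.sw S) *\<^sub>R G S)"
    for G :: "nat set \<Rightarrow> 'c :: {banach, second_countable_topology}"
  proof -
    have "integral\<^sup>L M (\<lambda>\<omega>. G (particles n (\<Lambda> \<omega>))) =
        (\<Sum>\<nu>\<in>young_box n k. schur_prob n k (inverse Q) p \<nu> *\<^sub>R G (particles n \<nu>))"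
      by (rule integral_random_diagram[OF rd])
    also have "\<dots> = (\<Sum>\<nu>\<in>young_box n k. (C * W.sw (particles n \<nu>)) *\<^sub>R G (particles n \<nu>))"
      by (intro sum.cong refl) (simp add: C)
    also have "\<dots> = (\<Sum>S\<in>W.ens n. (C * W.sw S) *\<^sub>R G S)"
      by (rule sum.reindex_bij_betw[OF bij])
    finally show ?thesis .
  qed
  have "C * W.Zn n = (\<Sum>S\<in>W.ens n. (C * W.sw S) *\<^sub>R 1)"
    by (simp add: W.Zn_def sum_distrib_left)
  also have "\<dots> = 1" using *[of "\<lambda>_. 1 :: real"] prob_space by simp
  finally have "C = 1 / W.Zn n" using W.Zn_pos[of n] by (simp add: field_simps)
  then show ?thesis using *[of F] by simp
qed

lemma char_random_diagram:
  assumes rd: "random_diagram M \<Lambda> n k (inverse Q) p"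
    and Q: "Q > 0" "Q \<noteq> 1" and n: "n > 0" and k: "k > 0"
    and p: "p = inverse Q \<and> e = k - 1 \<or> p = Q \<and> e = 0"
    and X: "\<And>\<omega>. X \<omega> = (\<Sum>i<n. f (Q ^ (\<Lambda> \<omega> i + n - Suc i)))"
  shows "char (distr M borel (\<lambda>\<omega>. X \<omega> - integral\<^sup>L M X)) t =
    node_weight.centered_char (n + k) (\<lambda>m. Q ^ m) (schur_weight (n + k) n Q e) n (\<lambda>m. f (Q ^ m)) t"
    and "real_distribution (distr M borel (\<lambda>\<omega>. X \<omega> - integral\<^sup>L M X))"
proof -
  interpret W: node_weight "n + k" "\<lambda>m. Q ^ m" "schur_weight (n + k) n Q e" by (rule node_weight_q[OF Q])
  interpret prob_space M using rd by (simp add: random_diagram_def)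
  have L: "\<Lambda> \<in> measurable M (count_space (young_box n k))" using rd by (simp add: random_diagram_def)
  have "(\<lambda>\<nu>. \<Sum>i<n. f (Q ^ (\<nu> i + n - Suc i))) \<in> measurable (count_space (young_box n k)) borel"
    by simp
  from measurable_compose[OF L this] have Xm: "X \<in> borel_measurable M"
    using X by (simp cong: measurable_cong)
  then have Ym: "(\<lambda>\<omega>. X \<omega> - integral\<^sup>L M X) \<in> borel_measurable M" by simp
  show "real_distribution (distr M borel (\<lambda>\<omega>. X \<omega> - integral\<^sup>L M X))"
    using Ym by (rule real_distribution_distr)
  have Xs: "X \<omega> = W.stat (\<lambda>m. f (Q ^ m)) (particles n (\<Lambda> \<omega>))" if "\<omega> \<in> space M" for \<omega>
  proof -
    have "\<Lambda> \<omega> \<in> young_box n k" using measurable_space[OF L that] by simp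
    then have "antimono (\<Lambda> \<omega>)" by (simp add: young_box_def)
    then show ?thesis unfolding X W.stat_def particles_def
      by (subst sum.reindex[OF particle_inj]) (auto simp: o_def)
  qed
  have EX: "integral\<^sup>L M X = W.EE n (W.stat (\<lambda>m. f (Q ^ m)))"
  proof -
    have "integral\<^sup>L M X = integral\<^sup>L M (\<lambda>\<omega>. W.stat (\<lambda>m. f (Q ^ m)) (particles n (\<Lambda> \<omega>)))"
      by (rule Bochner_Integration.integral_cong[OF refl Xs])
    also have "\<dots> = (\<Sum>S\<in>W.ens n. (W.sw S / W.Zn n) *\<^sub>R W.stat (\<lambda>m. f (Q ^ m)) S)"
      by (rule integral_ensemble[OF rd Q n k p])
    finally show ?thesis by (simp add: W.EE_def sum_divide_distrib)
  qed
  have "char (distr M borel (\<lambda>\<omega>. X \<omega> - integral\<^sup>L M X)) t =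
      integral\<^sup>L M (\<lambda>\<omega>. iexp (t * (X \<omega> - integral\<^sup>L M X)))"
    unfolding char_def by (rule integral_distr[OF Ym]) simp
  also have "\<dots> = integral\<^sup>L M (\<lambda>\<omega>. (\<lambda>S. iexp (t * (W.stat (\<lambda>m. f (Q ^ m)) S - integral\<^sup>L M X))) (particles n (\<Lambda> \<omega>)))"
    by (rule Bochner_Integration.integral_cong[OF refl]) (simp add: Xs)
  also have "\<dots> = (\<Sum>S\<in>W.ens n. (W.sw S / W.Zn n) *\<^sub>R iexp (t * (W.stat (\<lambda>m. f (Q ^ m)) S - integral\<^sup>L M X)))"
    by (rule integral_ensemble[OF rd Q n k p])
  also have "\<dots> = W.centered_char n (\<lambda>m. f (Q ^ m)) t"
    unfolding W.centered_char_def EX by (simp add: scaleR_conv_of_real)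
  finally show "char (distr M borel (\<lambda>\<omega>. X \<omega> - integral\<^sup>L M X)) t = W.centered_char n (\<lambda>m. f (Q ^ m)) t" .
qed

section \<open>Recurrence coefficients of the q-Krawtchouk weight\<close>

lemma schur_weight_balance_prod:
  fixes Q :: real
  assumes Q: "Q > 0" and m: "Suc m < N"
  shows "(\<Prod>m'\<in>{..<N} - {Suc m}. \<bar>Q ^ Suc m - Q ^ m'\<bar>) * \<bar>Q ^ m - Q ^ (N - 1)\<bar> =
    \<bar>Q ^ Suc m - 1\<bar> * Q ^ (N - 2) * (\<Prod>m'\<in>{..<N} - {m}. \<bar>Q ^ m - Q ^ m'\<bar>)"
proof -
  obtain N' where N: "N = Suc N'" using m by (cases N) auto
  have mN: "m < N'" using m N by simp
  have s1: "{..<N} - {Suc m} = insert 0 (Suc ` ({..<N'} - {m}))"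
    unfolding N lessThan_Suc_eq_insert_0 by auto
  have s2: "{..<N} - {m} = insert N' ({..<N'} - {m})" using mN by (auto simp: N)
  have "(\<Prod>m'\<in>{..<N} - {Suc m}. \<bar>Q ^ Suc m - Q ^ m'\<bar>) = \<bar>Q ^ Suc m - 1\<bar> * (\<Prod>m'\<in>{..<N'} - {m}. \<bar>Q ^ Suc m - Q ^ Suc m'\<bar>)"
    unfolding s1 by (subst prod.insert) (auto simp: prod.reindex simp del: power_Suc)
  also have "(\<Prod>m'\<in>{..<N'} - {m}. \<bar>Q ^ Suc m - Q ^ Suc m'\<bar>) = (\<Prod>m'\<in>{..<N'} - {m}. Q * \<bar>Q ^ m - Q ^ m'\<bar>)"
    using Q by (intro prod.cong refl) (simp add: abs_mult flip: right_diff_distrib)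
  also have "\<dots> = Q ^ (N' - 1) * (\<Prod>m'\<in>{..<N'} - {m}. \<bar>Q ^ m - Q ^ m'\<bar>)"
    using mN by (simp add: prod.distrib)
  finally have "(\<Prod>m'\<in>{..<N} - {Suc m}. \<bar>Q ^ Suc m - Q ^ m'\<bar>) =
      \<bar>Q ^ Suc m - 1\<bar> * (Q ^ (N' - 1) * (\<Prod>m'\<in>{..<N'} - {m}. \<bar>Q ^ m - Q ^ m'\<bar>))" .
  moreover have "(\<Prod>m'\<in>{..<N} - {m}. \<bar>Q ^ m - Q ^ m'\<bar>) = \<bar>Q ^ m - Q ^ N'\<bar> * (\<Prod>m'\<in>{..<N'} - {m}. \<bar>Q ^ m - Q ^ m'\<bar>)"
    unfolding s2 by (rule prod.insert) auto
  ultimately show ?thesis by (simp add: N)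
qed

text \<open>
  The weight is characterised by a detailed balance relation between neighbouring nodes. It makes
  the operator below symmetric; in the Askey scheme this is the q-Krawtchouk weight, up to the
  normalisation of its variable.
\<close>

locale q_krawtchouk =
  fixes N :: nat and Q R P :: real and w :: "nat \<Rightarrow> real"
  assumes Q: "Q > 0" "Q \<noteq> 1" and R_def: "R = Q ^ (N - 1)" and P: "P > 0"
    and w_pos: "\<And>m. m < N \<Longrightarrow> w m > 0"
    and balance: "\<And>m. Suc m < N \<Longrightarrow> w (Suc m) * (P * (1 - 1 / Q ^ Suc m)) = - w m * (1 - R / Q ^ m)"
begin

sublocale node_weight N "\<lambda>m. Q ^ m" w
  by unfold_locales (use w_pos Q power_inject_exp' in \<open>auto simp: inj_on_def\<close>)

text \<open>
  The operator below maps \<open>x ^ i\<close> to \<open>ev i * x ^ i + lo i * x ^ (i - 1)\<close>.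
\<close>

definition ev :: "nat \<Rightarrow> real" where "ev i = (Q ^ i - 1) - P * (1 / Q ^ i - 1)"
definition lo :: "nat \<Rightarrow> real" where "lo i = - R * (Q ^ i - 1) + P * (1 / Q ^ i - 1)"

text \<open>
  The operator is defined by its action on coefficients, which shows at once that it is triangular;
  its q-difference form follows.
\<close>

definition qop :: "real poly \<Rightarrow> real poly" where
  "qop f = (\<Sum>i\<le>degree f. monom (ev i * coeff f i) i + monom (lo i * coeff f i) (i - 1))"

lemma lo_0: "lo 0 = 0" by (simp add: lo_def)

lemma coeff_qop: "coeff (qop f) i = ev i * coeff f i + lo (Suc i) * coeff f (Suc i)"
proof -
  have "coeff (qop f) i = (\<Sum>j\<le>degree f. (if j = i then ev j * coeff f j else 0) + (if j - 1 = i then lo j * coeff f j else 0))"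
    by (simp add: qop_def coeff_sum)
  also have "\<dots> = (\<Sum>j\<le>degree f. if j = i then ev j * coeff f j else 0) + (\<Sum>j\<le>degree f. if j = Suc i then lo j * coeff f j else 0)"
    unfolding sum.distrib
  proof (intro arg_cong2[where f = "(+)"] sum.cong refl)
    fix j
    show "(if j - 1 = i then lo j * coeff f j else 0) = (if j = Suc i then lo j * coeff f j else 0)"
      by (cases j) (auto simp: lo_0)
  qed
  also have "(\<Sum>j\<le>degree f. if j = i then ev j * coeff f j else 0) = ev i * coeff f i"
    by (auto simp: coeff_eq_0)
  also have "(\<Sum>j\<le>degree f. if j = Suc i then lo j * coeff f j else 0) = lo (Suc i) * coeff f (Suc i)"
    by (auto simp: coeff_eq_0)
  finally show ?thesis .
qed

lemma degree_qop: "degree (qop f) \<le> degree f"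
  by (rule degree_le) (simp add: coeff_qop coeff_eq_0)

lemma poly_qop:
  assumes x: "x \<noteq> 0"
  shows "poly (qop f) x = (1 - R / x) * (poly f (Q * x) - poly f x) - P * (1 - 1 / x) * (poly f (x / Q) - poly f x)"
proof -
  have tm: "(1 - R / x) * ((Q * x) ^ i - x ^ i) - P * (1 - 1 / x) * ((x / Q) ^ i - x ^ i) =
      ev i * x ^ i + lo i * x ^ (i - 1)" for i
  proof (cases i)
    case (Suc j)
    have "x ^ i / x = x ^ j" using x Suc by simp
    have "(1 - R / x) * ((Q * x) ^ i - x ^ i) - P * (1 - 1 / x) * ((x / Q) ^ i - x ^ i) =
      ev i * x ^ i + lo i * (x ^ i / x)"
      unfolding ev_def lo_def power_mult_distrib power_divide by (simp add: algebra_simps diff_divide_distrib add_divide_distrib)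
    then show ?thesis using \<open>x ^ i / x = x ^ j\<close> Suc by simp
  qed (simp add: ev_def lo_def)
  have "poly (qop f) x = (\<Sum>i\<le>degree f. coeff f i * (ev i * x ^ i + lo i * x ^ (i - 1)))"
    by (simp add: qop_def poly_sum poly_monom algebra_simps)
  also have "\<dots> = (\<Sum>i\<le>degree f. (1 - R / x) * (coeff f i * (Q * x) ^ i - coeff f i * x ^ i) -
      P * (1 - 1 / x) * (coeff f i * (x / Q) ^ i - coeff f i * x ^ i))"
    by (intro sum.cong refl) (simp only: tm[symmetric], simp add: algebra_simps)
  also have "\<dots> = (1 - R / x) * (poly f (Q * x) - poly f x) - P * (1 - 1 / x) * (poly f (x / Q) - poly f x)"
    by (simp add: poly_altdef sum_subtractf flip: sum_distrib_left)
  finally show ?thesis .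
qed

text \<open>
  Summation by parts. The boundary terms vanish because \<open>1 - 1 / x\<close> is zero at the first node and
  \<open>1 - R / x\<close> at the last one.
\<close>

lemma ip_qop:
  "ip (qop f) g = - (\<Sum>m<N - 1. w m * (1 - R / Q ^ m) * (poly f (Q ^ Suc m) - poly f (Q ^ m)) * (poly g (Q ^ Suc m) - poly g (Q ^ m)))"
proof (cases N)
  case 0
  then show ?thesis unfolding ip_def by simp
next
  case (Suc N')
  let ?F = "\<lambda>m. poly f (Q ^ m)" and ?G = "\<lambda>m. poly g (Q ^ m)"
  let ?a = "\<lambda>m. w m * (1 - R / Q ^ m) * (?F (Suc m) - ?F m)"
  let ?b = "\<lambda>m. w m * (P * (1 - 1 / Q ^ m)) * (poly f (Q ^ m / Q) - ?F m)"
  have "ip (qop f) g = (\<Sum>m<N. ?a m * ?G m) - (\<Sum>m<N. ?b m * ?G m)"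
    unfolding ip_def sum_subtractf[symmetric]
    by (intro sum.cong refl, subst poly_qop) (use Q in \<open>auto simp: algebra_simps\<close>)
  also have "(\<Sum>m<N. ?a m * ?G m) = (\<Sum>m<N'. ?a m * ?G m)"
    using Q by (simp add: Suc R_def)
  also have "(\<Sum>m<N. ?b m * ?G m) = (\<Sum>m<N'. ?b (Suc m) * ?G (Suc m))"
    unfolding Suc sum.lessThan_Suc_shift by simp
  also have "\<dots> = (\<Sum>m<N'. ?a m * ?G (Suc m))"
  proof (rule sum.cong[OF refl])
    fix m assume "m \<in> {..<N'}"
    then have b0: "?b (Suc m) = (- w m * (1 - R / Q ^ m)) * (poly f (Q ^ Suc m / Q) - ?F (Suc m))"
      using balance[of m] Suc by simp
    have QQ: "Q ^ Suc m / Q = Q ^ m" using Q by simp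
    have sign: "(- u * v) * (p - p') * g = (u * v * (p' - p)) * g" for u v p p' g :: real
      by (simp add: algebra_simps)
    show "?b (Suc m) * ?G (Suc m) = ?a m * ?G (Suc m)" unfolding b0 unfolding QQ by (rule sign)
  qed
  finally show ?thesis
    by (simp add: Suc sum_subtractf[symmetric] sum_negf[symmetric] right_diff_distrib)
qed

lemma ip_qop_sym: "ip (qop f) g = ip f (qop g)"
  by (simp add: ip_commute[of f] ip_qop mult_ac)

text \<open>
  A symmetric operator that does not raise degrees has the orthogonal polynomials as eigenvectors.
\<close>

lemma mop_eigen:
  assumes j: "j < N"
  shows "qop (mop j) = smult (ev j) (mop j)"
proof -
  let ?r = "qop (mop j) - smult (ev j) (mop j)"
  have c: "coeff ?r i = 0" if "j \<le> i" for i
    using that by (cases "i = j") (auto simp: coeff_qop coeff_eq_0)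
  have orth: "ip p ?r = 0" if "degree p < j" for p
  proof -
    have "ip (mop j) (qop p) = 0" "ip (mop j) p = 0"
      using degree_qop[of p] that j by (auto intro!: mop_orth_lower)
    then show ?thesis by (simp add: ip_diff_right ip_smult_right ip_qop_sym[symmetric] ip_commute)
  qed
  have "?r = 0"
  proof (cases "j = 0")
    case True
    then show ?thesis using c by (intro poly_eqI) auto
  next
    case False
    have "degree ?r < j"
    proof (rule degree_lessI)
      show "?r \<noteq> 0 \<or> 0 < j" using False by simp
      show "\<forall>k\<ge>j. coeff ?r k = 0" using c by blast
    qed
    then show ?thesis using orth[of ?r] ip_self_pos[of ?r] j by fastforce
  qed
  then show ?thesis by simp
qed

text \<open>
  The two subleading coefficients of the monic polynomials. Comparing coefficients in the eigenvalue
  equation determines them, and they determine the recurrence coefficients.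
\<close>

definition al :: "nat \<Rightarrow> real" where "al j = coeff (mop (Suc j)) j"
definition ka :: "nat \<Rightarrow> real" where "ka j = coeff (mop (Suc (Suc j))) j"

lemma ev_al: "Suc j < N \<Longrightarrow> al j * (ev (Suc j) - ev j) = lo (Suc j)"
  using arg_cong[OF mop_eigen[of "Suc j"], of "\<lambda>p. coeff p j"]
  by (simp add: coeff_qop al_def algebra_simps)

lemma ev_ka: "Suc (Suc j) < N \<Longrightarrow> ka j * (ev (Suc (Suc j)) - ev j) = lo (Suc j) * al (Suc j)"
  using arg_cong[OF mop_eigen[of "Suc (Suc j)"], of "\<lambda>p. coeff p j"]
  by (simp add: coeff_qop al_def ka_def algebra_simps)

lemma rb_al: "rb (Suc j) = al j - al (Suc j)"
proof -
  have "coeff (pCons 0 (mop (Suc j))) (Suc j) = coeff (mop (Suc (Suc j)) + smult (rb (Suc j)) (mop (Suc j)) +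
      smult (hn (Suc j) / hn j) (mop j)) (Suc j)"
    by (subst X_mop) simp
  then show ?thesis by (simp add: al_def coeff_eq_0)
qed

lemma ra_ka: "Suc (Suc j) < N \<Longrightarrow> (ra (Suc (Suc j)))\<^sup>2 = ka j - ka (Suc j) - rb (Suc (Suc j)) * al (Suc j)"
proof -
  assume j: "Suc (Suc j) < N"
  let ?j = "Suc (Suc j)"
  have "coeff (pCons 0 (mop ?j)) (Suc j) = coeff (mop (Suc ?j) + smult (rb ?j) (mop ?j) +
      smult (hn ?j / hn (Suc j)) (mop (Suc j))) (Suc j)"
    by (subst X_mop) simp
  then have "hn ?j / hn (Suc j) = ka j - ka (Suc j) - rb ?j * al (Suc j)"
    by (simp add: al_def ka_def)
  moreover have "(ra ?j)\<^sup>2 = hn ?j / hn (Suc j)"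
    using hn_pos[of ?j] hn_pos[of "Suc j"] j by (simp add: ra_def)
  ultimately show ?thesis by simp
qed

end

text \<open>
  The classical factors \<open>A\<^sub>j\<close> and \<open>C\<^sub>j\<close> of the recurrence of the q-Krawtchouk polynomials as
  functions of \<open>y = q ^ j\<close>, with \<open>q = 1 / Q\<close>: the diagonal coefficient is \<open>1 - (A\<^sub>j + C\<^sub>j)\<close> and the
  squared off-diagonal one is \<open>A\<^sub>j\<^sub>-\<^sub>1 C\<^sub>j\<close>.
\<close>

definition kA :: "real \<Rightarrow> real \<Rightarrow> real \<Rightarrow> real \<Rightarrow> real" where
  "kA q P R y = (1 - y * R) * (1 + P * y) / ((1 + P * y\<^sup>2) * (1 + P * q * y\<^sup>2))"

definition kC :: "real \<Rightarrow> real \<Rightarrow> real \<Rightarrow> real \<Rightarrow> real" where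
  "kC q P R y = - P * y\<^sup>2 * (R + P * y) * (1 - y) / ((q + P * y\<^sup>2) * (1 + P * y\<^sup>2))"

lemma cancel_common_factor:
  fixes q :: real
  shows "q \<noteq> 0 \<Longrightarrow> - q * u * v / (w * (q * z)) = - u * v / (w * z)"
  by simp

lemma krawtchouk_diag_identity:
  fixes q P R y :: real
  assumes pos: "q > 0" "P > 0" and q1: "q \<noteq> 1"
  shows "- q * (1 - y) * (R + P * y) / ((1 - q) * (q + P * y\<^sup>2)) - (- (1 - q * y) * (R + P * q * y) / ((1 - q) * (1 + P * q * y\<^sup>2)))
    = 1 - (kA q P R y + kC q P R y)"
proof -
  have d: "q + P * y\<^sup>2 \<noteq> 0" "1 + P * y\<^sup>2 \<noteq> 0" "1 + P * q * y\<^sup>2 \<noteq> 0" "1 - q \<noteq> 0"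
    using pos q1 by (smt (verit, ccfv_threshold) mult_nonneg_nonneg zero_le_power2)+
  define d0 d1 d2 where "d0 = q + P * y\<^sup>2" and "d1 = 1 + P * y\<^sup>2" and "d2 = 1 + P * q * y\<^sup>2"
  have nz: "d0 \<noteq> 0" "d1 \<noteq> 0" "d2 \<noteq> 0" using d by (auto simp: d0_def d1_def d2_def)
  have "- q * (1 - y) * (R + P * y) * d1 * d2 + (1 - q * y) * (R + P * q * y) * d0 * d1 =
     (1 - q) * (d0 * d1 * d2 - ((1 - y * R) * (1 + P * y) * d0 + - P * y\<^sup>2 * (R + P * y) * (1 - y) * d2))"
    unfolding d0_def d1_def d2_def by (simp add: power2_eq_square algebra_simps)
  then have "(- q * (1 - y) * (R + P * y) * d1 * d2 + (1 - q * y) * (R + P * q * y) * d0 * d1) / ((1 - q) * d0 * d1 * d2) =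
     (1 - q) * (d0 * d1 * d2 - ((1 - y * R) * (1 + P * y) * d0 + - P * y\<^sup>2 * (R + P * y) * (1 - y) * d2)) / ((1 - q) * d0 * d1 * d2)"
    by simp
  moreover have "(- q * (1 - y) * (R + P * y) * d1 * d2 + (1 - q * y) * (R + P * q * y) * d0 * d1) / ((1 - q) * d0 * d1 * d2) =
     - q * (1 - y) * (R + P * y) / ((1 - q) * d0) - (- (1 - q * y) * (R + P * q * y) / ((1 - q) * d2))"
    using nz d(4) by (simp add: add_divide_distrib diff_divide_distrib del: minus_diff_eq)
  moreover have "(1 - q) * (d0 * d1 * d2 - ((1 - y * R) * (1 + P * y) * d0 + - P * y\<^sup>2 * (R + P * y) * (1 - y) * d2)) / ((1 - q) * d0 * d1 * d2) =
     1 - ((1 - y * R) * (1 + P * y) / (d1 * d2) + - P * y\<^sup>2 * (R + P * y) * (1 - y) / (d0 * d1))"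
    using nz d(4) by (simp add: add_divide_distrib diff_divide_distrib)
  ultimately show ?thesis
    unfolding kA_def kC_def d0_def[symmetric] d1_def[symmetric] d2_def[symmetric] by (simp only:)
qed

lemma krawtchouk_offdiag_identity:
  fixes q P R y :: real
  assumes pos: "q > 0" "P > 0" "y > 0" and q1: "q \<noteq> 1"
  defines "a1 \<equiv> - q * (1 - y) * (R + P * y) / ((1 - q) * (q + P * y\<^sup>2))"
  defines "a2 \<equiv> - (1 - q * y) * (R + P * q * y) / ((1 - q) * (1 + P * q * y\<^sup>2))"
  shows "- q * (q - y) * (q * R + P * y) * a1 / ((1 - q\<^sup>2) * (q\<^sup>2 + P * y\<^sup>2)) -
     - q * (1 - y) * (R + P * y) * a2 / ((1 - q\<^sup>2) * (1 + P * y\<^sup>2)) - (a1 - a2) * a1 =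
     kA q P R (y / q) * kC q P R y"
proof -
  define d0 d1 d2 dm where "d0 = q + P * y\<^sup>2" and "d1 = 1 + P * y\<^sup>2" and "d2 = 1 + P * q * y\<^sup>2" and "dm = q\<^sup>2 + P * y\<^sup>2"
  have q2: "q\<^sup>2 > 0" using pos by simp
  have Py: "P * y\<^sup>2 > 0" "P * q * y\<^sup>2 > 0" using pos by auto
  have "d0 > 0" "d1 > 0" "d2 > 0" "dm > 0"
    unfolding d0_def d1_def d2_def dm_def using pos q2 Py by linarith+
  then have nz: "d0 \<noteq> 0" "d1 \<noteq> 0" "d2 \<noteq> 0" "dm \<noteq> 0" by simp_all
  have q12: "1 - q\<^sup>2 = (1 - q) * (1 + q)" by (simp add: power2_eq_square algebra_simps)
  have nq: "1 - q \<noteq> 0" "1 + q \<noteq> 0" "q \<noteq> 0" using pos q1 by auto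
  have kA': "kA q P R (y / q) = q * (q - y * R) * (q + P * y) / (dm * d0)"
  proof -
    have 1: "1 + P * (y / q)\<^sup>2 = dm / q\<^sup>2" "1 + P * q * (y / q)\<^sup>2 = d0 / q"
      using nq by (simp_all add: dm_def d0_def power2_eq_square field_simps)
    have 2: "1 - y / q * R = (q - y * R) / q" "1 + P * (y / q) = (q + P * y) / q"
      using nq by (simp_all add: field_simps)
    show ?thesis unfolding kA_def 1 2 using nq nz by (simp add: field_simps power2_eq_square)
  qed
  have a1: "a1 = - q * (1 - y) * (R + P * y) / ((1 - q) * d0)" by (simp add: a1_def d0_def)
  have a2: "a2 = - (1 - q * y) * (R + P * q * y) / ((1 - q) * d2)" by (simp add: a2_def d2_def)
  have "q * (q - y) * (q * R + P * y) * d1 * d2 * d0 - (1 - q * y) * (R + P * q * y) * dm * d0 * d0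
      - (1 + q) * dm * d1 * (q * (1 - y) * (R + P * y) * d2 - (1 - q * y) * (R + P * q * y) * d0)
      + (1 - q)\<^sup>2 * (1 + q) * (q - y * R) * (q + P * y) * P * y\<^sup>2 * d2 = 0"
    unfolding d0_def d1_def d2_def dm_def by (simp add: power2_eq_square algebra_simps)
  then have inner: "q * (q - y) * (q * R + P * y) * d1 * d2 * d0 - (1 - q * y) * (R + P * q * y) * dm * d0 * d0
      - (1 + q) * dm * d1 * (q * (1 - y) * (R + P * y) * d2 - (1 - q * y) * (R + P * q * y) * d0) =
      - ((1 - q)\<^sup>2 * (1 + q) * (q - y * R) * (q + P * y) * P * y\<^sup>2 * d2)"
    by (simp only: eq_neg_iff_add_eq_0)
  have key: "(1 - y) * (R + P * y) * q * (
      q * (q - y) * (q * R + P * y) * d1 * d2 * d0 - (1 - q * y) * (R + P * q * y) * dm * d0 * d0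
      - (1 + q) * dm * d1 * (q * (1 - y) * (R + P * y) * d2 - (1 - q * y) * (R + P * q * y) * d0)) =
     - ((1 - y) * (R + P * y) * q * ((1 - q)\<^sup>2 * (1 + q) * (q - y * R) * (q + P * y) * P * y\<^sup>2 * d2))"
    unfolding inner by simp
  define D where "D = (1 - q)\<^sup>2 * (1 + q) * dm * d0\<^sup>2 * d1 * d2"
  have D: "D \<noteq> 0" using nz nq by (simp add: D_def)
  have l1: "- q * (q - y) * (q * R + P * y) * a1 / ((1 - q\<^sup>2) * (q\<^sup>2 + P * y\<^sup>2)) =
      (1 - y) * (R + P * y) * q * (q * (q - y) * (q * R + P * y) * d1 * d2 * d0) / D"
    unfolding a1 q12 dm_def[symmetric] D_def using nz nq by (simp add: divide_simps power2_eq_square)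
  have l2: "- q * (1 - y) * (R + P * y) * a2 / ((1 - q\<^sup>2) * (1 + P * y\<^sup>2)) =
      (1 - y) * (R + P * y) * q * ((1 - q * y) * (R + P * q * y) * dm * d0 * d0) / D"
    unfolding a2 q12 d1_def[symmetric] D_def using nz nq by (simp add: divide_simps power2_eq_square mult_ac del: minus_diff_eq)
  have l3: "(a1 - a2) * a1 =
      (1 - y) * (R + P * y) * q * ((1 + q) * dm * d1 * (q * (1 - y) * (R + P * y) * d2 - (1 - q * y) * (R + P * q * y) * d0)) / D"
    unfolding a1 a2 D_def using nz nq by (simp add: divide_simps power2_eq_square) (simp add: algebra_simps)
  have r: "kA q P R (y / q) * kC q P R y =
      - ((1 - y) * (R + P * y) * q * ((1 - q)\<^sup>2 * (1 + q) * (q - y * R) * (q + P * y) * P * y\<^sup>2 * d2)) / D"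
    unfolding kA' kC_def d0_def[symmetric] d1_def[symmetric] D_def using nz nq by (simp add: divide_simps power2_eq_square)
  show ?thesis unfolding l1 l2 l3 r key[symmetric] by (simp add: diff_divide_distrib right_diff_distrib)
qed

context q_krawtchouk
begin

lemma q_facts: "1 / Q > 0" "1 / Q \<noteq> 1" using Q by auto

lemma al_eq:
  assumes j: "Suc j < N"
  shows "al j = (let q = 1 / Q; y = q ^ Suc j in - q * (1 - y) * (R + P * y) / ((1 - q) * (q + P * y\<^sup>2)))"
proof -
  define q y where "q = 1 / Q" and "y = q ^ Suc j"
  have q: "q > 0" "q \<noteq> 1" using q_facts by (auto simp: q_def)
  have y: "y > 0" using q by (simp add: y_def)
  have Qy: "Q ^ Suc j = 1 / y" "Q ^ j = q / y"
    using Q by (simp_all add: y_def q_def power_divide)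
  have d: "q + P * y\<^sup>2 > 0" using q P y by (intro add_pos_nonneg) auto
  have "ev (Suc j) - ev j = (1 - q) * (q + P * y\<^sup>2) / (q * y)"
    unfolding ev_def Qy using q y by (simp add: field_simps power2_eq_square)
  moreover have "lo (Suc j) = - (1 - y) * (R + P * y) / y"
    unfolding lo_def Qy using y by (simp add: field_simps power2_eq_square)
  ultimately have "al j * ((1 - q) * (q + P * y\<^sup>2) / (q * y)) = - (1 - y) * (R + P * y) / y"
    using ev_al[OF j] by simp
  moreover have nz: "(1 - q) * (q + P * y\<^sup>2) / (q * y) \<noteq> 0" using q y d by simp
  ultimately have "al j = - (1 - y) * (R + P * y) / y / ((1 - q) * (q + P * y\<^sup>2) / (q * y))"
    unfolding nonzero_eq_divide_eq[OF nz] by simp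
  also have "\<dots> = - q * (1 - y) * (R + P * y) / ((1 - q) * (q + P * y\<^sup>2))"
    using q y by (simp add: mult_ac del: minus_diff_eq)
  finally have "al j = - q * (1 - y) * (R + P * y) / ((1 - q) * (q + P * y\<^sup>2))" .
  then show ?thesis unfolding q_def[symmetric] y_def[symmetric] Let_def .
qed

lemma al_Suc_eq:
  assumes j: "Suc (Suc j) < N"
  shows "al (Suc j) = (let q = 1 / Q; y = q ^ Suc j in - (1 - q * y) * (R + P * q * y) / ((1 - q) * (1 + P * q * y\<^sup>2)))"
proof -
  define q y where "q = 1 / Q" and "y = q ^ Suc j"
  have q: "q > 0" "q \<noteq> 1" using q_facts by (auto simp: q_def)
  have d: "1 + P * q * y\<^sup>2 > 0" using q P by (intro add_pos_nonneg) auto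
  have "al (Suc j) = - q * (1 - q * y) * (R + P * (q * y)) / ((1 - q) * (q + P * (q * y)\<^sup>2))"
    using al_eq[of "Suc j"] j unfolding Let_def q_def[symmetric] by (simp add: y_def)
  also have "q + P * (q * y)\<^sup>2 = q * (1 + P * q * y\<^sup>2)" by (simp add: power2_eq_square algebra_simps)
  also have "- q * (1 - q * y) * (R + P * (q * y)) / ((1 - q) * (q * (1 + P * q * y\<^sup>2))) =
      - (1 - q * y) * (R + P * (q * y)) / ((1 - q) * (1 + P * q * y\<^sup>2))"
    using q by (intro cancel_common_factor) simp
  also have "P * (q * y) = P * q * y" by simp
  finally show ?thesis unfolding q_def[symmetric] y_def[symmetric] Let_def .
qed

lemma rb_krawtchouk:
  assumes j: "0 < j" "Suc j < N"
  shows "rb j = 1 - (kA (1 / Q) P R ((1 / Q) ^ j) + kC (1 / Q) P R ((1 / Q) ^ j))"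
proof -
  obtain i where i: "j = Suc i" using j by (cases j) auto
  define q y where "q = 1 / Q" and "y = q ^ j"
  have a1: "al i = - q * (1 - y) * (R + P * y) / ((1 - q) * (q + P * y\<^sup>2))"
    using al_eq[of i] j unfolding Let_def q_def[symmetric] i[symmetric] y_def[symmetric] by simp
  have a2: "al j = - (1 - q * y) * (R + P * q * y) / ((1 - q) * (1 + P * q * y\<^sup>2))"
    using al_Suc_eq[of i] j unfolding Let_def q_def[symmetric] i[symmetric] y_def[symmetric] by simp
  have "rb j = al i - al j" using rb_al[of i] by (simp add: i)
  also have "\<dots> = 1 - (kA q P R y + kC q P R y)"
    unfolding a1 a2 by (rule krawtchouk_diag_identity) (use q_facts P in \<open>auto simp: q_def\<close>)
  finally show ?thesis by (simp add: q_def y_def)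
qed

lemma ka_eq:
  assumes j: "Suc (Suc j) < N"
  shows "ka j = (let q = 1 / Q; y = q ^ Suc (Suc j) in - q * (q - y) * (q * R + P * y) * al (Suc j) / ((1 - q\<^sup>2) * (q\<^sup>2 + P * y\<^sup>2)))"
proof -
  define q y where "q = 1 / Q" and "y = q ^ Suc (Suc j)"
  have q: "q > 0" "q \<noteq> 1" using q_facts by (auto simp: q_def)
  have y: "y > 0" using q by (simp add: y_def)
  have Qy: "Q ^ Suc (Suc j) = 1 / y" "Q ^ Suc j = q / y" "Q ^ j = q\<^sup>2 / y"
    using Q by (simp_all add: y_def q_def power_divide power2_eq_square)
  have d: "q\<^sup>2 + P * y\<^sup>2 > 0" using q P y by (intro add_pos_nonneg) auto
  have q2: "1 - q\<^sup>2 \<noteq> 0" using q by (simp add: power2_eq_1_iff)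
  have "ev (Suc (Suc j)) - ev j = (1 - q\<^sup>2) * (q\<^sup>2 + P * y\<^sup>2) / (q\<^sup>2 * y)"
    unfolding ev_def Qy using q y by (simp add: field_simps power2_eq_square)
  moreover have "lo (Suc j) = - (q - y) * (q * R + P * y) / (q * y)"
    unfolding lo_def Qy using q y by (simp add: field_simps power2_eq_square)
  ultimately have "ka j * ((1 - q\<^sup>2) * (q\<^sup>2 + P * y\<^sup>2) / (q\<^sup>2 * y)) = - (q - y) * (q * R + P * y) / (q * y) * al (Suc j)"
    using ev_ka[OF j] by simp
  moreover have nz: "(1 - q\<^sup>2) * (q\<^sup>2 + P * y\<^sup>2) / (q\<^sup>2 * y) \<noteq> 0" using q y d q2 by simp
  ultimately have "ka j = - (q - y) * (q * R + P * y) / (q * y) * al (Suc j) / ((1 - q\<^sup>2) * (q\<^sup>2 + P * y\<^sup>2) / (q\<^sup>2 * y))"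
    unfolding nonzero_eq_divide_eq[OF nz] by simp
  also have "\<dots> = - q * (q - y) * (q * R + P * y) * al (Suc j) / ((1 - q\<^sup>2) * (q\<^sup>2 + P * y\<^sup>2))"
    using q y by (simp add: power2_eq_square mult_ac del: minus_diff_eq)
  finally show ?thesis unfolding q_def[symmetric] y_def[symmetric] Let_def .
qed

lemma ka_Suc_eq:
  assumes j: "Suc (Suc (Suc j)) < N"
  shows "ka (Suc j) = (let q = 1 / Q; y = q ^ Suc (Suc j) in - q * (1 - y) * (R + P * y) * al (Suc (Suc j)) / ((1 - q\<^sup>2) * (1 + P * y\<^sup>2)))"
proof -
  define q y where "q = 1 / Q" and "y = q ^ Suc (Suc j)"
  have q: "q > 0" "q \<noteq> 1" using q_facts by (auto simp: q_def)
  have "ka (Suc j) = - q * (q - q * y) * (q * R + P * (q * y)) * al (Suc (Suc j)) / ((1 - q\<^sup>2) * (q\<^sup>2 + P * (q * y)\<^sup>2))"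
    using ka_eq[of "Suc j"] j unfolding Let_def q_def[symmetric] by (simp add: y_def)
  also have "q\<^sup>2 + P * (q * y)\<^sup>2 = q\<^sup>2 * (1 + P * y\<^sup>2)" by (simp add: power2_eq_square algebra_simps)
  also have "- q * (q - q * y) * (q * R + P * (q * y)) * al (Suc (Suc j)) = q\<^sup>2 * (- q * (1 - y) * (R + P * y) * al (Suc (Suc j)))"
    by (simp add: power2_eq_square algebra_simps)
  also have "q\<^sup>2 * (- q * (1 - y) * (R + P * y) * al (Suc (Suc j))) / ((1 - q\<^sup>2) * (q\<^sup>2 * (1 + P * y\<^sup>2))) =
      - q * (1 - y) * (R + P * y) * al (Suc (Suc j)) / ((1 - q\<^sup>2) * (1 + P * y\<^sup>2))"
    using q by simp
  finally show ?thesis unfolding q_def[symmetric] y_def[symmetric] Let_def .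
qed

lemma ra_krawtchouk:
  assumes j: "1 < j" "Suc j < N"
  shows "(ra j)\<^sup>2 = kA (1 / Q) P R ((1 / Q) ^ j / (1 / Q)) * kC (1 / Q) P R ((1 / Q) ^ j)"
proof -
  obtain i where i: "j = Suc (Suc i)" using j by (cases j rule: nat.exhaust; cases "j - 1") auto
  define q y where "q = 1 / Q" and "y = q ^ j"
  have y: "y > 0" using q_facts by (simp add: y_def q_def)
  have a1: "al (Suc i) = - q * (1 - y) * (R + P * y) / ((1 - q) * (q + P * y\<^sup>2))"
    using al_eq[of "Suc i"] j unfolding Let_def q_def[symmetric] i[symmetric] y_def[symmetric] by simp
  have a2: "al j = - (1 - q * y) * (R + P * q * y) / ((1 - q) * (1 + P * q * y\<^sup>2))"
    using al_Suc_eq[of "Suc i"] j unfolding Let_def q_def[symmetric] i[symmetric] y_def[symmetric] by simp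
  have k1: "ka i = - q * (q - y) * (q * R + P * y) * al (Suc i) / ((1 - q\<^sup>2) * (q\<^sup>2 + P * y\<^sup>2))"
    using ka_eq[of i] j unfolding Let_def q_def[symmetric] i[symmetric] y_def[symmetric] by simp
  have k2: "ka (Suc i) = - q * (1 - y) * (R + P * y) * al j / ((1 - q\<^sup>2) * (1 + P * y\<^sup>2))"
    using ka_Suc_eq[of i] j unfolding Let_def q_def[symmetric] i[symmetric] y_def[symmetric] by simp
  have "(ra j)\<^sup>2 = ka i - ka (Suc i) - (al (Suc i) - al j) * al (Suc i)"
    using ra_ka[of i] rb_al[of "Suc i"] j by (simp add: i)
  also have "\<dots> = kA q P R (y / q) * kC q P R y"
    unfolding k1 k2 a1 a2
    by (rule krawtchouk_offdiag_identity) (use q_facts P y in \<open>auto simp: q_def\<close>)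
  finally show ?thesis by (simp add: q_def y_def)
qed

end

text \<open>
  The ratio of neighbouring weights telescopes. The parameters are \<open>R = Q ^ (N - 1)\<close>, the last node,
  and a power of \<open>Q\<close> that depends on which of the two measures is considered.
\<close>

lemma schur_weight_krawtchouk:
  fixes Q :: real
  assumes Q: "Q > 0" "Q \<noteq> 1" and n: "n > 0" and e: "e \<le> k"
  shows "q_krawtchouk (n + k) Q (Q ^ (n + k - 1)) (Q ^ (2 * n + k - 2 - e)) (schur_weight (n + k) n Q e)"
proof
  let ?N = "n + k"
  show "Q > 0" "Q \<noteq> 1" by (rule Q)+
  show "Q ^ (2 * n + k - 2 - e) > 0" using Q by simp
  show "schur_weight ?N n Q e m > 0" if "m < ?N" for m
    using node_weight.weight_pos[OF node_weight_q[OF Q] that] .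
  fix m assume m: "Suc m < ?N"
  define W where "W = (\<lambda>m. \<Prod>m'\<in>{..<?N} - {m}. \<bar>Q ^ m - Q ^ m'\<bar>)"
  define A where "A = Q ^ m"
  define R where "R = Q ^ (?N - 1)"
  have W: "W i > 0" for i
    unfolding W_def using power_inj_real[OF Q, of UNIV] by (intro prod_pos) (auto simp: inj_on_def)
  have A: "A > 0" using Q by (simp add: A_def)
  have AR: "A \<noteq> R"
    using power_inj_real[OF Q, of UNIV] m unfolding A_def R_def inj_on_def by force
  have bal: "W (Suc m) * \<bar>A - R\<bar> = \<bar>Q * A - 1\<bar> * Q ^ (?N - 2) * W m"
    using schur_weight_balance_prod[OF Q(1) m] by (simp add: W_def A_def R_def)
  have sgn: "\<bar>Q * A - 1\<bar> * (A - R) = - (Q * A - 1) * \<bar>A - R\<bar>"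
  proof (cases "Q > 1")
    case True
    then have "A \<le> R" unfolding A_def R_def using m by (intro power_increasing) auto
    moreover have "Q * A \<ge> 1" using one_le_power[of Q "Suc m"] True by (simp add: A_def)
    ultimately show ?thesis by (simp add: algebra_simps)
  next
    case False
    then have "R \<le> A" unfolding A_def R_def using m Q by (intro power_decreasing) auto
    moreover have "Q * A \<le> 1" using power_le_one[of Q "Suc m"] False Q by (simp add: A_def)
    ultimately show ?thesis by (simp add: algebra_simps)
  qed
  have key: "Q ^ (?N - 2) * (Q * A - 1) * W m = - W (Suc m) * (A - R)"
  proof -
    have "(Q ^ (?N - 2) * (Q * A - 1) * W m) * \<bar>A - R\<bar> = Q ^ (?N - 2) * W m * ((Q * A - 1) * \<bar>A - R\<bar>)" by simp
    also have "(Q * A - 1) * \<bar>A - R\<bar> = - (\<bar>Q * A - 1\<bar> * (A - R))" unfolding sgn by (simp only: mult_minus_left minus_minus)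
    also have "Q ^ (?N - 2) * W m * - (\<bar>Q * A - 1\<bar> * (A - R)) = - (\<bar>Q * A - 1\<bar> * Q ^ (?N - 2) * W m) * (A - R)" by simp
    also have "\<dots> = (- W (Suc m) * (A - R)) * \<bar>A - R\<bar>" unfolding bal[symmetric] by simp
    finally show ?thesis using AR by (metis mult_right_cancel abs_eq_0 right_minus_eq)
  qed
  have pw: "Q ^ e * Q ^ (2 * n + k - 2 - e) = Q ^ n * Q ^ (?N - 2)"
  proof -
    have "e + (2 * n + k - 2 - e) = n + (?N - 2)" using e n m by linarith
    then show ?thesis by (simp flip: power_add)
  qed
  have qn: "Q ^ n = Q * Q ^ (n - 1)" using n by (cases n) auto
  have wm: "schur_weight ?N n Q e m = A ^ e / (A ^ (n - 1) * W m)"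
    and wS: "schur_weight ?N n Q e (Suc m) = Q ^ e * A ^ e / (Q ^ (n - 1) * A ^ (n - 1) * W (Suc m))"
    by (simp_all add: schur_weight_def W_def A_def power_mult_distrib)
  have "schur_weight ?N n Q e (Suc m) * (Q ^ (2 * n + k - 2 - e) * (1 - 1 / Q ^ Suc m)) =
      (Q ^ e * Q ^ (2 * n + k - 2 - e)) * A ^ e * (Q * A - 1) / (Q ^ (n - 1) * A ^ (n - 1) * W (Suc m) * (Q * A))"
    unfolding wS using A Q W[of "Suc m"] by (simp add: A_def field_simps)
  also have "\<dots> = A ^ e * (Q ^ (?N - 2) * (Q * A - 1) * W m) / (A ^ (n - 1) * W (Suc m) * A * W m)"
    unfolding pw qn using A Q W[of m] W[of "Suc m"] by (simp add: field_simps)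
  also have "\<dots> = - (A ^ e * (A - R) / (A ^ (n - 1) * A * W m))"
    unfolding key using A W[of m] W[of "Suc m"] by (simp add: field_simps)
  also have "\<dots> = - schur_weight ?N n Q e m * (1 - R / Q ^ m)"
    unfolding wm A_def[symmetric] using A W[of m] by (simp add: field_simps)
  finally show "schur_weight ?N n Q e (Suc m) * (Q ^ (2 * n + k - 2 - e) * (1 - 1 / Q ^ Suc m)) =
      - schur_weight ?N n Q e m * (1 - Q ^ (?N - 1) / Q ^ m)" by (simp add: R_def)
qed rule

text \<open>
  In the limit \<open>q \<rightarrow> 1\<close>, \<open>q ^ n \<rightarrow> 1 / A\<close>, \<open>R \<rightarrow> A * C\<close>, the closed forms give the constants of the
  theorem. The two measures differ by the limit of the parameter \<open>P\<close>.
\<close>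

lemma krawtchouk_limit_A:
  fixes \<gamma> c :: real
  defines "A \<equiv> exp \<gamma>" and "C \<equiv> exp (c * \<gamma>)"
  assumes \<gamma>: "\<gamma> \<noteq> 0" and c: "c > 0"
  shows "1 - (kA 1 (A\<^sup>2) (A * C) (1 / A) + kC 1 (A\<^sup>2) (A * C) (1 / A)) = b_A \<gamma> c"
    and "kA 1 (A\<^sup>2) (A * C) (1 / A) * kC 1 (A\<^sup>2) (A * C) (1 / A) = (a_A \<gamma> c)\<^sup>2"
proof -
  have A: "A > 0" by (simp add: A_def)
  have kA: "kA 1 (A\<^sup>2) (A * C) (1 / A) = (1 - C) * (1 + A) / 4"
    unfolding kA_def using A by (simp add: power2_eq_square)
  have kC: "kC 1 (A\<^sup>2) (A * C) (1 / A) = - (C + 1) * (A - 1) / 4"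
    unfolding kC_def using A by (simp add: power2_eq_square field_simps)
  show "1 - (kA 1 (A\<^sup>2) (A * C) (1 / A) + kC 1 (A\<^sup>2) (A * C) (1 / A)) = b_A \<gamma> c"
    unfolding kA kC b_A_def exp_parameters(1) A_def[symmetric] C_def[symmetric] by (simp add: field_simps)
  have "4 * (a_A \<gamma> c)\<^sup>2 = (A - 1) * (A + 1) * (C - 1) * (C + 1) / 4"
    using a_A_square(2)[OF \<gamma> c] unfolding A_def[symmetric] C_def[symmetric] by (simp add: power_mult_distrib)
  then show "kA 1 (A\<^sup>2) (A * C) (1 / A) * kC 1 (A\<^sup>2) (A * C) (1 / A) = (a_A \<gamma> c)\<^sup>2"
    unfolding kA kC by (simp add: field_simps)
qed

lemma krawtchouk_limit_B:
  fixes \<gamma> c :: real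
  defines "A \<equiv> exp \<gamma>" and "C \<equiv> exp (c * \<gamma>)"
  assumes \<gamma>: "\<gamma> \<noteq> 0" and c: "c > 0"
  shows "1 - (kA 1 (A\<^sup>2 * C) (A * C) (1 / A) + kC 1 (A\<^sup>2 * C) (A * C) (1 / A)) = b_B \<gamma> c"
    and "kA 1 (A\<^sup>2 * C) (A * C) (1 / A) * kC 1 (A\<^sup>2 * C) (A * C) (1 / A) = (a_B \<gamma> c)\<^sup>2"
proof -
  have A: "A > 0" "C > 0" by (simp_all add: A_def C_def)
  then have C1: "1 + C \<noteq> 0" by linarith
  have kA: "kA 1 (A\<^sup>2 * C) (A * C) (1 / A) = (1 - C) * (1 + A * C) / (1 + C)\<^sup>2"
    unfolding kA_def using A by (simp add: power2_eq_square)
  have kC: "kC 1 (A\<^sup>2 * C) (A * C) (1 / A) = - 2 * C\<^sup>2 * (A - 1) / (1 + C)\<^sup>2"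
    proof -
    have "1 + A\<^sup>2 * C * (1 / A)\<^sup>2 = 1 + C" "A\<^sup>2 * C * (1 / A)\<^sup>2 = C" using A by (simp_all add: power2_eq_square)
    then show ?thesis unfolding kC_def using A C1 by (simp add: power2_eq_square divide_simps)
  qed
  show "1 - (kA 1 (A\<^sup>2 * C) (A * C) (1 / A) + kC 1 (A\<^sup>2 * C) (A * C) (1 / A)) = b_B \<gamma> c"
    unfolding kA kC b_B_def exp_parameters(1-3) A_def[symmetric] C_def[symmetric] using C1
    by (simp add: divide_simps) (simp add: power2_eq_square algebra_simps)
  have "4 * (a_B \<gamma> c)\<^sup>2 = 8 * C\<^sup>2 * (A - 1) * (C - 1) * (1 + A * C) / ((1 + C)\<^sup>2)\<^sup>2"
    using a_B_square(2)[OF \<gamma> c] unfolding exp_parameters(1) A_def[symmetric] C_def[symmetric]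
    by (simp add: power_mult_distrib)
  then have "(a_B \<gamma> c)\<^sup>2 = 2 * C\<^sup>2 * (A - 1) * (C - 1) * (1 + A * C) / ((1 + C)\<^sup>2 * (1 + C)\<^sup>2)"
    by (simp add: power2_eq_square)
  then show "kA 1 (A\<^sup>2 * C) (A * C) (1 / A) * kC 1 (A\<^sup>2 * C) (A * C) (1 / A) = (a_B \<gamma> c)\<^sup>2"
    unfolding kA kC by (simp add: algebra_simps)
qed

lemma tendsto_kA:
  assumes "(q \<longlongrightarrow> 1) F" "(P \<longlongrightarrow> P0) F" "(R \<longlongrightarrow> R0) F" "(y \<longlongrightarrow> y0) F" "P0 > 0"
  shows "((\<lambda>x. kA (q x) (P x) (R x) (y x)) \<longlongrightarrow> kA 1 P0 R0 y0) F"
proof -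
  have "1 + P0 * y0\<^sup>2 > 0" using assms(5) by (intro add_pos_nonneg) auto
  then show ?thesis unfolding kA_def by (intro tendsto_intros assms) auto
qed

lemma tendsto_kC:
  assumes "(q \<longlongrightarrow> 1) F" "(P \<longlongrightarrow> P0) F" "(R \<longlongrightarrow> R0) F" "(y \<longlongrightarrow> y0) F" "P0 > 0"
  shows "((\<lambda>x. kC (q x) (P x) (R x) (y x)) \<longlongrightarrow> kC 1 P0 R0 y0) F"
proof -
  have "1 + P0 * y0\<^sup>2 > 0" using assms(5) by (intro add_pos_nonneg) auto
  then show ?thesis unfolding kC_def by (intro tendsto_intros assms) auto
qed

text \<open>
  The closed forms are continuous functions of \<open>Q ^ (n + O(1))\<close>, which converges as \<open>n\<close> grows
  because \<open>Q = exp (\<gamma> / n)\<close>. The number \<open>d\<close> is the limit of the exponent of \<open>P\<close> divided by \<open>n\<close>.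
\<close>

lemma krawtchouk_near_toeplitz:
  fixes \<gamma> :: real and k e :: "nat \<Rightarrow> nat"
  assumes \<gamma>: "\<gamma> \<noteq> 0" and k: "filterlim k at_top sequentially"
    and kc: "(\<lambda>n. real (k n) / real n) \<longlonglongrightarrow> c"
    and e: "\<And>n. e n \<le> k n"
    and ec: "(\<lambda>n. real (2 * n + k n - 2 - e n) / real n) \<longlonglongrightarrow> d"
    and a: "a \<ge> 0" "kA 1 (exp (\<gamma> * d)) (exp (\<gamma> * (1 + c))) (exp (- \<gamma>)) * kC 1 (exp (\<gamma> * d)) (exp (\<gamma> * (1 + c))) (exp (- \<gamma>)) = a\<^sup>2"
    and b: "1 - (kA 1 (exp (\<gamma> * d)) (exp (\<gamma> * (1 + c))) (exp (- \<gamma>)) + kC 1 (exp (\<gamma> * d)) (exp (\<gamma> * (1 + c))) (exp (- \<gamma>))) = b"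
    and \<epsilon>: "\<epsilon> > 0"
  shows "eventually (\<lambda>n. near_toeplitz a b (n + k n) (\<lambda>m. exp (\<gamma> / real n) ^ m) n D
      (schur_weight (n + k n) n (exp (\<gamma> / real n)) (e n)) \<epsilon>) sequentially"
proof -
  let ?Q = "\<lambda>n. exp (\<gamma> / real n)"
  let ?R = "\<lambda>n. ?Q n ^ (n + k n - 1)" and ?P = "\<lambda>n. ?Q n ^ (2 * n + k n - 2 - e n)"
  let ?w = "\<lambda>n. schur_weight (n + k n) n (?Q n) (e n)"
  have Qpow: "?Q n ^ m = exp (\<gamma> * (real m / real n))" for n m
    by (simp add: mult.commute flip: exp_of_nat_mult)
  have qpow: "(1 / ?Q n) ^ m = exp (- \<gamma> * (real m / real n))" for n m
    by (simp add: power_divide Qpow exp_minus inverse_eq_divide)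
  have inv_n: "(\<lambda>n. C / real n) \<longlonglongrightarrow> 0" for C by (rule lim_const_over_n)
  have "(\<lambda>n. exp (- (\<gamma> / real n))) \<longlonglongrightarrow> exp (- 0)"
    by (intro tendsto_exp tendsto_minus inv_n)
  then have q_lim: "(\<lambda>n. 1 / ?Q n) \<longlonglongrightarrow> 1" by (simp add: exp_minus inverse_eq_divide)
  have R_lim: "?R \<longlonglongrightarrow> exp (\<gamma> * (1 + c))"
  proof -
    have "(\<lambda>n. 1 + real (k n) / real n - 1 / real n) \<longlonglongrightarrow> 1 + c - 0"
      by (intro tendsto_intros kc inv_n)
    moreover have "eventually (\<lambda>n. 1 + real (k n) / real n - 1 / real n = real (n + k n - 1) / real n) sequentially"
      using eventually_gt_at_top[of 0] by eventually_elim (simp add: of_nat_diff field_simps)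
    ultimately have "(\<lambda>n. real (n + k n - 1) / real n) \<longlonglongrightarrow> 1 + c"
      by (simp add: Lim_transform_eventually)
    then show ?thesis unfolding Qpow by (intro tendsto_intros)
  qed
  have P_lim: "?P \<longlonglongrightarrow> exp (\<gamma> * d)" unfolding Qpow by (intro tendsto_intros ec)
  have y_lim: "(\<lambda>n. (1 / ?Q n) ^ (n - D + i)) \<longlonglongrightarrow> exp (- \<gamma>)" for i
  proof -
    have "(\<lambda>n. 1 + (real i - real D) / real n) \<longlonglongrightarrow> 1 + 0" by (intro tendsto_intros inv_n)
    moreover have "eventually (\<lambda>n. 1 + (real i - real D) / real n = real (n - D + i) / real n) sequentially"
      using eventually_gt_at_top[of 0] eventually_ge_at_top[of D]
      by eventually_elim (simp add: of_nat_diff field_simps)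
    ultimately have "(\<lambda>n. real (n - D + i) / real n) \<longlonglongrightarrow> 1" by (simp add: Lim_transform_eventually)
    then have "(\<lambda>n. exp (- \<gamma> * (real (n - D + i) / real n))) \<longlonglongrightarrow> exp (- \<gamma> * 1)" by (intro tendsto_intros)
    then show ?thesis unfolding qpow by simp
  qed
  have y_lim': "(\<lambda>n. (1 / ?Q n) ^ (n - D + i) / (1 / ?Q n)) \<longlonglongrightarrow> exp (- \<gamma>)" for i
    using tendsto_divide[OF y_lim q_lim] by simp
  have wk: "q_krawtchouk (n + k n) (?Q n) (?R n) (?P n) (?w n)" if "n > 0" for n
    using \<gamma> that by (intro schur_weight_krawtchouk e) auto
  have k_gt: "eventually (\<lambda>n. D + 1 < k n) sequentially"
    using k unfolding filterlim_at_top by (metis (mono_tags, lifting) Suc_eq_plus1 eventually_mono less_eq_Suc_le)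
  have ok: "eventually (\<lambda>n. n > 0 \<and> D + 1 < n \<and> D + 1 < k n) sequentially"
    using eventually_gt_at_top[of 0] eventually_gt_at_top[of "D + 1"] k_gt by eventually_elim simp
  have idx: "i \<le> 2 * D \<Longrightarrow> n > 0 \<and> D + 1 < n \<and> D + 1 < k n \<Longrightarrow>
      1 < n - D + i \<and> Suc (n - D + i) < n + k n" for i n by linarith
  have rb_lim: "(\<lambda>n. node_weight.rb (n + k n) (\<lambda>m. ?Q n ^ m) (?w n) (n - D + i)) \<longlonglongrightarrow> b" if i: "i \<le> 2 * D" for i
  proof -
    let ?y = "\<lambda>n. (1 / ?Q n) ^ (n - D + i)"
    have "(\<lambda>n. 1 - (kA (1 / ?Q n) (?P n) (?R n) (?y n) + kC (1 / ?Q n) (?P n) (?R n) (?y n))) \<longlonglongrightarrow> b"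
      unfolding b[symmetric] by (intro tendsto_intros tendsto_kA tendsto_kC q_lim P_lim R_lim y_lim) auto
    moreover have "eventually (\<lambda>n. 1 - (kA (1 / ?Q n) (?P n) (?R n) (?y n) + kC (1 / ?Q n) (?P n) (?R n) (?y n)) =
        node_weight.rb (n + k n) (\<lambda>m. ?Q n ^ m) (?w n) (n - D + i)) sequentially"
      using ok
    proof eventually_elim
      case (elim n)
      show ?case using idx[OF i elim] elim by (subst q_krawtchouk.rb_krawtchouk[OF wk]) auto
    qed
    ultimately show ?thesis by (rule Lim_transform_eventually)
  qed
  have ra_lim: "(\<lambda>n. node_weight.ra (n + k n) (\<lambda>m. ?Q n ^ m) (?w n) (n - D + i)) \<longlonglongrightarrow> a" if i: "i \<le> 2 * D" for i
  proof -
    let ?y = "\<lambda>n. (1 / ?Q n) ^ (n - D + i)"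
    have "(\<lambda>n. kA (1 / ?Q n) (?P n) (?R n) (?y n / (1 / ?Q n)) * kC (1 / ?Q n) (?P n) (?R n) (?y n)) \<longlonglongrightarrow> a\<^sup>2"
      unfolding a(2)[symmetric] by (intro tendsto_intros tendsto_kA tendsto_kC q_lim P_lim R_lim y_lim y_lim') auto
    then have "(\<lambda>n. sqrt (kA (1 / ?Q n) (?P n) (?R n) (?y n / (1 / ?Q n)) * kC (1 / ?Q n) (?P n) (?R n) (?y n))) \<longlonglongrightarrow> sqrt (a\<^sup>2)"
      by (rule tendsto_real_sqrt)
    moreover have "eventually (\<lambda>n. sqrt (kA (1 / ?Q n) (?P n) (?R n) (?y n / (1 / ?Q n)) * kC (1 / ?Q n) (?P n) (?R n) (?y n)) =
        node_weight.ra (n + k n) (\<lambda>m. ?Q n ^ m) (?w n) (n - D + i)) sequentially"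
      using ok
    proof eventually_elim
      case (elim n)
      interpret q_krawtchouk "n + k n" "?Q n" "?R n" "?P n" "?w n" using elim by (intro wk) simp
      have "ra (n - D + i) \<ge> 0" using idx[OF i elim] by (intro ra_nonneg) simp
      moreover have "(ra (n - D + i))\<^sup>2 = kA (1 / ?Q n) (?P n) (?R n) (?y n / (1 / ?Q n)) * kC (1 / ?Q n) (?P n) (?R n) (?y n)"
        using idx[OF i elim] by (intro ra_krawtchouk) auto
      ultimately show ?case by (intro real_sqrt_unique)
    qed
    ultimately have "(\<lambda>n. node_weight.ra (n + k n) (\<lambda>m. ?Q n ^ m) (?w n) (n - D + i)) \<longlonglongrightarrow> sqrt (a\<^sup>2)"
      by (rule Lim_transform_eventually)
    then show ?thesis using a(1) by simp
  qed
  have "eventually (\<lambda>n. \<forall>i\<in>{..2 * D}. \<bar>node_weight.ra (n + k n) (\<lambda>m. ?Q n ^ m) (?w n) (n - D + i) - a\<bar> \<le> \<epsilon> \<and>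
      \<bar>node_weight.rb (n + k n) (\<lambda>m. ?Q n ^ m) (?w n) (n - D + i) - b\<bar> \<le> \<epsilon>) sequentially"
  proof (rule eventually_ball_finite, simp, intro ballI)
    fix i assume "i \<in> {..2 * D}"
    then have i: "i \<le> 2 * D" by simp
    from tendstoD[OF ra_lim[OF i] \<epsilon>] tendstoD[OF rb_lim[OF i] \<epsilon>]
    show "eventually (\<lambda>n. \<bar>node_weight.ra (n + k n) (\<lambda>m. ?Q n ^ m) (?w n) (n - D + i) - a\<bar> \<le> \<epsilon> \<and>
      \<bar>node_weight.rb (n + k n) (\<lambda>m. ?Q n ^ m) (?w n) (n - D + i) - b\<bar> \<le> \<epsilon>) sequentially"
      by eventually_elim (simp add: dist_real_def)
  qed
  then show ?thesis
    using ok
  proof eventually_elim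
    case (elim n)
    show ?case unfolding near_toeplitz_def
    proof (intro conjI ballI)
      show "D \<le> n" "n + D < n + k n" using elim(2) by auto
      fix l assume "l \<in> {n - D..n + D}"
      then have "l = n - D + (l - (n - D))" "l - (n - D) \<in> {..2 * D}" using elim(2) by auto
      with elim(1) show "\<bar>node_weight.ra (n + k n) (\<lambda>m. ?Q n ^ m) (?w n) l - a\<bar> \<le> \<epsilon>"
        "\<bar>node_weight.rb (n + k n) (\<lambda>m. ?Q n ^ m) (?w n) l - b\<bar> \<le> \<epsilon>" by metis+
    qed
  qed
qed

lemma char_centered_normal:
  "char (centered_normal v) t = of_real (exp (- (sqrt v * t)\<^sup>2 / 2))"
proof -
  have "char (centered_normal v) t = char std_normal_distribution (sqrt v * t)"
    unfolding char_def centered_normal_def by (subst integral_distr) (auto simp: mult_ac)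
  then show ?thesis by (simp add: char_std_normal_distribution)
qed

lemma real_distribution_centered_normal: "real_distribution (centered_normal v)"
proof -
  interpret prob_space std_normal_distribution by (rule prob_space_normal_density) simp
  show ?thesis unfolding centered_normal_def by (rule real_distribution_distr) simp
qed

theorem theorem3:
  fixes c \<gamma> a b :: real
    and k :: "nat \<Rightarrow> nat"
    and q :: "nat \<Rightarrow> real"
    and M :: "nat \<Rightarrow> 'w measure"
    and \<Lambda> :: "nat \<Rightarrow> 'w \<Rightarrow> nat \<Rightarrow> nat"
    and X :: "nat \<Rightarrow> 'w \<Rightarrow> real"
    and f :: "real \<Rightarrow> real"
  assumes "c > 0" and "\<gamma> \<noteq> 0"
    and "filterlim k at_top sequentially"
    and "(\<lambda>n. real (k n) / real n) \<longlonglongrightarrow> c"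
    and "\<And>n. q n = exp (- \<gamma> / real n)"
    and "(\<forall>n>0. random_diagram (M n) (\<Lambda> n) n (k n) (q n) (q n)) \<and>
           a = a_A \<gamma> c \<and> b = b_A \<gamma> c \<or>
         (\<forall>n>0. random_diagram (M n) (\<Lambda> n) n (k n) (q n) (inverse (q n))) \<and>
           a = a_B \<gamma> c \<and> b = b_B \<gamma> c"
    and "f C1_differentiable_on UNIV"
    and "\<And>n \<omega>. X n \<omega> = linear_statistic \<gamma> f n (\<Lambda> n \<omega>)"
  shows "summable (\<lambda>l. real l * (cmod (fourier_coeff a b f l))\<^sup>2) \<and>
    weak_conv_m (\<lambda>n. distr (M n) borel (\<lambda>\<omega>. X n \<omega> - integral\<^sup>L (M n) (X n)))
      (centered_normal (\<Sum>l. real l * (cmod (fourier_coeff a b f l))\<^sup>2))"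
proof -
  obtain f' where "\<And>y. (f has_vector_derivative f' y) (at y)" and f': "continuous_on UNIV f'"
    using assms(7) unfolding C1_differentiable_on_def by auto
  then have f: "(f has_real_derivative f' y) (at y)" for y
    by (simp add: has_real_derivative_iff_has_vector_derivative)
  have contf: "continuous_on UNIV f"
    using f by (meson DERIV_isCont continuous_at_imp_continuous_on)
  let ?Q = "\<lambda>n. exp (\<gamma> / real n)"
  have Q: "?Q n > 0" "n > 0 \<Longrightarrow> ?Q n \<noteq> 1" for n using assms(2) by auto
  have qQ: "q n = inverse (?Q n)" for n by (simp add: assms(5) exp_minus)
  \<comment> \<open>The two cases differ only in the exponent \<open>e\<close> of the weight and the specialisation \<open>p\<close>.\<close>
  obtain e p where e: "\<And>n. e n \<le> k n" and rd: "\<And>n. n > 0 \<Longrightarrow> random_diagram (M n) (\<Lambda> n) n (k n) (q n) (p n)"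
    and p: "\<And>n. p n = inverse (?Q n) \<and> e n = k n - 1 \<or> p n = ?Q n \<and> e n = 0"
    and a: "a > 0"
    and near: "\<And>D \<epsilon>. \<epsilon> > 0 \<Longrightarrow> eventually (\<lambda>n. near_toeplitz a b (n + k n) (\<lambda>m. ?Q n ^ m) n D
      (schur_weight (n + k n) n (?Q n) (e n)) \<epsilon>) sequentially"
  proof -
    have RR: "exp (\<gamma> * (1 + c)) = exp \<gamma> * exp (c * \<gamma>)" "exp (- \<gamma>) = 1 / exp \<gamma>"
      by (simp_all add: algebra_simps exp_minus inverse_eq_divide flip: exp_add)
    have inv_n: "(\<lambda>n. C / real n) \<longlonglongrightarrow> 0" for C by (rule lim_const_over_n)
    show ?thesis
      using assms(6)
    proof (elim disjE conjE)
      assume rd: "\<forall>n>0. random_diagram (M n) (\<Lambda> n) n (k n) (q n) (q n)" and ab: "a = a_A \<gamma> c" "b = b_A \<gamma> c"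
      have kpos: "eventually (\<lambda>n. 0 < k n) sequentially"
        using assms(3)[unfolded filterlim_at_top, THEN spec, of 1] by eventually_elim simp
      have "(\<lambda>n. 2 - 1 / real n) \<longlonglongrightarrow> 2 - 0" by (intro tendsto_intros inv_n)
      moreover have "eventually (\<lambda>n. 2 - 1 / real n = real (2 * n + k n - 2 - (k n - 1)) / real n) sequentially"
        using kpos eventually_gt_at_top[of 0]
      proof eventually_elim
        case (elim n)
        then have "2 * n + k n - 2 - (k n - 1) = 2 * n - 1" by linarith
        then show ?case using elim by (simp add: of_nat_diff field_simps)
      qed
      ultimately have ec: "(\<lambda>n. real (2 * n + k n - 2 - (k n - 1)) / real n) \<longlonglongrightarrow> 2"
        by (simp add: Lim_transform_eventually)
      have PP: "exp (\<gamma> * 2) = (exp \<gamma>)\<^sup>2" by (simp add: power2_eq_square flip: exp_add)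
      show ?thesis
      proof (rule that[of "\<lambda>n. k n - 1" q])
        show "a > 0" using a_A_square(1)[OF assms(2,1)] ab by simp
        show "eventually (\<lambda>n. near_toeplitz a b (n + k n) (\<lambda>m. ?Q n ^ m) n D
            (schur_weight (n + k n) n (?Q n) (k n - 1)) \<epsilon>) sequentially" if "\<epsilon> > 0" for D \<epsilon>
          by (rule krawtchouk_near_toeplitz[OF assms(2,3,4) _ ec _ _ _ that])
             (use krawtchouk_limit_A[OF assms(2,1)] a_A_square(1)[OF assms(2,1)] ab in \<open>auto simp: RR PP\<close>)
      qed (use rd qQ in auto)
    next
      assume rd: "\<forall>n>0. random_diagram (M n) (\<Lambda> n) n (k n) (q n) (inverse (q n))" and ab: "a = a_B \<gamma> c" "b = b_B \<gamma> c"
      have "(\<lambda>n. 2 + real (k n) / real n - 2 / real n) \<longlonglongrightarrow> 2 + c - 0" by (intro tendsto_intros inv_n assms(4))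
      moreover have "eventually (\<lambda>n. 2 + real (k n) / real n - 2 / real n = real (2 * n + k n - 2 - 0) / real n) sequentially"
        using eventually_gt_at_top[of 0] by eventually_elim (simp add: of_nat_diff field_simps)
      ultimately have ec: "(\<lambda>n. real (2 * n + k n - 2 - 0) / real n) \<longlonglongrightarrow> 2 + c"
        by (simp add: Lim_transform_eventually)
      have PP: "exp (\<gamma> * (2 + c)) = (exp \<gamma>)\<^sup>2 * exp (c * \<gamma>)"
        by (simp add: power2_eq_square algebra_simps flip: exp_add)
      show ?thesis
      proof (rule that[of "\<lambda>n. 0" "\<lambda>n. inverse (q n)"])
        show "a > 0" using a_B_square(1)[OF assms(2,1)] ab by simp
        show "eventually (\<lambda>n. near_toeplitz a b (n + k n) (\<lambda>m. ?Q n ^ m) n D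
            (schur_weight (n + k n) n (?Q n) 0) \<epsilon>) sequentially" if "\<epsilon> > 0" for D \<epsilon>
          by (rule krawtchouk_near_toeplitz[OF assms(2,3,4) _ ec _ _ _ that])
             (use krawtchouk_limit_B[OF assms(2,1)] a_B_square(1)[OF assms(2,1)] ab in \<open>auto simp: RR PP\<close>)
      qed (use rd qQ in auto)
    qed
  qed
  have fc: "(cmod (fourier_coeff a b f l))\<^sup>2 = (fcos a b f l)\<^sup>2" for l
    by (simp add: fourier_coeff_eq_fcos[OF contf])
  have sf: "summable (\<lambda>l. real l * (fcos a b f l)\<^sup>2)"
    using a by (intro limit_variance_summable[OF f f']) simp
  have v: "(\<Sum>l. real l * (fcos a b f l)\<^sup>2) = limit_variance a b f" by (simp add: limit_variance_def)
  obtain K where K: "\<And>n m. n > 0 \<Longrightarrow> m < n + k n \<Longrightarrow> \<bar>?Q n ^ m\<bar> \<le> K"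
  proof -
    have "Bseq (\<lambda>n. real (k n) / real n)" using assms(4) by (intro convergent_imp_Bseq convergentI)
    then obtain B where B: "\<And>n. norm (real (k n) / real n) \<le> B" by (auto simp: Bseq_def)
    have "\<bar>?Q n ^ m\<bar> \<le> exp (\<bar>\<gamma>\<bar> * (1 + B))" if n: "n > 0" and m: "m < n + k n" for n m
    proof -
      have "?Q n ^ m = exp (\<gamma> * (real m / real n))" by (simp add: mult.commute flip: exp_of_nat_mult)
      moreover have "real m / real n \<le> 1 + B"
      proof -
        have "real m / real n \<le> (real n + real (k n)) / real n"
          using m n by (intro divide_right_mono) auto
        also have "\<dots> = 1 + real (k n) / real n" using n by (simp add: add_divide_distrib)
        also have "\<dots> \<le> 1 + B" using B[of n] by simp
        finally show ?thesis .
      qed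
      then have "\<gamma> * (real m / real n) \<le> \<bar>\<gamma>\<bar> * (1 + B)" by (intro mult_mono) auto
      ultimately show ?thesis by simp
    qed
    then show ?thesis by (rule that)
  qed
  let ?D = "\<lambda>n. distr (M n) borel (\<lambda>\<omega>. X n \<omega> - integral\<^sup>L (M n) (X n))"
  have Xform: "X n \<omega> = (\<Sum>i<n. f (?Q n ^ (\<Lambda> n \<omega> i + n - Suc i)))" for n \<omega>
    unfolding assms(8) linear_statistic_def point_def
    by (intro sum.cong refl) (simp add: mult.commute flip: exp_of_nat_mult)
  have centered_char_lim: "(\<lambda>\<nu>. node_weight.centered_char (Suc \<nu> + k (Suc \<nu>)) (\<lambda>m. ?Q (Suc \<nu>) ^ m)
      (schur_weight (Suc \<nu> + k (Suc \<nu>)) (Suc \<nu>) (?Q (Suc \<nu>)) (e (Suc \<nu>))) (Suc \<nu>) (\<lambda>m. f (?Q (Suc \<nu>) ^ m)) t) \<longlonglongrightarrow>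
    of_real (exp (- limit_variance a b f * t\<^sup>2 / 2))" for t
  proof (rule C1_clt[OF _ _ _ _ f f'])
    show "node_weight (Suc \<nu> + k (Suc \<nu>)) (\<lambda>m. ?Q (Suc \<nu>) ^ m)
      (schur_weight (Suc \<nu> + k (Suc \<nu>)) (Suc \<nu>) (?Q (Suc \<nu>)) (e (Suc \<nu>)))" for \<nu>
      using Q[of "Suc \<nu>"] by (intro node_weight_q) auto
    show "\<bar>?Q (Suc \<nu>) ^ m\<bar> \<le> K" if "m < Suc \<nu> + k (Suc \<nu>)" for \<nu> m
      using K[of "Suc \<nu>" m] that by simp
    show "eventually (\<lambda>\<nu>. near_toeplitz a b (Suc \<nu> + k (Suc \<nu>)) (\<lambda>m. ?Q (Suc \<nu>) ^ m) (Suc \<nu>) D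
        (schur_weight (Suc \<nu> + k (Suc \<nu>)) (Suc \<nu>) (?Q (Suc \<nu>)) (e (Suc \<nu>))) \<epsilon>) sequentially" if "\<epsilon> > 0" for D \<epsilon>
      using near[OF that, of D] unfolding eventually_sequentially_Suc[of "\<lambda>n. near_toeplitz a b (n + k n) (\<lambda>m. ?Q n ^ m) n D
      (schur_weight (n + k n) n (?Q n) (e n)) \<epsilon>"] .
    show "a \<ge> 0" using a by simp
  qed
  obtain n0 where n0: "\<And>n. n \<ge> n0 \<Longrightarrow> 0 < k n"
  proof -
    have "eventually (\<lambda>n. 1 \<le> k n) sequentially"
      using assms(3)[unfolded filterlim_at_top] by (rule spec)
    then obtain N where "\<forall>n\<ge>N. 1 \<le> k n" by (auto simp: eventually_sequentially)
    then show ?thesis using that[of N] by (simp add: Suc_le_eq)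
  qed
  \<comment> \<open>Small \<open>n\<close>, for which the rectangle may be empty, are skipped.\<close>
  let ?s = "\<lambda>\<nu>. Suc (\<nu> + n0)"
  have rdQ: "random_diagram (M (?s \<nu>)) (\<Lambda> (?s \<nu>)) (?s \<nu>) (k (?s \<nu>)) (inverse (?Q (?s \<nu>))) (p (?s \<nu>))" for \<nu>
    using rd[of "?s \<nu>"] qQ by simp
  have shifted: "weak_conv_m (\<lambda>\<nu>. ?D (?s \<nu>)) (centered_normal (limit_variance a b f))"
  proof (rule levy_continuity)
    show "real_distribution (?D (?s \<nu>))" for \<nu>
      by (rule char_random_diagram(2)[OF rdQ Q(1) Q(2) _ n0 p Xform]) auto
    show "real_distribution (centered_normal (limit_variance a b f))" by (rule real_distribution_centered_normal)
    fix t
    have "char (?D (?s \<nu>)) t = node_weight.centered_char (?s \<nu> + k (?s \<nu>)) (\<lambda>m. ?Q (?s \<nu>) ^ m)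
      (schur_weight (?s \<nu> + k (?s \<nu>)) (?s \<nu>) (?Q (?s \<nu>)) (e (?s \<nu>))) (?s \<nu>) (\<lambda>m. f (?Q (?s \<nu>) ^ m)) t" for \<nu>
      by (rule char_random_diagram(1)[OF rdQ Q(1) Q(2) _ n0 p Xform]) auto
    moreover have "char (centered_normal (limit_variance a b f)) t = of_real (exp (- limit_variance a b f * t\<^sup>2 / 2))"
      using limit_variance_nonneg[OF sf] by (simp add: char_centered_normal power_mult_distrib)
    ultimately show "(\<lambda>\<nu>. char (?D (?s \<nu>)) t) \<longlonglongrightarrow> char (centered_normal (limit_variance a b f)) t"
      using LIMSEQ_ignore_initial_segment[OF centered_char_lim[of t], of n0] by simp
  qed
  have "weak_conv_m ?D (centered_normal (limit_variance a b f))"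
    unfolding weak_conv_m_def weak_conv_def
  proof (intro allI impI)
    fix x assume "isCont (cdf (centered_normal (limit_variance a b f))) x"
    then have "(\<lambda>\<nu>. cdf (?D (?s \<nu>)) x) \<longlonglongrightarrow> cdf (centered_normal (limit_variance a b f)) x"
      by (rule shifted[unfolded weak_conv_m_def weak_conv_def, rule_format])
    then show "(\<lambda>n. cdf (?D n) x) \<longlonglongrightarrow> cdf (centered_normal (limit_variance a b f)) x"
      by - (rule LIMSEQ_offset[where k = "Suc n0"], simp only: add_Suc_right)
  qed
  then show ?thesis unfolding fc v using sf by simp
qed

end
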